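(* Let $n\ge2$ and $s\in(1/2,1)$. Let $u\in BUC(\mathbb{R}^n\times[0,\infty))$ be a constructed viscosity solution (in the sense defined in the context) of $\partial_tu=\Delta^s_\infty u$ in $\mathbb{R}^n\times(0,\infty)$, $u(\cdot,0)=u_0$, with initial data $u_0\in BUC(\mathbb{R}^n)$ such that $u_0\not\equiv0$ and $$0\le u_0(x)\le(1+|x|^2)^{-\frac{1+2s}{2}}\qquad\text{for all }|x|\ge R\ge1 .$$ Then, for all $\tau>0$, there exist constants $C_1,C_2>0$ depending only on $s$, $R$, and $u_0$, such that $$C_1P_s(|x|,t)\le u(x,t)\le C_2P_s(|x|,t)\qquad\text{for all }(x,t)\in\mathbb{R}^n\times[\tau,\infty).$$ Moreover, for all $\tau>0$, there exist constants $\tilde C_1,\tilde C_2>0$ depending only on $s$, $R$, and $u_0$, such that $$\tilde C_1\frac{t}{(t^{1/s}+|x|^2)^{\frac{1+2s}{2}}}\le u(x,t)\le\tilde C_2\frac{t}{(t^{1/s}+|x|^2)^{\frac{1+2s}{2}}}\qquad\text{for all }(x,t)\in\mathbb{R}^n\times[\tau,\infty).$$ In particular, $u>0$ in $\mathbb{R}^n\times[\tau,\infty)$.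
   Context: Notation. $C_s=\frac{4^s s\,\Gamma(\frac12+s)}{\pi^{1/2}\Gamma(1-s)}$. $BUC$: bounded uniformly continuous functions. $P_s(x,t)=\mathcal{F}^{-1}(e^{-|\xi|^{2s}t})(x)$, $x\in\mathbb{R}$, $t>0$, is the fundamental solution of the one-dimensional fractional heat equation $\partial_tv+(-\partial_{xx}^2)^sv=0$ (heat kernel with total mass $1$). Operator. For $\phi$ bounded on $\mathbb{R}^n$ and $C^{1,1}$ at $x$ (i.e. $|\phi(x+y)-\phi(x)-\nabla\phi(x)\cdot y|\le C_x|y|^2$ for $|y|<\eta_x$, for some $C_x,\eta_x>0$): if $\nabla\phi(x)\ne0$, with $\zeta=\nabla\phi(x)/|\nabla\phi(x)|$, $$\Delta^s_\infty\phi(x)=C_s\int_0^\infty(\phi(x+\eta\zeta)+\phi(x-\eta\zeta)-2\phi(x))\frac{d\eta}{\eta^{1+2s}};$$ if $\nabla\phi(x)=0$, $$\Delta^s_\infty\phi(x)=C_s\sup_{|y|=1}\int_0^\infty(\phi(x+\eta y)-\phi(x))\frac{d\eta}{\eta^{1+2s}}+C_s\inf_{|y|=1}\int_0^\infty(\phi(x-\eta y)-\phi(x))\frac{d\eta}{\eta^{1+2s}}.$$ Constructed viscosity solutions. For $\varepsilon>0$ let $$\mathcal{L}_\varepsilon[\phi](x)=C_s\sup_{|y|=1}\inf_{|\tilde y|=1}\int_\varepsilon^\infty(\phi(x+\eta y)+\phi(x-\eta\tilde y)-2\phi(x))\frac{d\eta}{\eta^{1+2s}}.$$ Let $h=h(\varepsilon)>0$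 (time step) satisfy $h\le\frac{s}{C_s}\varepsilon^{2s}$, put $t_j=jh$, and define $U^0_\varepsilon=u_0$, $U^{j+1}_\varepsilon=U^j_\varepsilon+h\,\mathcal{L}_\varepsilon[U^j_\varepsilon]$ for $j=0,1,2,\dots$. Let $u_\varepsilon(x,0)=u_0(x)$ and $u_\varepsilon(x,t)=\frac{t_{j+1}-t}{h}U_\varepsilon^j(x)+\frac{t-t_j}{h}U_\varepsilon^{j+1}(x)$ for $t\in(t_j,t_{j+1}]$. A constructed viscosity solution is a function $u$ on $\mathbb{R}^n\times[0,\infty)$ such that $u_{\varepsilon_k}\to u$ locally uniformly in $\mathbb{R}^n\times[0,\infty)$ for some sequence $\varepsilon_k\to0^+$ (such limits exist along subsequences and are viscosity solutions of the problem).
   Formalization: The initial datum u_0 is assumed nonnegative on all of R^n, not only for |x| ≥ R (otherwise a nonpositive bump inside |x| < R is a counterexample), and the constants may depend on τ, since constants independent of τ are impossible. *)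

theory Defs
  imports "HOL-Analysis.Analysis"
begin

definition BUC :: "('a::metric_space) set \<Rightarrow> ('a \<Rightarrow> real) \<Rightarrow> bool" where
  "BUC S f \<longleftrightarrow> bounded (f ` S) \<and> uniformly_continuous_on S f"

text \<open>For 0 < s < 1 this is the normalising constant of the one-dimensional fractional Laplacian
  \<open>(- d\<^sup>2/dx\<^sup>2)\<^sup>s\<close>, whose symbol is \<open>\<bar>\<xi>\<bar>\<^bsup>2s\<^esup>\<close>.\<close>

definition C_frac :: "real \<Rightarrow> real" where
  "C_frac s = (4 powr s * s * Gamma (1/2 + s)) / (pi powr (1/2) * Gamma (1 - s))"

text \<open>The factor \<open>1 / (2 * pi)\<close> makes \<open>inv_fourier\<close> the inverse of the transform
  \<open>f \<mapsto> \<integral> exp (- \<i> x \<xi>) f(x) dx\<close>.\<close>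

definition inv_fourier :: "(real \<Rightarrow> complex) \<Rightarrow> real \<Rightarrow> complex" where
  "inv_fourier g x =
     complex_of_real (1 / (2 * pi)) * (LINT \<xi>|lborel. exp (\<i> * complex_of_real (x * \<xi>)) * g \<xi>)"

text \<open>The fundamental solution of the one-dimensional fractional heat equation, of total mass 1.
  The symbol is real and even in \<open>\<xi>\<close>, so the inverse transform is real-valued and \<open>Re\<close> only
  adjusts the type.\<close>

definition frac_heat_kernel :: "real \<Rightarrow> real \<Rightarrow> real \<Rightarrow> real" where
  "frac_heat_kernel s x t =
     Re (inv_fourier (\<lambda>\<xi>. complex_of_real (exp (- (\<bar>\<xi>\<bar> powr (2 * s)) * t))) x)"

definition L_eps :: "real \<Rightarrow> real \<Rightarrow> (real^'n \<Rightarrow> real) \<Rightarrow> real^'n \<Rightarrow> real" where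
  "L_eps s \<epsilon> \<phi> x =
     C_frac s * (SUP y\<in>sphere 0 1. INF z\<in>sphere 0 1.
       LINT \<eta>:{\<epsilon><..}|lborel.
         (\<phi> (x + \<eta> *\<^sub>R y) + \<phi> (x - \<eta> *\<^sub>R z) - 2 * \<phi> x) / \<eta> powr (1 + 2 * s))"

primrec scheme :: "real \<Rightarrow> real \<Rightarrow> real \<Rightarrow> (real^'n \<Rightarrow> real) \<Rightarrow> nat \<Rightarrow> real^'n \<Rightarrow> real" where
  "scheme s \<epsilon> h u0 0 = u0"
| "scheme s \<epsilon> h u0 (Suc j) =
     (\<lambda>x. scheme s \<epsilon> h u0 j x + h * L_eps s \<epsilon> (scheme s \<epsilon> h u0 j) x)"

text \<open>For h > 0 and t > 0, the index \<open>j = nat (\<lceil>t / h\<rceil> - 1)\<close> is the unique j with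
  \<open>t \<in> {real j * h <.. real (Suc j) * h}\<close>.\<close>

definition interp_scheme ::
    "real \<Rightarrow> real \<Rightarrow> real \<Rightarrow> (real^'n \<Rightarrow> real) \<Rightarrow> (real^'n) \<times> real \<Rightarrow> real" where
  "interp_scheme s \<epsilon> h u0 = (\<lambda>(x, t).
     if t \<le> 0 then u0 x
     else let j = nat (\<lceil>t / h\<rceil> - 1) in
       (real (Suc j) * h - t) / h * scheme s \<epsilon> h u0 j x
       + (t - real j * h) / h * scheme s \<epsilon> h u0 (Suc j) x)"

text \<open>Functions on \<open>\<real>\<^sup>n \<times> [0,\<infinity>)\<close> are total functions on \<open>(real^'n) \<times> real\<close> of which only the values at
  nonnegative times matter.  The domain is locally compact, so locally uniform convergence is uniform
  convergence on compact subsets.\<close>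

definition constructed_viscosity_solution ::
    "real \<Rightarrow> (real^'n \<Rightarrow> real) \<Rightarrow> ((real^'n) \<times> real \<Rightarrow> real) \<Rightarrow> bool" where
  "constructed_viscosity_solution s u0 u \<longleftrightarrow>
     (\<exists>h :: real \<Rightarrow> real.
        (\<forall>\<epsilon>>0. 0 < h \<epsilon> \<and> h \<epsilon> \<le> s / C_frac s * \<epsilon> powr (2 * s)) \<and>
        (\<exists>e :: nat \<Rightarrow> real.
           (\<forall>k. 0 < e k) \<and> e \<longlonglongrightarrow> 0 \<and>
           (\<forall>K. compact K \<and> K \<subseteq> UNIV \<times> {0..} \<longrightarrow>
              uniform_limit K (\<lambda>k. interp_scheme s (e k) (h (e k)) u0) u sequentially)))"

end

(* Along a radially nonincreasing function the supremum and the infimum in the nonlocal infinity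
   Laplacian are attained in the directions towards and away from the centre, so there the operator
   is the one-dimensional fractional Laplacian of the profile, also for the truncated operator of
   the scheme.  The scheme is monotone under the CFL condition and commutes with constants, hence
   radial profiles that solve the one-dimensional fractional heat equation are barriers, up to a
   consistency error that vanishes in the limit.  The upper barrier is a multiple of the heat kernel
   P(|x|, 1 + k t); the lower one integrates the kernel over a window of fixed width, which starts
   at time d -> 0 essentially as the indicator function of an interval below u0.

   The kernel is a limit of superpositions of Gaussians, because |xi|^(2s) is a Bernstein function
   of xi^2; so it is nonnegative and radially nonincreasing.  Averages of the kernel against
   Gaussians are explicit on the Fourier side and show that the mass outside a ball of radius r is
   comparable to r^(-2s); monotonicity turns this into pointwise two-sided bounds. *)

theory Submission
  imports Defs "HOL-Probability.Probability"
begin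

section \<open>Integrals against the Levy weight\<close>

text \<open>The operator is nonlinear, and what is known of \<open>u\<close> is that it is a limit
  of the explicit scheme. All comparison is therefore done on the grid, with constants fixed before
  \<open>u\<close>. On a barrier the operator becomes linear, but only while the profile is
  nonincreasing in |x|; so unimodality has to hold along the whole flow, and it is proved on the
  Fourier side, where products and limits are easy. Consistency costs a fourth moment of the symbol
  exp(-T |xi|^(2s)), finite only for T > 0, so no barrier can start from a rough datum at time 0.
  From above, the kernel at time 1 has exactly the decay |x|^(-1-2s) allowed to \<open>u0\<close>.
  From below, \<open>u0\<close> may have compact support while every kernel is positive; the
  smoothed indicator exceeds \<open>u0\<close> by at most a constant of order d, which is subtracted
  and disappears as d -> 0. Barriers run at times 1 + k t or d + k t instead of t and may be centred
  off the origin; for t >= \<tau> both changes cost only constants, and so the normalising constant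
  is never evaluated.\<close>

lemma integrable_le:
  fixes f g :: "real \<Rightarrow> real"
  assumes "integrable lborel g" "f \<in> borel_measurable borel" "\<And>x. \<bar>f x\<bar> \<le> g x"
  shows "integrable lborel f"
proof (rule Bochner_Integration.integrable_bound[OF assms(1)])
  have "norm (f x) \<le> norm (g x)" for x
    using assms(3)[of x] by (simp add: order_trans[OF _ abs_ge_self])
  then show "AE x in lborel. norm (f x) \<le> norm (g x)" by simp
qed (use assms in simp)

text \<open>A product majorant makes the double integral absolutely convergent, so each exchange of
  integrals in the proof reduces to measurability, a pointwise bound and two one-dimensional
  integrals.\<close>

lemma fubini_dominated:
  fixes F :: "real \<Rightarrow> real \<Rightarrow> real"
  assumes [measurable]: "case_prod F \<in> borel_measurable (borel \<Otimes>\<^sub>M borel)"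
    and f: "integrable lborel f" and g: "integrable lborel g"
    and le: "\<And>x y. \<bar>F x y\<bar> \<le> f x * g y"
  shows "(\<integral>x. (\<integral>y. F x y \<partial>lborel) \<partial>lborel) = (\<integral>y. (\<integral>x. F x y \<partial>lborel) \<partial>lborel)"
    and "integrable lborel (\<lambda>x. \<integral>y. F x y \<partial>lborel)"
proof -
  have [measurable]: "f \<in> borel_measurable borel" "g \<in> borel_measurable borel"
    using f g by auto
  have i2: "integrable lborel (\<lambda>y. F x y)" for x
    by (rule integrable_le[of "\<lambda>y. f x * g y"]) (use g le in auto)
  have "integrable lborel (\<lambda>x. \<integral>y. \<bar>F x y\<bar> \<partial>lborel)"
  proof (rule integrable_le)
    show "integrable lborel (\<lambda>x. f x * (\<integral>y. g y \<partial>lborel))" using f by simp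
    show "\<bar>\<integral>y. \<bar>F x y\<bar> \<partial>lborel\<bar> \<le> f x * (\<integral>y. g y \<partial>lborel)" for x
    proof -
      have "(\<integral>y. \<bar>F x y\<bar> \<partial>lborel) \<le> (\<integral>y. f x * g y \<partial>lborel)"
        by (rule integral_mono) (use i2 g le in auto)
      then show ?thesis by simp
    qed
  qed auto
  then have "integrable (lborel \<Otimes>\<^sub>M lborel) (case_prod F)"
    by (intro lborel_pair.Fubini_integrable) (use i2 in auto)
  from lborel_pair.Fubini_integral[OF this] lborel_pair.integrable_fst[OF this]
  show "(\<integral>x. (\<integral>y. F x y \<partial>lborel) \<partial>lborel) = (\<integral>y. (\<integral>x. F x y \<partial>lborel) \<partial>lborel)"
    "integrable lborel (\<lambda>x. \<integral>y. F x y \<partial>lborel)" by simp_all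
qed

text \<open>The truncation sits inside the weight, so all integrals run over the whole line. The
  exponent is used with \<open>b = 2 * s\<close> for the operator and with \<open>b = s\<close> for
  the representation of |xi|^(2s) as the power s of xi^2.\<close>

definition levy_weight :: "real \<Rightarrow> real \<Rightarrow> real \<Rightarrow> real" where
  "levy_weight b e r = indicator {e<..} r * r powr (- (1 + b))"

lemma levy_weight_measurable [measurable]: "levy_weight b e \<in> borel_measurable borel"
  unfolding levy_weight_def by measurable

lemma levy_weight_nonneg [simp]: "0 \<le> levy_weight b e r"
  by (simp add: levy_weight_def)

lemma levy_weight_eq_0: "r \<le> e \<Longrightarrow> levy_weight b e r = 0"
  by (simp add: levy_weight_def)

lemma levy_weight_mono: "e' \<le> e \<Longrightarrow> levy_weight b e r \<le> levy_weight b e' r"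
  by (simp add: levy_weight_def indicator_def)

lemma levy_weight_tail:
  assumes "0 < b" "0 < e"
  shows "has_bochner_integral lborel (levy_weight b e) (e powr (- b) / b)"
proof -
  have "((\<lambda>x. x powr (- (1 + b))) has_integral -(e powr (- (1 + b) + 1)) / (- (1 + b) + 1)) {e..}"
    by (rule has_integral_powr_to_inf) (use assms in auto)
  also have "-(e powr (- (1 + b) + 1)) / (- (1 + b) + 1) = e powr (-b) / b" by simp
  finally have "((\<lambda>x. x powr (- (1 + b))) has_integral (e powr (-b) / b)) {e..}" .
  then have "integral\<^sup>N lborel (\<lambda>x. indicator {e..} x * (x powr (- (1 + b)))) = e powr (-b) / b"
    by (intro nn_integral_has_integral_lebesgue) auto
  moreover have "AE x in lborel. x \<noteq> e" by (rule AE_lborel_singleton)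
  then have "integral\<^sup>N lborel (\<lambda>x. indicator {e..} x * (x powr (- (1 + b)))) = integral\<^sup>N lborel (levy_weight b e)"
    by (intro nn_integral_cong_AE, eventually_elim) (auto simp: levy_weight_def indicator_def)
  ultimately show ?thesis
    using assms by (intro has_bochner_integral_nn_integral) auto
qed

lemma powr_weight_near_0:
  fixes a c :: real
  assumes "-1 < a" "0 \<le> c"
  shows "has_bochner_integral lborel (\<lambda>x. indicator {0..c} x * x powr a) (c powr (a + 1) / (a + 1))"
proof -
  have "integral\<^sup>N lborel (\<lambda>x. indicat_real {0..c} x * x powr a) = c powr (a + 1) / (a + 1)"
    by (intro nn_integral_has_integral_lebesgue has_integral_powr_from_0) (use assms in auto)
  then show ?thesis
    using assms by (intro has_bochner_integral_nn_integral) auto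
qed

lemma levy_weight_integrable_bounded:
  assumes "0 < b" "0 < e" and [measurable]: "f \<in> borel_measurable borel" and f: "\<And>r. \<bar>f r\<bar> \<le> M"
  shows "integrable lborel (\<lambda>r. levy_weight b e r * f r)"
proof (rule integrable_le)
  show "integrable lborel (\<lambda>r. levy_weight b e r * M)"
    using levy_weight_tail[OF assms(1,2)] by (auto dest: integrable.intros)
  show "\<bar>levy_weight b e r * f r\<bar> \<le> levy_weight b e r * M" for r
    using f by (simp add: abs_mult mult_left_mono)
qed auto

lemma levy_weight_integrable:
  assumes "0 < b" "b < c" and [measurable]: "f \<in> borel_measurable borel" and "\<And>r. \<bar>f r\<bar> \<le> M"
    and "\<And>r. 0 < r \<Longrightarrow> \<bar>f r\<bar> \<le> M * r powr c" and e: "0 \<le> e"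
  shows "integrable lborel (\<lambda>r. levy_weight b e r * f r)"
proof (rule integrable_le)
  show "integrable lborel (\<lambda>r. M * (indicator {0..1} r * r powr (c - b - 1)) + M * levy_weight b 1 r)"
    using levy_weight_tail[of b 1] powr_weight_near_0[of "c - b - 1" 1] assms
    by (auto dest: integrable.intros intro!: Bochner_Integration.integrable_add integrable_mult_right)
  have M: "0 \<le> M" using assms(4)[of 0] by linarith
  show "\<bar>levy_weight b e r * f r\<bar> \<le> M * (indicator {0..1} r * r powr (c - b - 1)) + M * levy_weight b 1 r" for r
  proof (cases "r > e")
    case False
    then show ?thesis using M by (simp add: levy_weight_def)
  next
    case True
    then have r: "r > 0" using e by simp
    show ?thesis
    proof (cases "r \<le> 1")
      case True
      have "\<bar>f r\<bar> * r powr (- (1 + b)) \<le> M * r powr c * r powr (- (1 + b))"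
        using assms(5)[of r] r by (intro mult_right_mono) auto
      also have "\<dots> = M * r powr (c - b - 1)" by (simp add: powr_add[symmetric] algebra_simps)
      finally show ?thesis using r True M \<open>r > e\<close> by (auto simp: levy_weight_def abs_mult mult.commute)
    next
      case False
      have "\<bar>f r\<bar> * r powr (- (1 + b)) \<le> M * r powr (- (1 + b))"
        using assms(4)[of r] r by (intro mult_right_mono) auto
      then show ?thesis using r False M \<open>r > e\<close> by (auto simp: levy_weight_def abs_mult mult.commute)
    qed
  qed
qed auto

text \<open>Homogeneity of the untruncated weight. It produces the pure powers of |xi|, both in the
  Bernstein representation and in the symbol of the operator.\<close>

lemma levy_weight_scale:
  assumes "0 < a"
  shows "(\<integral>r. levy_weight b 0 r * f (a * r) \<partial>lborel) = a powr b * (\<integral>r. levy_weight b 0 r * f r \<partial>lborel)"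
proof -
  have *: "levy_weight b 0 (a * r) = a powr (- (1 + b)) * levy_weight b 0 r" for r
    using assms by (auto simp: levy_weight_def indicator_def powr_mult zero_less_mult_iff)
  have "(\<integral>r. levy_weight b 0 r * f r \<partial>lborel) = a * (\<integral>r. levy_weight b 0 (a * r) * f (a * r) \<partial>lborel)"
    using assms by (subst lborel_integral_real_affine[of a _ 0]) auto
  also have "\<dots> = a * (a powr (- (1 + b)) * (\<integral>r. levy_weight b 0 r * f (a * r) \<partial>lborel))"
    unfolding * by (simp add: mult.assoc)
  also have "\<dots> = a powr (-b) * (\<integral>r. levy_weight b 0 r * f (a * r) \<partial>lborel)"
    using assms powr_add[of a 1 "- (1 + b)"] by simp
  finally show ?thesis using assms by (simp add: powr_minus field_simps)
qed

lemma integrable_inverse_square: "integrable lborel (\<lambda>x::real. inverse (1 + x\<^sup>2))"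
  using integrable_inverse_1_plus_square
  by (simp add: set_integrable_def einterval_eq_UNIV)

section \<open>Symbols with radially nonincreasing transform\<close>

text \<open>For even \<open>g\<close> this is the Fourier transform without the factor 1/(2 pi); the
  cosine keeps the analysis real.\<close>

definition cos_transform :: "(real \<Rightarrow> real) \<Rightarrow> real \<Rightarrow> real" where
  "cos_transform g x = (\<integral>\<xi>. cos (x * \<xi>) * g \<xi> \<partial>lborel)"

lemma integrable_cos_mult:
  fixes g :: "real \<Rightarrow> real"
  assumes "integrable lborel g"
  shows "integrable lborel (\<lambda>\<xi>. cos (x * \<xi>) * g \<xi>)"
proof (rule integrable_le)
  show "integrable lborel (\<lambda>\<xi>. \<bar>g \<xi>\<bar>)" using assms by simp
  show "(\<lambda>\<xi>. cos (x * \<xi>) * g \<xi>) \<in> borel_measurable borel"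
    using borel_measurable_integrable[OF assms] by simp
  show "\<bar>cos (x * \<xi>) * g \<xi>\<bar> \<le> \<bar>g \<xi>\<bar>" for \<xi>
    by (simp add: abs_mult mult_left_le_one_le)
qed

lemma abs_cos_transform_le:
  assumes "integrable lborel h" "\<And>\<xi>. \<bar>g \<xi>\<bar> \<le> h \<xi>"
  shows "\<bar>cos_transform g x\<bar> \<le> (\<integral>\<xi>. h \<xi> \<partial>lborel)"
proof (cases "integrable lborel (\<lambda>\<xi>. cos (x * \<xi>) * g \<xi>)")
  case True
  have "\<bar>cos_transform g x\<bar> \<le> (\<integral>\<xi>. \<bar>cos (x * \<xi>) * g \<xi>\<bar> \<partial>lborel)"
    unfolding cos_transform_def by (rule integral_abs_bound)
  also have "\<dots> \<le> (\<integral>\<xi>. h \<xi> \<partial>lborel)"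
  proof (rule integral_mono)
    fix \<xi>
    have "\<bar>cos (x * \<xi>)\<bar> * \<bar>g \<xi>\<bar> \<le> 1 * h \<xi>" by (intro mult_mono) (use assms in auto)
    then show "\<bar>cos (x * \<xi>) * g \<xi>\<bar> \<le> h \<xi>" by (simp add: abs_mult)
  qed (use True assms in auto)
  finally show ?thesis .
next
  \<comment> \<open>A Bochner integral that does not exist has the default value 0, and
    \<open>h\<close> is nonnegative because it dominates an absolute value.\<close>
  case False
  have "0 \<le> h \<xi>" for \<xi> using assms(2)[of \<xi>] by linarith
  then show ?thesis using False by (simp add: cos_transform_def not_integrable_integral_eq)
qed

lemma integrable_gauss:
  assumes "0 < d"
  shows "integrable lborel (\<lambda>\<xi>::real. exp (- d * \<xi>\<^sup>2))"
proof -
  have "integrable lborel (\<lambda>z. std_normal_density z)"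
    using integrable_std_normal_moment[of 0] by simp
  then have "integrable lborel (\<lambda>z. sqrt (2 * pi) * std_normal_density (0 + sqrt (2 * d) * z))"
    using assms by (intro integrable_mult_right lborel_integrable_real_affine) auto
  also have "(\<lambda>z. sqrt (2 * pi) * std_normal_density (0 + sqrt (2 * d) * z)) = (\<lambda>\<xi>. exp (- d * \<xi>\<^sup>2))"
    using assms by (auto simp: fun_eq_iff std_normal_density_def power_mult_distrib)
  finally show ?thesis .
qed

text \<open>Real part of the characteristic function of the standard normal law, after a dilation by
  \<open>sqrt (2 * d)\<close>.\<close>

lemma cos_transform_gauss:
  assumes "0 < d"
  shows "cos_transform (\<lambda>\<xi>. exp (- d * \<xi>\<^sup>2)) x = sqrt (pi / d) * exp (- x\<^sup>2 / (4 * d))"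
proof -
  have std: "(\<integral>z. cos (t * z) * std_normal_density z \<partial>lborel) = exp (- t\<^sup>2 / 2)" for t
  proof -
    have "char std_normal_distribution t = (\<integral>z. std_normal_density z *\<^sub>R cis (t * z) \<partial>lborel)"
      unfolding char_def by (subst integral_density) (auto simp: cis_conv_exp normal_density_nonneg)
    then have "Re (\<integral>z. std_normal_density z *\<^sub>R cis (t * z) \<partial>lborel) = Re (complex_of_real (exp (- t\<^sup>2 / 2)))"
      by (simp only: char_std_normal_distribution)
    moreover have "integrable lborel (\<lambda>z. std_normal_density z *\<^sub>R cis (t * z))"
    proof (rule Bochner_Integration.integrable_bound)
      show "integrable lborel (\<lambda>z. std_normal_density z)"
        using integrable_std_normal_moment[of 0] by simp
      have "(\<lambda>z. cis (t * z)) \<in> borel_measurable borel"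
        by (intro borel_measurable_continuous_onI continuous_intros)
      then show "(\<lambda>z. std_normal_density z *\<^sub>R cis (t * z)) \<in> borel_measurable lborel"
        by simp
    qed (simp add: normal_density_nonneg)
    ultimately have "(\<integral>z. Re (std_normal_density z *\<^sub>R cis (t * z)) \<partial>lborel) = exp (- t\<^sup>2 / 2)"
      by (subst integral_Re) auto
    then show ?thesis by (simp add: mult.commute)
  qed
  define q where "q = sqrt (2 * d)"
  have q: "q > 0" "q\<^sup>2 = 2 * d" using assms by (auto simp: q_def)
  have "exp (- (x / q)\<^sup>2 / 2) = (\<integral>z. cos (x / q * z) * std_normal_density z \<partial>lborel)"
    by (rule std[symmetric])
  also have "\<dots> = q * (\<integral>\<xi>. cos (x * \<xi>) * std_normal_density (q * \<xi>) \<partial>lborel)"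
    using q by (subst lborel_integral_real_affine[of q _ 0]) auto
  also have "(\<lambda>\<xi>. cos (x * \<xi>) * std_normal_density (q * \<xi>)) = (\<lambda>\<xi>. 1 / sqrt (2 * pi) * (cos (x * \<xi>) * exp (- d * \<xi>\<^sup>2)))"
    using q by (auto simp: fun_eq_iff std_normal_density_def power_mult_distrib)
  also have "q * (\<integral>\<xi>. 1 / sqrt (2 * pi) * (cos (x * \<xi>) * exp (- d * \<xi>\<^sup>2)) \<partial>lborel)
      = q / sqrt (2 * pi) * cos_transform (\<lambda>\<xi>. exp (- d * \<xi>\<^sup>2)) x"
    unfolding cos_transform_def by (simp del: mult_minus_left)
  finally have "cos_transform (\<lambda>\<xi>. exp (- d * \<xi>\<^sup>2)) x = sqrt (2 * pi) / q * exp (- (x / q)\<^sup>2 / 2)"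
    using q by (simp add: field_simps)
  then show ?thesis using q(2) assms by (simp add: power_divide q_def real_sqrt_divide[symmetric])
qed

text \<open>The factor \<open>exp (- d * \<xi>\<^sup>2)\<close> makes the integral absolutely convergent for every bounded symbol and
  is absorbed when the symbol is multiplied by another Gaussian.\<close>

definition unimodal_symbol :: "(real \<Rightarrow> real) \<Rightarrow> bool" where
  "unimodal_symbol g \<longleftrightarrow> g \<in> borel_measurable borel \<and> (\<exists>M. \<forall>\<xi>. \<bar>g \<xi>\<bar> \<le> M) \<and>
     (\<forall>d>0. \<forall>x y. 0 \<le> x \<and> x \<le> y \<longrightarrow>
        0 \<le> cos_transform (\<lambda>\<xi>. exp (- d * \<xi>\<^sup>2) * g \<xi>) y \<and>
        cos_transform (\<lambda>\<xi>. exp (- d * \<xi>\<^sup>2) * g \<xi>) y \<le> cos_transform (\<lambda>\<xi>. exp (- d * \<xi>\<^sup>2) * g \<xi>) x)"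

lemma integrable_gauss_mult:
  fixes g :: "real \<Rightarrow> real"
  assumes "0 < d" "g \<in> borel_measurable borel" "\<And>\<xi>. \<bar>g \<xi>\<bar> \<le> M"
  shows "integrable lborel (\<lambda>\<xi>. exp (- d * \<xi>\<^sup>2) * g \<xi>)"
proof (rule integrable_le)
  show "integrable lborel (\<lambda>\<xi>. exp (- d * \<xi>\<^sup>2) * M)" using integrable_gauss[OF assms(1)] by simp
  show "\<bar>exp (- d * \<xi>\<^sup>2) * g \<xi>\<bar> \<le> exp (- d * \<xi>\<^sup>2) * M" for \<xi>
    using assms(3) by (simp add: abs_mult)
qed (use assms in measurable)

lemma unimodal_symbol_1: "unimodal_symbol (\<lambda>\<xi>. 1)"
  unfolding unimodal_symbol_def by (auto simp: cos_transform_gauss[simplified] divide_right_mono power_mono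
    intro!: exI[of _ 1] mult_left_mono)

lemma unimodal_symbol_scale:
  assumes "unimodal_symbol g" "0 \<le> c"
  shows "unimodal_symbol (\<lambda>\<xi>. c * g \<xi>)"
proof -
  have *: "cos_transform (\<lambda>\<xi>. exp (- d * \<xi>\<^sup>2) * (c * g \<xi>)) x = c * cos_transform (\<lambda>\<xi>. exp (- d * \<xi>\<^sup>2) * g \<xi>) x" for d x
    unfolding cos_transform_def by (subst integral_mult_right_zero[symmetric]) (simp add: ac_simps)
  obtain M where "\<And>\<xi>. \<bar>g \<xi>\<bar> \<le> M" using assms by (auto simp: unimodal_symbol_def)
  then have "\<forall>\<xi>. \<bar>c * g \<xi>\<bar> \<le> c * M" using assms by (simp add: abs_mult mult_left_mono)
  then show ?thesis
    using assms unfolding unimodal_symbol_def * by (auto intro: mult_left_mono)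
qed

lemma unimodal_symbol_add:
  assumes "unimodal_symbol f" "unimodal_symbol g"
  shows "unimodal_symbol (\<lambda>\<xi>. f \<xi> + g \<xi>)"
proof -
  obtain M where M: "\<And>\<xi>. \<bar>f \<xi>\<bar> \<le> M" using assms by (auto simp: unimodal_symbol_def)
  obtain N where N: "\<And>\<xi>. \<bar>g \<xi>\<bar> \<le> N" using assms by (auto simp: unimodal_symbol_def)
  have m [measurable]: "f \<in> borel_measurable borel" "g \<in> borel_measurable borel"
    using assms by (auto simp: unimodal_symbol_def)
  have *: "cos_transform (\<lambda>\<xi>. exp (- d * \<xi>\<^sup>2) * (f \<xi> + g \<xi>)) x =
      cos_transform (\<lambda>\<xi>. exp (- d * \<xi>\<^sup>2) * f \<xi>) x + cos_transform (\<lambda>\<xi>. exp (- d * \<xi>\<^sup>2) * g \<xi>) x"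
    if "d > 0" for d x
    using Bochner_Integration.integral_add[OF integrable_cos_mult[OF integrable_gauss_mult[OF that m(1) M]]
      integrable_cos_mult[OF integrable_gauss_mult[OF that m(2) N]], of x x]
    unfolding cos_transform_def by (simp only: distrib_left)
  have "\<bar>f \<xi> + g \<xi>\<bar> \<le> M + N" for \<xi> using M[of \<xi>] N[of \<xi>] by linarith
  then have "\<exists>M. \<forall>\<xi>. \<bar>f \<xi> + g \<xi>\<bar> \<le> M" by blast
  then show ?thesis
    using assms unfolding unimodal_symbol_def by (auto simp: *[simplified] intro: add_mono)
qed

lemma cos_transform_lim:
  assumes "\<And>\<xi>. (\<lambda>n. g n \<xi>) \<longlonglongrightarrow> g' \<xi>" "\<And>n. g n \<in> borel_measurable borel"
    "integrable lborel h" "\<And>n \<xi>. \<bar>g n \<xi>\<bar> \<le> h \<xi>"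
  shows "(\<lambda>n. cos_transform (g n) x) \<longlonglongrightarrow> cos_transform g' x"
  unfolding cos_transform_def
proof (rule integral_dominated_convergence[where w = h])
  have [measurable]: "g n \<in> borel_measurable borel" for n by (rule assms)
  have [measurable]: "g' \<in> borel_measurable borel"
    by (rule borel_measurable_LIMSEQ_real[OF assms(1)]) (use assms(2) in auto)
  show "(\<lambda>\<xi>. cos (x * \<xi>) * g' \<xi>) \<in> borel_measurable lborel" by measurable
  show "(\<lambda>\<xi>. cos (x * \<xi>) * g n \<xi>) \<in> borel_measurable lborel" for n by measurable
  show "AE \<xi> in lborel. (\<lambda>n. cos (x * \<xi>) * g n \<xi>) \<longlonglongrightarrow> cos (x * \<xi>) * g' \<xi>"
    by (intro AE_I2 tendsto_intros assms)
  have "\<bar>cos (x * \<xi>)\<bar> * \<bar>g n \<xi>\<bar> \<le> 1 * h \<xi>" for n \<xi> by (intro mult_mono) (use assms in auto)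
  then show "AE \<xi> in lborel. norm (cos (x * \<xi>) * g n \<xi>) \<le> h \<xi>" for n by (simp add: abs_mult)
qed fact

text \<open>The common bound \<open>M\<close> times the Gaussian factor dominates the integrands, so
  the regularised transforms converge pointwise; nonnegativity and monotonicity are closed
  conditions.\<close>

lemma unimodal_symbol_lim:
  assumes g: "\<And>n. unimodal_symbol (g n)" and M: "\<And>n \<xi>. \<bar>g n \<xi>\<bar> \<le> M" and lim: "\<And>\<xi>. (\<lambda>n. g n \<xi>) \<longlonglongrightarrow> g' \<xi>"
  shows "unimodal_symbol g'"
proof -
  have m [measurable]: "g n \<in> borel_measurable borel" for n
    using g by (auto simp: unimodal_symbol_def)
  have L: "(\<lambda>n. cos_transform (\<lambda>\<xi>. exp (- d * \<xi>\<^sup>2) * g n \<xi>) x) \<longlonglongrightarrow> cos_transform (\<lambda>\<xi>. exp (- d * \<xi>\<^sup>2) * g' \<xi>) x"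
    if "d > 0" for d x
  proof (rule cos_transform_lim)
    show "integrable lborel (\<lambda>\<xi>. exp (- d * \<xi>\<^sup>2) * M)" using integrable_gauss[OF that] by simp
    show "\<bar>exp (- d * \<xi>\<^sup>2) * g n \<xi>\<bar> \<le> exp (- d * \<xi>\<^sup>2) * M" for n \<xi> using M by (simp add: abs_mult)
  qed (intro tendsto_intros lim, measurable)
  have "\<bar>g' \<xi>\<bar> \<le> M" for \<xi>
    by (rule LIMSEQ_le_const2[OF tendsto_rabs[OF lim]]) (use M in auto)
  then have "\<exists>M. \<forall>\<xi>. \<bar>g' \<xi>\<bar> \<le> M" by blast
  moreover have "g' \<in> borel_measurable borel"
    by (rule borel_measurable_LIMSEQ_real[OF lim]) measurable
  moreover have "0 \<le> cos_transform (\<lambda>\<xi>. exp (- d * \<xi>\<^sup>2) * g' \<xi>) y"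
    "cos_transform (\<lambda>\<xi>. exp (- d * \<xi>\<^sup>2) * g' \<xi>) y \<le> cos_transform (\<lambda>\<xi>. exp (- d * \<xi>\<^sup>2) * g' \<xi>) x"
    if "d > 0" "0 \<le> x" "x \<le> y" for d x y
    using g that unfolding unimodal_symbol_def
    by (blast intro: LIMSEQ_le_const[OF L] LIMSEQ_le[OF L L])+
  ultimately show ?thesis
    unfolding unimodal_symbol_def by blast
qed

section \<open>Laplace transforms in xi^2: mixtures of Gaussian symbols\<close>

definition gauss_mixture :: "(real \<Rightarrow> real) \<Rightarrow> real \<Rightarrow> real" where
  "gauss_mixture w \<xi> = (\<integral>\<tau>. w \<tau> * exp (- \<tau> * \<xi>\<^sup>2) \<partial>lborel)"

context
  fixes w :: "real \<Rightarrow> real"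
  assumes w: "integrable lborel w" "\<And>\<tau>. 0 \<le> w \<tau>" "\<And>\<tau>. \<tau> \<le> 0 \<Longrightarrow> w \<tau> = 0"
begin

lemma mixture_weight_measurable: "w \<in> borel_measurable borel"
  using w(1) by auto

lemma gauss_mixture_integrable: "\<bar>w \<tau> * exp (- \<tau> * \<xi>\<^sup>2)\<bar> \<le> w \<tau>" "integrable lborel (\<lambda>\<tau>. w \<tau> * exp (- \<tau> * \<xi>\<^sup>2))"
proof -
  show *: "\<bar>w \<tau> * exp (- \<tau> * \<xi>\<^sup>2)\<bar> \<le> w \<tau>" for \<tau>
    using w(2)[of \<tau>] w(3)[of \<tau>] by (cases "\<tau> \<le> 0") (auto simp: abs_mult mult_left_le)
  show "integrable lborel (\<lambda>\<tau>. w \<tau> * exp (- \<tau> * \<xi>\<^sup>2))"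
    by (rule integrable_le[OF w(1) _ *]) (use mixture_weight_measurable in measurable)
qed

lemma gauss_mixture_bounds: "0 \<le> gauss_mixture w \<xi>" "gauss_mixture w \<xi> \<le> integral\<^sup>L lborel w"
proof -
  show "0 \<le> gauss_mixture w \<xi>" unfolding gauss_mixture_def using w(2) by simp
  show "gauss_mixture w \<xi> \<le> integral\<^sup>L lborel w" unfolding gauss_mixture_def
    by (rule integral_mono[OF gauss_mixture_integrable(2) w(1) order_trans[OF abs_ge_self gauss_mixture_integrable(1)]])
qed

lemma gauss_mixture_measurable: "gauss_mixture w \<in> borel_measurable borel"
  unfolding gauss_mixture_def[abs_def] using mixture_weight_measurable by measurable

text \<open>The factor \<open>exp (- \<tau> * \<xi>\<^sup>2)\<close> of the mixture merges with the
  regularising Gaussian, so the transform of the product at parameter \<open>d\<close> is the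
  average, with weight \<open>w\<close>, of the transforms of \<open>g\<close> at the parameters
  \<open>d + \<tau>\<close>. Averaging keeps sign and monotonicity. This is why
  \<open>unimodal_symbol\<close> quantifies over all \<open>d > 0\<close>.\<close>

lemma unimodal_symbol_gauss_mixture_mult:
  assumes g: "unimodal_symbol g"
  shows "unimodal_symbol (\<lambda>\<xi>. gauss_mixture w \<xi> * g \<xi>)"
proof -
  obtain M where M: "\<And>\<xi>. \<bar>g \<xi>\<bar> \<le> M" using g by (auto simp: unimodal_symbol_def)
  have [measurable]: "g \<in> borel_measurable borel" using g by (auto simp: unimodal_symbol_def)
  note [measurable] = mixture_weight_measurable gauss_mixture_measurable
  let ?C = "\<lambda>d. cos_transform (\<lambda>\<xi>. exp (- d * \<xi>\<^sup>2) * g \<xi>)"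
  have key: "cos_transform (\<lambda>\<xi>. exp (- d * \<xi>\<^sup>2) * (gauss_mixture w \<xi> * g \<xi>)) x = (\<integral>\<tau>. w \<tau> * ?C (d + \<tau>) x \<partial>lborel)"
    "integrable lborel (\<lambda>\<tau>. w \<tau> * ?C (d + \<tau>) x)" if d: "d > 0" for d x
  proof -
    define F where "F = (\<lambda>\<tau> \<xi>. w \<tau> * (cos (x * \<xi>) * (exp (- (d + \<tau>) * \<xi>\<^sup>2) * g \<xi>)))"
    have [measurable]: "case_prod F \<in> borel_measurable (borel \<Otimes>\<^sub>M borel)" unfolding F_def by measurable
    have gi: "integrable lborel (\<lambda>\<xi>. exp (- d * \<xi>\<^sup>2) * M)" using integrable_gauss[OF d] by simp
    have le: "\<bar>F \<tau> \<xi>\<bar> \<le> w \<tau> * (exp (- d * \<xi>\<^sup>2) * M)" for \<tau> \<xi>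
    proof -
      have "F \<tau> \<xi> = (w \<tau> * exp (- \<tau> * \<xi>\<^sup>2)) * (cos (x * \<xi>) * (exp (- d * \<xi>\<^sup>2) * g \<xi>))"
        by (simp add: F_def exp_add[symmetric] algebra_simps)
      also have "\<bar>\<dots>\<bar> \<le> w \<tau> * (1 * (exp (- d * \<xi>\<^sup>2) * M))"
        unfolding abs_mult[of "w \<tau> * exp (- \<tau> * \<xi>\<^sup>2)"] abs_mult[of "cos (x * \<xi>)"] abs_mult[of "exp (- d * \<xi>\<^sup>2)"]
        by (intro mult_mono gauss_mixture_integrable) (use M w(2) in auto)
      finally show ?thesis by simp
    qed
    note fub = fubini_dominated[of F, OF _ w(1) gi le]
    have inner: "(\<integral>\<xi>. F \<tau> \<xi> \<partial>lborel) = w \<tau> * ?C (d + \<tau>) x" for \<tau>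
      unfolding F_def cos_transform_def by simp
    show "integrable lborel (\<lambda>\<tau>. w \<tau> * ?C (d + \<tau>) x)"
      using fub(2) by (simp add: inner)
    have "cos_transform (\<lambda>\<xi>. exp (- d * \<xi>\<^sup>2) * (gauss_mixture w \<xi> * g \<xi>)) x = (\<integral>\<xi>. (\<integral>\<tau>. F \<tau> \<xi> \<partial>lborel) \<partial>lborel)"
      unfolding cos_transform_def
    proof (rule Bochner_Integration.integral_cong[OF refl])
      fix \<xi> :: real
      have "exp (- (d + \<tau>) * \<xi>\<^sup>2) = exp (- d * \<xi>\<^sup>2) * exp (- \<tau> * \<xi>\<^sup>2)" for \<tau>
        by (simp add: exp_add[symmetric] algebra_simps)
      then have "(\<integral>\<tau>. F \<tau> \<xi> \<partial>lborel) = (\<integral>\<tau>. (cos (x * \<xi>) * (exp (- d * \<xi>\<^sup>2) * g \<xi>)) * (w \<tau> * exp (- \<tau> * \<xi>\<^sup>2)) \<partial>lborel)"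
        by (intro Bochner_Integration.integral_cong) (simp_all add: F_def ac_simps)
      then show "cos (x * \<xi>) * (exp (- d * \<xi>\<^sup>2) * (gauss_mixture w \<xi> * g \<xi>)) = (\<integral>\<tau>. F \<tau> \<xi> \<partial>lborel)"
        unfolding gauss_mixture_def integral_mult_right_zero by (simp only: ac_simps)
    qed
    with fub(1) show "cos_transform (\<lambda>\<xi>. exp (- d * \<xi>\<^sup>2) * (gauss_mixture w \<xi> * g \<xi>)) x = (\<integral>\<tau>. w \<tau> * ?C (d + \<tau>) x \<partial>lborel)"
      by (simp add: inner)
  qed
  have pos: "0 \<le> w \<tau> * ?C (d + \<tau>) y" "w \<tau> * ?C (d + \<tau>) y \<le> w \<tau> * ?C (d + \<tau>) x"
    if "d > 0" "0 \<le> x" "x \<le> y" for d x y \<tau>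
  proof -
    have "0 \<le> ?C (d + \<tau>) y \<and> ?C (d + \<tau>) y \<le> ?C (d + \<tau>) x" if "\<tau> > 0"
      using g that \<open>d > 0\<close> \<open>0 \<le> x\<close> \<open>x \<le> y\<close> unfolding unimodal_symbol_def by (meson add_pos_pos)
    then show "0 \<le> w \<tau> * ?C (d + \<tau>) y" "w \<tau> * ?C (d + \<tau>) y \<le> w \<tau> * ?C (d + \<tau>) x"
      using w(2)[of \<tau>] w(3)[of \<tau>] by (cases "\<tau> \<le> 0"; simp add: mult_left_mono)+
  qed
  have "\<bar>gauss_mixture w \<xi> * g \<xi>\<bar> \<le> integral\<^sup>L lborel w * M" for \<xi>
    unfolding abs_mult by (intro mult_mono) (use gauss_mixture_bounds[of \<xi>] M in auto)
  then have "\<exists>M. \<forall>\<xi>. \<bar>gauss_mixture w \<xi> * g \<xi>\<bar> \<le> M" by blast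
  then show ?thesis
    unfolding unimodal_symbol_def
  proof (safe; (simp only: key)?)
    fix d x y :: real assume d: "0 < d" "0 \<le> x" "x \<le> y"
    show "0 \<le> (\<integral>\<tau>. w \<tau> * ?C (d + \<tau>) y \<partial>lborel)"
      by (rule Bochner_Integration.integral_nonneg) (rule pos(1)[OF d])
    show "(\<integral>\<tau>. w \<tau> * ?C (d + \<tau>) y \<partial>lborel) \<le> (\<integral>\<tau>. w \<tau> * ?C (d + \<tau>) x \<partial>lborel)"
      by (rule integral_mono[OF key(2)[OF d(1)] key(2)[OF d(1)] pos(2)[OF d]])
  qed measurable
qed

text \<open>The exponential series has nonnegative coefficients, each power of the mixture is
  unimodal by repeated multiplication, and the partial sums are bounded by the exponential of the
  total mass. Up to normalisation this is the characteristic function of a compound Poisson law with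
  Gaussian jumps of random variance.\<close>

lemma unimodal_symbol_exp_gauss_mixture: "unimodal_symbol (\<lambda>\<xi>. exp (gauss_mixture w \<xi>))"
proof (rule unimodal_symbol_lim)
  have pow: "unimodal_symbol (\<lambda>\<xi>. gauss_mixture w \<xi> ^ k)" for k
    by (induction k) (auto intro: unimodal_symbol_1 unimodal_symbol_gauss_mixture_mult)
  show "unimodal_symbol (\<lambda>\<xi>. \<Sum>k<n. gauss_mixture w \<xi> ^ k /\<^sub>R fact k)" for n
  proof (induction n)
    case 0
    show ?case using unimodal_symbol_scale[OF unimodal_symbol_1, of 0] by simp
  next
    case (Suc n)
    then show ?case using unimodal_symbol_add[OF Suc unimodal_symbol_scale[OF pow[of n], of "inverse (fact n)"]] by simp
  qed
  show "(\<lambda>n. \<Sum>k<n. gauss_mixture w \<xi> ^ k /\<^sub>R fact k) \<longlonglongrightarrow> exp (gauss_mixture w \<xi>)" for \<xi>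
    using exp_converges[of "gauss_mixture w \<xi>"] by (simp add: sums_def)
  show "\<bar>\<Sum>k<n. gauss_mixture w \<xi> ^ k /\<^sub>R fact k\<bar> \<le> exp (integral\<^sup>L lborel w)" for n \<xi>
  proof -
    have nn: "0 \<le> gauss_mixture w \<xi> ^ k /\<^sub>R fact k" for k using gauss_mixture_bounds(1) by simp
    have "(\<Sum>k<n. gauss_mixture w \<xi> ^ k /\<^sub>R fact k) \<le> exp (gauss_mixture w \<xi>)"
      unfolding exp_def using nn by (intro sum_le_suminf summable_exp_generic) auto
    also have "\<dots> \<le> exp (integral\<^sup>L lborel w)" using gauss_mixture_bounds(2) by simp
    finally show ?thesis using nn by (simp add: sum_nonneg)
  qed
qed

end

section \<open>The stable density\<close>

definition stable_symbol :: "real \<Rightarrow> real \<Rightarrow> real \<Rightarrow> real" where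
  "stable_symbol s T \<xi> = exp (- T * \<bar>\<xi>\<bar> powr (2 * s))"

lemma stable_symbol_measurable [measurable]: "stable_symbol s T \<in> borel_measurable borel"
  unfolding stable_symbol_def by measurable

lemma stable_symbol_nonneg [simp]: "0 \<le> stable_symbol s T \<xi>" "\<bar>stable_symbol s T \<xi>\<bar> = stable_symbol s T \<xi>"
  by (simp_all add: stable_symbol_def)

lemma stable_symbol_antimono: "T \<le> T' \<Longrightarrow> stable_symbol s T' \<xi> \<le> stable_symbol s T \<xi>"
  by (simp add: stable_symbol_def mult_right_mono)

text \<open>For \<open>T > 0\<close> this is the heat kernel of the theorem;
  \<open>frac_heat_kernel_eq\<close> makes the identification.\<close>

definition stable_density :: "real \<Rightarrow> real \<Rightarrow> real \<Rightarrow> real" where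
  "stable_density s T = (\<lambda>x. cos_transform (stable_symbol s T) x / (2 * pi))"

text \<open>Since 2s > 1, |xi|^(2s) >= |xi| - 1, so the symbol decays at least like exp(-T |xi|).
  The weight 1 + xi^4 is the one that the consistency estimate consumes.\<close>

lemma stable_symbol_integrable:
  assumes s: "1/2 < s" and T: "0 < T"
  shows "integrable lborel (\<lambda>\<xi>. (1 + \<xi>^4) * stable_symbol s T \<xi>)" "integrable lborel (stable_symbol s T)"
proof -
  \<comment> \<open>Chosen so that 1 + y <= c exp(T y / 6). The sixth power then covers four powers
    from the weight and two from the majorant 1/(1 + xi^2).\<close>
  define c where "c = max 1 (6 / T)"
  have c: "1 \<le> c" "6 \<le> c * T" using T by (auto simp: c_def max_def field_simps)
  have le: "(1 + \<xi>^4) * stable_symbol s T \<xi> \<le> exp T * c ^ 6 * inverse (1 + \<xi>\<^sup>2)" for \<xi>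
  proof -
    define y where "y = \<bar>\<xi>\<bar>"
    have y: "0 \<le> y" "\<xi>\<^sup>2 = y\<^sup>2" "\<xi>^4 = y^4" by (auto simp: y_def)
    have "y - 1 \<le> y powr (2 * s)"
    proof (cases "y \<le> 1")
      case False
      then have "y powr 1 \<le> y powr (2 * s)" using s by (intro powr_mono) auto
      then show ?thesis using False by simp
    qed (simp add: order_trans[OF _ powr_ge_zero])
    then have "T * (y - 1) \<le> T * y powr (2 * s)" using T by (intro mult_left_mono) auto
    then have 1: "stable_symbol s T \<xi> \<le> exp T * exp (- T * y)"
      by (simp add: stable_symbol_def y_def[symmetric] exp_add[symmetric] algebra_simps)
    have "(1 + y) \<le> c * (1 + T * y / 6)"
      using mult_right_mono[OF c(2) y(1)] c(1) by (simp add: algebra_simps)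
    also have "\<dots> \<le> c * exp (T * y / 6)"
      using c by (intro mult_left_mono exp_ge_add_one_self) auto
    finally have "(1 + y) ^ 6 \<le> (c * exp (T * y / 6)) ^ 6"
      using y by (intro power_mono) auto
    also have "\<dots> = c ^ 6 * exp (T * y)"
      by (simp add: power_mult_distrib exp_of_nat_mult[symmetric])
    finally have 2: "(1 + y) ^ 6 \<le> c ^ 6 * exp (T * y)" .
    have "(1 + y^4) * (1 + y\<^sup>2) \<le> (1 + y) ^ 4 * (1 + y)\<^sup>2"
    proof (intro mult_mono)
      show "1 + y\<^sup>2 \<le> (1 + y)\<^sup>2" using y by (simp add: power2_sum)
      have "1 + (y\<^sup>2)\<^sup>2 \<le> (1 + y\<^sup>2)\<^sup>2" by (simp add: power2_sum)
      also have "\<dots> \<le> ((1 + y)\<^sup>2)\<^sup>2" using \<open>1 + y\<^sup>2 \<le> (1 + y)\<^sup>2\<close> by (intro power_mono) auto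
      finally show "1 + y^4 \<le> (1 + y)^4" by (simp add: power_mult[symmetric])
    qed auto
    also have "\<dots> = (1 + y) ^ 6" by (simp add: power_add[symmetric])
    finally have 3: "(1 + y^4) * (1 + y\<^sup>2) \<le> c ^ 6 * exp (T * y)" using 2 by simp
    have "(1 + y^4) * stable_symbol s T \<xi> * (1 + y\<^sup>2) \<le> (1 + y^4) * (exp T * exp (- T * y)) * (1 + y\<^sup>2)"
      using 1 by (intro mult_right_mono mult_left_mono) auto
    also have "\<dots> = (exp T * exp (- T * y)) * ((1 + y^4) * (1 + y\<^sup>2))" by simp
    also have "\<dots> \<le> (exp T * exp (- T * y)) * (c ^ 6 * exp (T * y))"
      using 3 by (intro mult_left_mono) auto
    also have "\<dots> = exp T * c ^ 6" by (simp add: exp_minus field_simps)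
    finally show ?thesis unfolding y using y by (simp add: field_simps add_pos_nonneg)
  qed
  show *: "integrable lborel (\<lambda>\<xi>. (1 + \<xi>^4) * stable_symbol s T \<xi>)"
  proof (rule integrable_le)
    show "integrable lborel (\<lambda>\<xi>. exp T * c ^ 6 * inverse (1 + \<xi>\<^sup>2))"
      using integrable_inverse_square by simp
    show "\<bar>(1 + \<xi>^4) * stable_symbol s T \<xi>\<bar> \<le> exp T * c ^ 6 * inverse (1 + \<xi>\<^sup>2)" for \<xi>
      using le[of \<xi>] by (simp add: abs_mult)
  qed measurable
  show "integrable lborel (stable_symbol s T)"
    by (rule integrable_le[OF *]) (auto simp: algebra_simps)
qed

section \<open>The power |xi|^(2s) as a Bernstein function of xi^2\<close>

lemma levy_tail_integral_lim:
  assumes "0 < b" "b < c" and m [measurable]: "f \<in> borel_measurable borel" and "\<And>r. \<bar>f r\<bar> \<le> M"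
    and "\<And>r. 0 < r \<Longrightarrow> \<bar>f r\<bar> \<le> M * r powr c"
  shows "(\<lambda>n. \<integral>r. levy_weight b (1 / real (Suc n)) r * f r \<partial>lborel) \<longlonglongrightarrow> (\<integral>r. levy_weight b 0 r * f r \<partial>lborel)"
proof (rule integral_dominated_convergence)
  show "integrable lborel (\<lambda>r. \<bar>levy_weight b 0 r * f r\<bar>)"
    by (intro integrable_abs levy_weight_integrable[OF assms]) auto
  show "AE r in lborel. norm (levy_weight b (1 / real (Suc n)) r * f r) \<le> \<bar>levy_weight b 0 r * f r\<bar>" for n
    using levy_weight_mono[of 0 "1 / real (Suc n)" b] by (simp add: abs_mult mult_right_mono)
  show "AE r in lborel. (\<lambda>n. levy_weight b (1 / real (Suc n)) r * f r) \<longlonglongrightarrow> levy_weight b 0 r * f r"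
  proof (intro AE_I2 tendsto_mult tendsto_const)
    fix r :: real
    show "(\<lambda>n. levy_weight b (1 / real (Suc n)) r) \<longlonglongrightarrow> levy_weight b 0 r"
    proof (cases "0 < r")
      case True
      then obtain N where "1 / real (Suc N) < r" by (metis nat_approx_posE inverse_eq_divide)
      then have "1 / real (Suc n) < r" if "n \<ge> N" for n
        using that by (smt (verit) frac_le of_nat_0_less_iff of_nat_mono zero_less_Suc Suc_le_mono)
      then have "\<forall>\<^sub>F n in sequentially. levy_weight b (1 / real (Suc n)) r = levy_weight b 0 r"
        unfolding eventually_sequentially using True by (auto simp: levy_weight_def intro!: exI[of _ N])
      then show ?thesis by (rule tendsto_eventually)
    next
      case False
      then have "levy_weight b (1 / real (Suc n)) r = levy_weight b 0 r" for n
        by (auto simp: levy_weight_def indicator_def dest: less_trans[of "0::real", rotated])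
      then show ?thesis by simp
    qed
  qed
qed measurable

lemma abs_1_minus_exp_le: "\<bar>1 - exp (- (max 0 r))\<bar> \<le> 1" "0 < r \<Longrightarrow> \<bar>1 - exp (- (max 0 r))\<bar> \<le> 1 * r powr 1"
  for r :: real
  using exp_ge_add_one_self[of "- r"] by (auto simp: abs_le_iff)

text \<open>The constant in the representation of x^s as a superposition of the functions 1 - exp(-r
  x); for 0 < s < 1 its value is Gamma(1-s)/s. The \<open>max 0\<close> keeps the integrand bounded
  on the negative axis, where the weight vanishes.\<close>

definition bernstein_const :: "real \<Rightarrow> real" where
  "bernstein_const s = (\<integral>r. levy_weight s 0 r * (1 - exp (- max 0 r)) \<partial>lborel)"

lemma bernstein_const_pos:
  assumes "0 < s" "s < 1"
  shows "0 < bernstein_const s"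
proof -
  have "0 < (1 - exp (- 1)) * (1 powr (- s) / s)" using assms by simp
  also have "\<dots> = (\<integral>r. (1 - exp (-1)) * levy_weight s 1 r \<partial>lborel)"
    using levy_weight_tail[of s 1] assms by (simp add: has_bochner_integral_integral_eq)
  also have "\<dots> \<le> bernstein_const s" unfolding bernstein_const_def
  proof (rule integral_mono)
    show "integrable lborel (\<lambda>r. levy_weight s 0 r * (1 - exp (- max 0 r)))"
      by (rule levy_weight_integrable[of s 1 _ 1]) (use assms abs_1_minus_exp_le in auto)
    show "integrable lborel (\<lambda>r. (1 - exp (- 1)) * levy_weight s 1 r)"
      using levy_weight_tail[of s 1] assms by (auto intro: integrable.intros)
    show "(1 - exp (- 1)) * levy_weight s 1 r \<le> levy_weight s 0 r * (1 - exp (- max 0 r))" for r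
      by (auto simp: levy_weight_def indicator_def mult.commute intro!: mult_left_mono)
  qed
  finally show ?thesis .
qed

lemma powr_eq_levy_integral:
  assumes "0 < s" "s < 1"
  shows "(\<integral>r. levy_weight s 0 r * (1 - exp (- max 0 (\<xi>\<^sup>2 * r))) \<partial>lborel) = bernstein_const s * \<bar>\<xi>\<bar> powr (2 * s)"
proof (cases "\<xi> = 0")
  case False
  then have "\<xi>\<^sup>2 > 0" by simp
  have "\<xi>\<^sup>2 powr s = \<bar>\<xi>\<bar> powr (2 * s)"
    using False by (simp add: powr_powr[symmetric] powr_numeral)
  then show ?thesis
    using levy_weight_scale[OF \<open>\<xi>\<^sup>2 > 0\<close>, of s "\<lambda>r. 1 - exp (- max 0 r)"] by (simp add: bernstein_const_def)
qed simp

text \<open>Cutting the Levy measure off at 1/(n+1) makes it finite, so the 1 in 1 - exp(-r xi^2)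
  can be integrated separately: the approximating symbol is a positive constant times the
  exponential of a Gaussian mixture. The approximations are bounded by 1 and converge
  pointwise.\<close>

lemma unimodal_symbol_stable_symbol:
  assumes s: "0 < s" "s < 1" and T: "0 \<le> T"
  shows "unimodal_symbol (stable_symbol s T)"
proof (rule unimodal_symbol_lim)
  \<comment> \<open>Rescales the Bernstein integral so that the limit exponent is exactly T
    |xi|^(2s).\<close>
  define k where "k = T / bernstein_const s"
  have K: "0 < bernstein_const s" using bernstein_const_pos[OF s] .
  have k: "0 \<le> k" using T K by (simp add: k_def)
  define \<psi> where "\<psi> n \<xi> = (\<integral>r. levy_weight s (1 / real (Suc n)) r * (1 - exp (- max 0 (\<xi>\<^sup>2 * r))) \<partial>lborel)" for n \<xi>
  let ?w = "\<lambda>n \<tau>. k * levy_weight s (1 / real (Suc n)) \<tau>"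
  have wi: "integrable lborel (levy_weight s (1 / real (Suc n)))" for n
    using levy_weight_tail[of s "1 / real (Suc n)"] s by (auto intro: integrable.intros)
  have w: "integrable lborel (?w n)" "\<And>\<tau>. 0 \<le> ?w n \<tau>" "\<And>\<tau>. \<tau> \<le> 0 \<Longrightarrow> ?w n \<tau> = 0" for n
    using wi[of n] k order_trans[of _ 0 "1 / real (Suc n)"] by (simp_all add: levy_weight_eq_0)
  have eq: "exp (- k * \<psi> n \<xi>) = exp (- integral\<^sup>L lborel (?w n)) * exp (gauss_mixture (?w n) \<xi>)" for n \<xi>
  proof -
    have "k * \<psi> n \<xi> = (\<integral>\<tau>. ?w n \<tau> - ?w n \<tau> * exp (- \<tau> * \<xi>\<^sup>2) \<partial>lborel)"
      unfolding \<psi>_def integral_mult_right_zero[symmetric]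
      by (rule Bochner_Integration.integral_cong)
        (auto simp: levy_weight_def indicator_def algebra_simps max_def divide_less_0_iff zero_le_mult_iff dest: less_trans[of "0::real", rotated])
    also have "\<dots> = integral\<^sup>L lborel (?w n) - gauss_mixture (?w n) \<xi>"
      unfolding gauss_mixture_def
      by (rule Bochner_Integration.integral_diff[OF w(1) gauss_mixture_integrable(2)[OF w]])
    finally show ?thesis by (simp add: exp_add[symmetric])
  qed
  show "unimodal_symbol (\<lambda>\<xi>. exp (- k * \<psi> n \<xi>))" for n
    unfolding eq by (intro unimodal_symbol_scale unimodal_symbol_exp_gauss_mixture w) auto
  have "0 \<le> \<psi> n \<xi>" for n \<xi> unfolding \<psi>_def by (rule Bochner_Integration.integral_nonneg) simp
  then show "\<bar>exp (- k * \<psi> n \<xi>)\<bar> \<le> 1" for n \<xi> using k by simp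
  show "(\<lambda>n. exp (- k * \<psi> n \<xi>)) \<longlonglongrightarrow> stable_symbol s T \<xi>" for \<xi>
  proof -
    define M where "M = max 1 (\<xi>\<^sup>2)"
    have "(\<lambda>n. \<psi> n \<xi>) \<longlonglongrightarrow> (\<integral>r. levy_weight s 0 r * (1 - exp (- max 0 (\<xi>\<^sup>2 * r))) \<partial>lborel)"
      unfolding \<psi>_def
    proof (rule levy_tail_integral_lim[where M=M and c=1])
      show "\<bar>1 - exp (- max 0 (\<xi>\<^sup>2 * r))\<bar> \<le> M" for r
        using abs_1_minus_exp_le(1)[of "\<xi>\<^sup>2 * r"] by (simp only: M_def le_max_iff_disj simp_thms)
      show "\<bar>1 - exp (- max 0 (\<xi>\<^sup>2 * r))\<bar> \<le> M * r powr 1" if "0 < r" for r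
      proof (cases "\<xi> = 0")
        case False
        then have "\<bar>1 - exp (- max 0 (\<xi>\<^sup>2 * r))\<bar> \<le> \<xi>\<^sup>2 * r"
          using abs_1_minus_exp_le(2)[of "\<xi>\<^sup>2 * r"] that by simp
        also have "\<dots> \<le> M * r" using that by (intro mult_right_mono) (auto simp: M_def)
        finally show ?thesis using that by simp
      qed (use that in \<open>simp add: M_def\<close>)
    qed (use s in auto)
    then have "(\<lambda>n. exp (- k * \<psi> n \<xi>)) \<longlonglongrightarrow> exp (- k * (bernstein_const s * \<bar>\<xi>\<bar> powr (2 * s)))"
      unfolding powr_eq_levy_integral[OF s] by (intro tendsto_intros)
    then show ?thesis using K by (simp add: stable_symbol_def k_def)
  qed
qed

text \<open>The Gaussian regularisation is removed along 1/(n+1); the symbol itself is integrable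
  and serves as majorant.\<close>

lemma stable_density_noninc:
  assumes s: "1/2 < s" "s < 1" and T: "0 < T" and xy: "0 \<le> x" "x \<le> y"
  shows "0 \<le> stable_density s T y" "stable_density s T y \<le> stable_density s T x"
proof -
  have L: "(\<lambda>n. cos_transform (\<lambda>\<xi>. exp (- (1 / real (Suc n)) * \<xi>\<^sup>2) * stable_symbol s T \<xi>) z) \<longlonglongrightarrow> cos_transform (stable_symbol s T) z" for z
  proof (rule cos_transform_lim)
    show "integrable lborel (stable_symbol s T)" using stable_symbol_integrable s T by auto
    have "(\<lambda>n. exp (- (1 / real (Suc n)) * \<xi>\<^sup>2) * stable_symbol s T \<xi>) \<longlonglongrightarrow> exp (- 0 * \<xi>\<^sup>2) * stable_symbol s T \<xi>" for \<xi>
      by (intro tendsto_intros LIMSEQ_Suc lim_1_over_n)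
    then show "(\<lambda>n. exp (- (1 / real (Suc n)) * \<xi>\<^sup>2) * stable_symbol s T \<xi>) \<longlonglongrightarrow> stable_symbol s T \<xi>" for \<xi> by simp
    show "\<bar>exp (- (1 / real (Suc n)) * \<xi>\<^sup>2) * stable_symbol s T \<xi>\<bar> \<le> stable_symbol s T \<xi>" for n \<xi>
      by (simp add: abs_mult mult_left_le_one_le)
  qed measurable
  have unimodal_symbol: "unimodal_symbol (stable_symbol s T)" using unimodal_symbol_stable_symbol[of s T] s T by simp
  have d: "0 < 1 / real (Suc n)" for n by simp
  have "0 \<le> cos_transform (stable_symbol s T) y"
    by (rule LIMSEQ_le_const[OF L]) (use unimodal_symbol d xy in \<open>unfold unimodal_symbol_def, blast\<close>)
  then show "0 \<le> stable_density s T y" by (simp add: stable_density_def)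
  have "cos_transform (stable_symbol s T) y \<le> cos_transform (stable_symbol s T) x"
    by (rule LIMSEQ_le[OF L L]) (use unimodal_symbol d xy in \<open>unfold unimodal_symbol_def, blast\<close>)
  then show "stable_density s T y \<le> stable_density s T x" by (simp add: stable_density_def divide_right_mono)
qed

lemma stable_density_minus [simp]: "stable_density s T (- x) = stable_density s T x"
  by (simp add: stable_density_def cos_transform_def)

lemma stable_density_abs [simp]: "stable_density s T \<bar>x\<bar> = stable_density s T x"
  by (simp add: abs_if)

lemma stable_density_measurable [measurable]: "stable_density s T \<in> borel_measurable borel"
  unfolding stable_density_def cos_transform_def by measurable

lemma stable_density_nonneg:
  assumes "1/2 < s" "s < 1" "0 < T"
  shows "0 \<le> stable_density s T x"
  using stable_density_noninc(1)[OF assms, of "\<bar>x\<bar>" "\<bar>x\<bar>"] by simp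

lemma powr_abs_le:
  fixes z :: real
  assumes "0 \<le> a" "a \<le> 2"
  shows "\<bar>z\<bar> powr a \<le> 1 + z\<^sup>2"
proof (cases "\<bar>z\<bar> \<le> 1")
  case True
  then have "\<bar>z\<bar> powr a \<le> 1" using assms by (intro powr_le1) auto
  then show ?thesis by (simp add: add_increasing2)
next
  case False
  then have "\<bar>z\<bar> powr a \<le> \<bar>z\<bar> powr 2" using assms by (intro powr_mono) auto
  also have "\<dots> = z\<^sup>2" by (simp add: powr_numeral)
  finally show ?thesis by simp
qed

lemma one_minus_exp_bounds:
  fixes u :: real
  shows "1 - exp (- u) \<le> u" and "0 \<le> u \<Longrightarrow> u \<le> 1 \<Longrightarrow> u / 2 \<le> 1 - exp (- u)"
proof -
  show "1 - exp (- u) \<le> u" using exp_ge_add_one_self[of "- u"] by linarith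
  assume u: "0 \<le> u" "u \<le> 1"
  have "(1 - u / 2) * (1 + u) \<ge> 1" using mult_left_le[OF u(2) u(1)] by (simp add: algebra_simps)
  also have "(1 - u / 2) * (1 + u) \<le> (1 - u / 2) * exp u"
    using u exp_ge_add_one_self[of u] by (intro mult_left_mono) auto
  finally show "u / 2 \<le> 1 - exp (- u)" by (simp add: exp_minus field_simps)
qed

section \<open>Averages of the kernel against Gaussians\<close>

context
  fixes s :: real
  assumes s: "1/2 < s" "s < 1"
begin

text \<open>Fubini moves the Gaussian weight to the frequency side, and the substitution xi = (2/r)
  z leaves the radius only in the factor (2/r)^(2s) of the exponent. A large radius thus means a
  small perturbation of exp(-z^2).\<close>

lemma stable_density_gauss_average:
  assumes r: "0 < r"
  shows "has_bochner_integral lborel (\<lambda>x. stable_density s 1 x * exp (- (x / r)\<^sup>2))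
     ((\<integral>z. exp (- ((2 / r) powr (2 * s)) * \<bar>z\<bar> powr (2 * s)) * exp (- z\<^sup>2) \<partial>lborel) / sqrt pi)"
proof -
  define d where "d = 1 / r\<^sup>2"
  have d: "0 < d" using r by (simp add: d_def)
  define F where "F = (\<lambda>x \<xi>. exp (- d * x\<^sup>2) * (cos (x * \<xi>) * stable_symbol s 1 \<xi>))"
  have m: "case_prod F \<in> borel_measurable (borel \<Otimes>\<^sub>M borel)" unfolding F_def by measurable
  have le: "\<bar>F x \<xi>\<bar> \<le> exp (- d * x\<^sup>2) * stable_symbol s 1 \<xi>" for x \<xi>
    by (simp add: F_def abs_mult mult_left_le_one_le)
  note fub = fubini_dominated[OF m integrable_gauss[OF d] _ le]
  have i: "integrable lborel (stable_symbol s 1)" using stable_symbol_integrable s by simp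
  have in1: "(\<integral>\<xi>. F x \<xi> \<partial>lborel) = 2 * pi * (stable_density s 1 x * exp (- (x / r)\<^sup>2))" for x
    by (simp add: F_def stable_density_def cos_transform_def d_def power_divide)
  have in2: "(\<integral>x. F x \<xi> \<partial>lborel) = sqrt (pi / d) * (stable_symbol s 1 \<xi> * exp (- \<xi>\<^sup>2 / (4 * d)))" for \<xi>
  proof -
    have "(\<integral>x. F x \<xi> \<partial>lborel) = stable_symbol s 1 \<xi> * cos_transform (\<lambda>x. exp (- d * x\<^sup>2)) \<xi>"
      unfolding F_def cos_transform_def integral_mult_right_zero[symmetric] by (simp add: ac_simps)
    then show ?thesis unfolding cos_transform_gauss[OF d] by simp
  qed
  have "integrable lborel (\<lambda>x. 1 / (2 * pi) * (\<integral>\<xi>. F x \<xi> \<partial>lborel))" using fub(2)[OF i] by simp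
  then have I: "integrable lborel (\<lambda>x. stable_density s 1 x * exp (- (x / r)\<^sup>2))" unfolding in1 by simp
  have "2 * pi * (\<integral>x. stable_density s 1 x * exp (- (x / r)\<^sup>2) \<partial>lborel) =
    sqrt (pi / d) * (\<integral>\<xi>. stable_symbol s 1 \<xi> * exp (- \<xi>\<^sup>2 / (4 * d)) \<partial>lborel)"
    using fub(1)[OF i] unfolding in1 in2 by simp
  also have "(\<integral>\<xi>. stable_symbol s 1 \<xi> * exp (- \<xi>\<^sup>2 / (4 * d)) \<partial>lborel)
     = 2 / r * (\<integral>z. stable_symbol s 1 (2 / r * z) * exp (- (2 / r * z)\<^sup>2 / (4 * d)) \<partial>lborel)"
    using r by (subst lborel_integral_real_affine[of "2 / r" _ 0]) auto
  also have "(\<lambda>z. stable_symbol s 1 (2 / r * z) * exp (- (2 / r * z)\<^sup>2 / (4 * d))) =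
     (\<lambda>z. exp (- ((2 / r) powr (2 * s)) * \<bar>z\<bar> powr (2 * s)) * exp (- z\<^sup>2))"
  proof
    fix z
    have "\<bar>2 / r * z\<bar> powr (2 * s) = (2 / r) powr (2 * s) * \<bar>z\<bar> powr (2 * s)"
      using r by (simp add: abs_mult powr_mult flip: times_divide_eq_left)
    moreover have "(2 / r * z)\<^sup>2 / (4 * d) = z\<^sup>2" using r by (simp add: d_def power2_eq_square)
    ultimately show "stable_symbol s 1 (2 / r * z) * exp (- (2 / r * z)\<^sup>2 / (4 * d)) =
       exp (- ((2 / r) powr (2 * s)) * \<bar>z\<bar> powr (2 * s)) * exp (- z\<^sup>2)"
      by (simp only: stable_symbol_def minus_divide_left[symmetric] mult_minus_left mult_1)
  qed
  also have "sqrt (pi / d) = r * sqrt pi" using r by (simp add: d_def real_sqrt_mult)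
  finally have "(\<integral>x. stable_density s 1 x * exp (- (x / r)\<^sup>2) \<partial>lborel) =
     (\<integral>z. exp (- ((2 / r) powr (2 * s)) * \<bar>z\<bar> powr (2 * s)) * exp (- z\<^sup>2) \<partial>lborel) * (sqrt pi / pi)"
    using r by (simp add: field_simps)
  also have "sqrt pi / pi = 1 / sqrt pi" by (simp add: real_div_sqrt field_simps)
  finally show ?thesis using I by (simp add: has_bochner_integral_iff)
qed

lemma integrable_gauss_1: "integrable lborel (\<lambda>z::real. exp (- z\<^sup>2))" "integral\<^sup>L lborel (\<lambda>z::real. exp (- z\<^sup>2)) = sqrt pi"
  using integrable_gauss[of 1] cos_transform_gauss[of 1 0] by (simp_all add: cos_transform_def)

text \<open>As the radius grows, the Gaussian weights increase to 1 and the averages tend to 1 by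
  the explicit formula. Monotone convergence, available because the density is nonnegative, gives
  integrability and mass together.\<close>

lemma stable_density_has_integral: "has_bochner_integral lborel (stable_density s 1) 1"
proof -
  let ?r = "\<lambda>n. real (Suc n)"
  let ?f = "\<lambda>n x. stable_density s 1 x * exp (- (x / ?r n)\<^sup>2)"
  have nn: "0 \<le> stable_density s 1 x" for x using stable_density_nonneg s by simp
  have L: "(\<lambda>n. c / ?r n) \<longlonglongrightarrow> 0" for c
    by (rule LIMSEQ_Suc[OF lim_const_over_n])
  have 0: "(\<lambda>n. (2 / ?r n) powr (2 * s)) \<longlonglongrightarrow> 0"
  proof -
    have "(\<lambda>n. (2 / ?r n) powr (2 * s)) \<longlonglongrightarrow> 0 powr (2 * s)"
      using s by (intro tendsto_powr' L tendsto_const) auto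
    then show ?thesis by simp
  qed
  have i: "integrable lborel (?f n)" for n
    using stable_density_gauss_average[of "?r n"] by (auto intro: integrable.intros simp del: of_nat_Suc)
  have mono: "AE x in lborel. mono (\<lambda>n. ?f n x)"
    using nn by (intro AE_I2 monoI mult_left_mono) (auto simp: power_divide intro!: divide_left_mono power_mono)
  have lim: "AE x in lborel. (\<lambda>n. ?f n x) \<longlonglongrightarrow> stable_density s 1 x"
  proof (intro AE_I2)
    fix x
    have "(\<lambda>n. stable_density s 1 x * exp (- (x / ?r n)\<^sup>2)) \<longlonglongrightarrow> stable_density s 1 x * exp (- (0\<^sup>2))"
      by (intro tendsto_intros L)
    then show "(\<lambda>n. ?f n x) \<longlonglongrightarrow> stable_density s 1 x" by simp
  qed
  have "(\<lambda>n. (\<integral>z. exp (- ((2 / ?r n) powr (2 * s)) * \<bar>z\<bar> powr (2 * s)) * exp (- z\<^sup>2) \<partial>lborel) / sqrt pi)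
    \<longlonglongrightarrow> (\<integral>z. exp (- z\<^sup>2) \<partial>lborel) / sqrt pi"
  proof (intro tendsto_divide tendsto_const)
    show "(\<lambda>n. (\<integral>z. exp (- ((2 / ?r n) powr (2 * s)) * \<bar>z\<bar> powr (2 * s)) * exp (- z\<^sup>2) \<partial>lborel))
       \<longlonglongrightarrow> (\<integral>z. exp (- z\<^sup>2) \<partial>lborel)"
    proof (rule integral_dominated_convergence[OF _ _ integrable_gauss_1(1)])
      show "AE z in lborel. (\<lambda>n. exp (- ((2 / ?r n) powr (2 * s)) * \<bar>z\<bar> powr (2 * s)) * exp (- z\<^sup>2)) \<longlonglongrightarrow> exp (- z\<^sup>2)"
      proof (intro AE_I2)
        fix z
        have "(\<lambda>n. exp (- ((2 / ?r n) powr (2 * s)) * \<bar>z\<bar> powr (2 * s)) * exp (- z\<^sup>2)) \<longlonglongrightarrow> exp (- 0 * \<bar>z\<bar> powr (2 * s)) * exp (- z\<^sup>2)"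
          by (intro tendsto_intros 0)
        then show "(\<lambda>n. exp (- ((2 / ?r n) powr (2 * s)) * \<bar>z\<bar> powr (2 * s)) * exp (- z\<^sup>2)) \<longlonglongrightarrow> exp (- z\<^sup>2)" by simp
      qed
    qed auto
  qed auto
  then have ilim: "(\<lambda>n. integral\<^sup>L lborel (?f n)) \<longlonglongrightarrow> 1"
    using stable_density_gauss_average[THEN has_bochner_integral_integral_eq] by (simp add: integrable_gauss_1(2))
  show ?thesis
    using integral_monotone_convergence_nonneg[OF i mono _ lim ilim] nn by (simp add: has_bochner_integral_iff)
qed

text \<open>The function 1 - exp(-(x/r)^2) is a smooth stand-in for the indicator of |x| > r, so
  these integrals play the role of the tail mass. On the frequency side they integrate 1 - exp(-q
  |z|^(2s)) against a Gaussian, with q = (2/r)^(2s), and are comparable to q; the lower estimate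
  uses q <= 1, hence \<open>2 \<le> r\<close>.\<close>

lemma stable_density_gauss_deficit:
  obtains m M where "0 < m" "0 < M"
    "\<And>r. 0 < r \<Longrightarrow> integrable lborel (\<lambda>x. stable_density s 1 x * (1 - exp (- (x / r)\<^sup>2)))"
    "\<And>r. 0 < r \<Longrightarrow> (\<integral>x. stable_density s 1 x * (1 - exp (- (x / r)\<^sup>2)) \<partial>lborel) \<le> M * r powr (- (2 * s))"
    "\<And>r. 2 \<le> r \<Longrightarrow> m * r powr (- (2 * s)) \<le> (\<integral>x. stable_density s 1 x * (1 - exp (- (x / r)\<^sup>2)) \<partial>lborel)"
proof -
  define K where "K = (\<integral>z. \<bar>z\<bar> powr (2 * s) * exp (- z\<^sup>2) \<partial>lborel)"
  have Ki: "integrable lborel (\<lambda>z. \<bar>z\<bar> powr (2 * s) * exp (- z\<^sup>2))"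
  proof (rule integrable_le)
    show "integrable lborel (\<lambda>z::real. 2 * exp (- (1/2) * z\<^sup>2))"
      using integrable_gauss[of "1/2"] by (intro integrable_mult_right) auto
    fix z :: real
    have "\<bar>z\<bar> powr (2 * s) \<le> 1 + z\<^sup>2" using s by (intro powr_abs_le) auto
    also have "\<dots> \<le> 2 * (1 + z\<^sup>2 / 2)" by simp
    also have "\<dots> \<le> 2 * exp (z\<^sup>2 / 2)" by (intro mult_left_mono exp_ge_add_one_self) auto
    finally have "\<bar>z\<bar> powr (2 * s) * exp (- z\<^sup>2) \<le> 2 * exp (z\<^sup>2 / 2) * exp (- z\<^sup>2)" by (intro mult_right_mono) auto
    also have "\<dots> = 2 * exp (- (1/2) * z\<^sup>2)" by (simp add: exp_add[symmetric])
    finally show "\<bar>\<bar>z\<bar> powr (2 * s) * exp (- z\<^sup>2)\<bar> \<le> 2 * exp (- (1/2) * z\<^sup>2)" by (simp add: abs_mult)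
  qed measurable
  \<comment> \<open>The factors are the minimum of exp(-z^2) on [0, 1], the 1/2 from u/2 <= 1 -
    exp(-u), and the integral of z^(2s) over [0, 1]; the lower bound keeps only these z.\<close>
  have k: "0 < exp (- 1) / 2 * (1 / (2 * s + 1))" (is "0 < ?k") using s by simp
  let ?D = "\<lambda>q. (\<integral>z. (1 - exp (- q * \<bar>z\<bar> powr (2 * s))) * exp (- z\<^sup>2) \<partial>lborel)"
  have Di: "integrable lborel (\<lambda>z. (1 - exp (- q * \<bar>z\<bar> powr (2 * s))) * exp (- z\<^sup>2))" if "0 \<le> q" for q
  proof (rule integrable_le[OF integrable_gauss_1(1)])
    show "\<bar>(1 - exp (- q * \<bar>z\<bar> powr (2 * s))) * exp (- z\<^sup>2)\<bar> \<le> exp (- z\<^sup>2)" for z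
      using that by (simp add: abs_mult mult_left_le_one_le abs_le_iff)
  qed measurable
  have up: "?D q \<le> q * K" if "0 \<le> q" for q
    unfolding K_def integral_mult_right_zero[symmetric]
  proof (rule integral_mono[OF Di[OF that]])
    show "(1 - exp (- q * \<bar>z\<bar> powr (2 * s))) * exp (- z\<^sup>2) \<le> q * (\<bar>z\<bar> powr (2 * s) * exp (- z\<^sup>2))" for z
      using one_minus_exp_bounds(1)[of "q * \<bar>z\<bar> powr (2 * s)"] by (simp add: mult.assoc[symmetric])
  qed (use Ki in auto)
  have lo: "q * ?k \<le> ?D q" if q: "0 \<le> q" "q \<le> 1" for q
  proof -
    have h: "has_bochner_integral lborel (\<lambda>z. indicator {0..1} z * z powr (2 * s)) (1 / (2 * s + 1))"
      using powr_weight_near_0[of "2 * s" 1] s by simp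
    have "q * ?k = (\<integral>z. q * (exp (-1) / 2) * (indicator {0..1} z * z powr (2 * s)) \<partial>lborel)"
      using has_bochner_integral_integral_eq[OF h] by simp
    also have "\<dots> \<le> ?D q"
    proof (rule integral_mono[OF _ Di[OF q(1)]])
      show "integrable lborel (\<lambda>z. q * (exp (-1) / 2) * (indicator {0..1} z * z powr (2 * s)))"
        using integrable.intros[OF h] by simp
      fix z :: real
      show "q * (exp (-1) / 2) * (indicator {0..1} z * z powr (2 * s)) \<le> (1 - exp (- q * \<bar>z\<bar> powr (2 * s))) * exp (- z\<^sup>2)"
      proof (cases "z \<in> {0..1}")
        case True
        have "z powr (2 * s) \<le> 1" using True s by (intro powr_le1) auto
        then have "q * z powr (2 * s) \<le> 1" using q by (intro mult_le_one) auto
        then have "q * z powr (2 * s) / 2 \<le> 1 - exp (- (q * z powr (2 * s)))"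
          using q by (intro one_minus_exp_bounds) auto
        moreover have "exp (-1) \<le> exp (- z\<^sup>2)" using True by (simp add: power_le_one)
        ultimately have "q * z powr (2 * s) / 2 * exp (-1) \<le> (1 - exp (- (q * z powr (2 * s)))) * exp (- z\<^sup>2)"
          using q by (intro mult_mono) auto
        then show ?thesis using True by (simp add: ac_simps)
      qed (use q in \<open>simp add: mult_nonneg_nonneg\<close>)
    qed
    finally show ?thesis .
  qed
  have eq: "has_bochner_integral lborel (\<lambda>x. stable_density s 1 x * (1 - exp (- (x / r)\<^sup>2))) (?D ((2 / r) powr (2 * s)) / sqrt pi)"
    if r: "0 < r" for r
  proof -
    let ?q = "(2 / r) powr (2 * s)"
    have i: "integrable lborel (\<lambda>z. exp (- ?q * \<bar>z\<bar> powr (2 * s)) * exp (- z\<^sup>2))"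
      by (rule integrable_le[OF integrable_gauss_1(1)]) (auto simp: abs_mult)
    have "?D ?q = (\<integral>z. exp (- z\<^sup>2) - exp (- ?q * \<bar>z\<bar> powr (2 * s)) * exp (- z\<^sup>2) \<partial>lborel)"
      by (simp add: algebra_simps)
    also have "\<dots> = sqrt pi - (\<integral>z. exp (- ?q * \<bar>z\<bar> powr (2 * s)) * exp (- z\<^sup>2) \<partial>lborel)"
      using integrable_gauss_1 i by (subst Bochner_Integration.integral_diff) auto
    finally have "?D ?q / sqrt pi = 1 - (\<integral>z. exp (- ?q * \<bar>z\<bar> powr (2 * s)) * exp (- z\<^sup>2) \<partial>lborel) / sqrt pi"
      by (simp add: diff_divide_distrib)
    then show ?thesis
      using has_bochner_integral_diff[OF stable_density_has_integral stable_density_gauss_average[OF r]]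
      by (simp only: right_diff_distrib mult_1_right)
  qed
  have q: "(2 / r) powr (2 * s) = 2 powr (2 * s) * r powr (- (2 * s))" if "0 < r" for r
    using that by (simp add: powr_divide powr_minus field_simps)
  have K0: "0 \<le> K" unfolding K_def by simp
  \<comment> \<open>\<open>K + 1\<close> instead of \<open>K\<close> makes the constant of the upper
    bound visibly positive.\<close>
  show ?thesis
  proof (rule that[of "2 powr (2 * s) * ?k / sqrt pi" "2 powr (2 * s) * (K + 1) / sqrt pi"])
    fix r :: real
    show "integrable lborel (\<lambda>x. stable_density s 1 x * (1 - exp (- (x / r)\<^sup>2)))" if "0 < r"
      using integrable.intros[OF eq[OF that]] .
    show "(\<integral>x. stable_density s 1 x * (1 - exp (- (x / r)\<^sup>2)) \<partial>lborel) \<le> 2 powr (2 * s) * (K + 1) / sqrt pi * r powr (- (2 * s))"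
      if "0 < r"
    proof -
      have "?D ((2 / r) powr (2 * s)) \<le> (2 / r) powr (2 * s) * K" by (rule up) simp
      also have "\<dots> \<le> (2 / r) powr (2 * s) * (K + 1)" by (intro mult_left_mono) auto
      finally show ?thesis
        unfolding has_bochner_integral_integral_eq[OF eq[OF that]] q[OF that]
        by (simp add: field_simps)
    qed
    show "2 powr (2 * s) * ?k / sqrt pi * r powr (- (2 * s)) \<le> (\<integral>x. stable_density s 1 x * (1 - exp (- (x / r)\<^sup>2)) \<partial>lborel)"
      if "2 \<le> r"
    proof -
      have r: "0 < r" using that by simp
      have "(2 / r) powr (2 * s) * ?k \<le> ?D ((2 / r) powr (2 * s))"
        by (rule lo) (use that s in \<open>auto intro!: powr_le1\<close>)
      from divide_right_mono[OF this, of "sqrt pi"] show ?thesis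
        unfolding has_bochner_integral_integral_eq[OF eq[OF r]] q[OF r]
        by (simp add: ac_simps)
    qed
  qed (use s K0 in \<open>auto intro!: divide_pos_pos mult_pos_pos add_nonneg_pos\<close>)
qed

end

section \<open>Pointwise tail bounds of the kernel\<close>

context
  fixes s :: real
  assumes s: "1/2 < s" "s < 1"
begin

text \<open>On [x/2, x] monotonicity keeps the density at least at its value at x, and the deficit
  weight with r = x/2 is at least 1 - exp(-1) there. So x/2 times the density at x is bounded by a
  multiple of x^(-2s).\<close>

lemma stable_density_tail_upper:
  obtains C where "0 < C" "\<And>x. 0 < x \<Longrightarrow> stable_density s 1 x \<le> C * x powr (- (1 + 2 * s))"
proof -
  obtain m M where M: "0 < (M::real)"
    and i: "\<And>r. 0 < r \<Longrightarrow> integrable lborel (\<lambda>x. stable_density s 1 x * (1 - exp (- (x / r)\<^sup>2)))"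
    and up: "\<And>r. 0 < r \<Longrightarrow> (\<integral>x. stable_density s 1 x * (1 - exp (- (x / r)\<^sup>2)) \<partial>lborel) \<le> M * r powr (- (2 * s))"
    by (rule stable_density_gauss_deficit[OF s]) blast
  define e where "e = (1 - exp (-1) :: real)"
  have e: "0 < e" by (simp add: e_def)
  note nn = stable_density_nonneg[OF s zero_less_one]
  have bound: "stable_density s 1 x \<le> (M / e * 2 powr (1 + 2 * s)) * x powr (- (1 + 2 * s))" if x: "0 < x" for x
  proof -
    define r where "r = x / 2"
    have r: "0 < r" using x by (simp add: r_def)
    have "r * (stable_density s 1 x * e) = (\<integral>y. indicator {r..x} y * (stable_density s 1 x * e) \<partial>lborel)"
      using x by (simp add: r_def)
    also have "\<dots> \<le> (\<integral>y. stable_density s 1 y * (1 - exp (- (y / r)\<^sup>2)) \<partial>lborel)"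
    proof (rule integral_mono[OF _ i[OF r]])
      show "integrable lborel (\<lambda>y. indicator {r..x} y * (stable_density s 1 x * e))"
        by (intro integrable_mult_left integrable_real_indicator) (auto simp: emeasure_lborel_Icc_eq)
      fix y
      show "indicator {r..x} y * (stable_density s 1 x * e) \<le> stable_density s 1 y * (1 - exp (- (y / r)\<^sup>2))"
      proof (cases "y \<in> {r..x}")
        case True
        then have "1 \<le> y / r" using r by simp
        then have "1 \<le> (y / r)\<^sup>2" by (rule one_le_power)
        then have "e \<le> 1 - exp (- (y / r)\<^sup>2)" by (simp add: e_def)
        then have "stable_density s 1 x * e \<le> stable_density s 1 y * (1 - exp (- (y / r)\<^sup>2))"
          using True r e by (intro mult_mono stable_density_noninc[OF s] nn) auto
        then show ?thesis using True by simp
      qed (use nn in simp)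
    qed
    also have "\<dots> \<le> M * r powr (- (2 * s))" by (rule up[OF r])
    finally have "stable_density s 1 x \<le> M * r powr (- (2 * s)) / (r * e)"
      using r e by (simp add: pos_le_divide_eq ac_simps)
    also have "\<dots> = M / e * (r powr (- (2 * s)) / r)" by simp
    also have "r powr (- (2 * s)) / r = r powr (- (2 * s) - 1)" using r by (simp add: powr_diff)
    also have "- (2 * s) - 1 = - (1 + 2 * s)" by simp
    also have "r powr (- (1 + 2 * s)) = 2 powr (1 + 2 * s) * x powr (- (1 + 2 * s))"
      using x unfolding r_def by (simp only: powr_divide powr_minus) (simp add: field_simps)
    finally show ?thesis by simp
  qed
  show ?thesis by (rule that[OF _ bound]) (use M e in auto)
qed

text \<open>The deficit, at least m r^(-2s), cannot come mainly from |x| <= r a, where the weight is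
  at most (x/r)^2, nor from |x| > r A, where the upper tail bound is integrable, once a is small and
  A is large. A fixed share lies in between, where monotonicity bounds the density by its value at r
  a; this forces that value up.\<close>

lemma stable_density_tail_lower:
  obtains c x0 where "0 < c" "0 < x0" "\<And>x. x0 \<le> x \<Longrightarrow> c * x powr (- (1 + 2 * s)) \<le> stable_density s 1 x"
proof -
  obtain m M where m: "0 < (m::real)"
    and i: "\<And>r. 0 < r \<Longrightarrow> integrable lborel (\<lambda>x. stable_density s 1 x * (1 - exp (- (x / r)\<^sup>2)))"
    and lo: "\<And>r. 2 \<le> r \<Longrightarrow> m * r powr (- (2 * s)) \<le> (\<integral>x. stable_density s 1 x * (1 - exp (- (x / r)\<^sup>2)) \<partial>lborel)"
    by (rule stable_density_gauss_deficit[OF s]) blast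
  obtain C where C: "0 < C" and up: "\<And>x. 0 < x \<Longrightarrow> stable_density s 1 x \<le> C * x powr (- (1 + 2 * s))"
    using stable_density_tail_upper by blast
  note nn = stable_density_nonneg[OF s zero_less_one]
  \<comment> \<open>Solved so that the inner and the outer range each contribute m/8 times r^(-2s)
    on the half line, together half of the lower bound after doubling by symmetry.\<close>
  define a where "a = (m * (2 - 2 * s) / (8 * C)) powr (1 / (2 - 2 * s))"
  define A where "A = (m * (2 * s) / (8 * C)) powr (- 1 / (2 * s))"
  have a: "0 < a" "C * (a powr (2 - 2 * s) / (2 - 2 * s)) = m / 8"
    using m C s by (auto simp: a_def powr_powr)
  have A: "0 < A" "C * (A powr (- (2 * s)) / (2 * s)) = m / 8"
    using m C s by (auto simp: A_def powr_powr)
  have main: "m / (4 * A) * r powr (- (1 + 2 * s)) \<le> stable_density s 1 (r * a)" if r: "2 \<le> r" for r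
  proof -
    let ?h = "\<lambda>x. stable_density s 1 x * (1 - exp (- (x / r)\<^sup>2))"
    \<comment> \<open>Majorant over the three ranges. The middle term covers all of [0, r A], so the
      majorant is valid whichever of \<open>a\<close> and \<open>A\<close> is larger.\<close>
    let ?g = "\<lambda>x. C / r\<^sup>2 * (indicator {0..r * a} x * x powr (1 - 2 * s)) + indicator {0..r * A} x * stable_density s 1 (r * a)
       + C * levy_weight (2 * s) (r * A) x"
    have r0: "0 < r" using r by simp
    have hi: "integrable lborel (\<lambda>x. indicator {0..} x *\<^sub>R ?h x)"
      using integrable_mult_indicator[OF _ i[OF r0], of "{0..}"] by simp
    have h2: "integral\<^sup>L lborel ?h = 2 * (\<integral>x. indicator {0..} x *\<^sub>R ?h x \<partial>lborel)"
      using has_bochner_integral_even_function[OF has_bochner_integral_integrable[OF hi]]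
      by (simp add: has_bochner_integral_integral_eq)
    have g1: "has_bochner_integral lborel (\<lambda>x. C / r\<^sup>2 * (indicator {0..r * a} x * x powr (1 - 2 * s))) (C / r\<^sup>2 * ((r * a) powr (2 - 2 * s) / (2 - 2 * s)))"
      using powr_weight_near_0[of "1 - 2 * s" "r * a"] s r0 a by (intro has_bochner_integral_mult_right) auto
    have g2: "has_bochner_integral lborel (\<lambda>x. indicator {0..r * A} x * stable_density s 1 (r * a)) (r * A * stable_density s 1 (r * a))"
      using r0 A by (intro has_bochner_integral_mult_left) (auto simp: has_bochner_integral_iff)
    have g3: "has_bochner_integral lborel (\<lambda>x. C * levy_weight (2 * s) (r * A) x) (C * ((r * A) powr (- (2 * s)) / (2 * s)))"
      using r0 A s by (intro has_bochner_integral_mult_right levy_weight_tail) auto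
    note g = has_bochner_integral_add[OF has_bochner_integral_add[OF g1 g2] g3]
    have le: "indicator {0..} x *\<^sub>R ?h x \<le> ?g x" for x
    proof (cases "0 < x")
      case False
      then have "indicator {0..} x *\<^sub>R ?h x = 0" by (cases "x = 0") (auto simp: indicator_def)
      moreover have "0 \<le> ?g x" using C nn s by (intro add_nonneg_nonneg mult_nonneg_nonneg) auto
      ultimately show ?thesis by (simp only:)
    next
      case True
      have e1: "1 - exp (- (x / r)\<^sup>2) \<le> 1" by simp
      have e0: "0 \<le> 1 - exp (- (x / r)\<^sup>2)" by simp
      have h1: "?h x \<le> stable_density s 1 x" using mult_left_mono[OF e1 nn] by simp
      have t: "0 \<le> C / r\<^sup>2 * (indicator {0..r * a} x * x powr (1 - 2 * s))"
        "0 \<le> indicator {0..r * A} x * stable_density s 1 (r * a)" "0 \<le> C * levy_weight (2 * s) (r * A) x"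
        using C nn by auto
      consider "x \<le> r * a" | "r * a < x" "x \<le> r * A" | "r * A < x" by linarith
      then have "?h x \<le> ?g x"
      proof cases
        case 1
        have "?h x \<le> (C * x powr (- (1 + 2 * s))) * (x / r)\<^sup>2"
          using up[OF True] one_minus_exp_bounds(1)[of "(x / r)\<^sup>2"] C e0 by (intro mult_mono) auto
        also have "\<dots> = C / r\<^sup>2 * x powr (1 - 2 * s)"
          using True powr_add[of x 2 "- (1 + 2 * s)"] by (simp add: powr_numeral power_divide)
        finally show ?thesis using t 1 True by simp
      next
        case 2
        have "stable_density s 1 x \<le> stable_density s 1 (r * a)"
          using 2 r0 a by (intro stable_density_noninc[OF s]) auto
        then show ?thesis using t 2 True h1 by simp
      next
        case 3
        then show ?thesis using t True h1 up[OF True] by (simp add: levy_weight_def)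
      qed
      then show ?thesis using True by simp
    qed
    have p1: "C / r\<^sup>2 * ((r * a) powr (2 - 2 * s) / (2 - 2 * s)) = m / 8 * r powr (- (2 * s))"
    proof -
      have "(r * a) powr (2 - 2 * s) = r\<^sup>2 * r powr (- (2 * s)) * a powr (2 - 2 * s)"
        using r0 a powr_add[of r 2 "- (2 * s)"] by (simp add: powr_mult powr_numeral)
      then have "C / r\<^sup>2 * ((r * a) powr (2 - 2 * s) / (2 - 2 * s)) = r powr (- (2 * s)) * (C * (a powr (2 - 2 * s) / (2 - 2 * s)))"
        using r0 by simp
      then show ?thesis unfolding a(2) by simp
    qed
    have p3: "C * ((r * A) powr (- (2 * s)) / (2 * s)) = m / 8 * r powr (- (2 * s))"
    proof -
      have "(r * A) powr (- (2 * s)) = r powr (- (2 * s)) * A powr (- (2 * s))"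
        using r0 A by (simp add: powr_mult)
      then have "C * ((r * A) powr (- (2 * s)) / (2 * s)) = r powr (- (2 * s)) * (C * (A powr (- (2 * s)) / (2 * s)))"
        by simp
      then show ?thesis unfolding A(2) by simp
    qed
    have "m * r powr (- (2 * s)) \<le> 2 * (\<integral>x. indicator {0..} x *\<^sub>R ?h x \<partial>lborel)"
      using lo[OF r] h2 by simp
    also have "\<dots> \<le> 2 * integral\<^sup>L lborel ?g"
      by (intro mult_left_mono integral_mono[OF hi integrable.intros[OF g] le]) simp
    also have "integral\<^sup>L lborel ?g = m / 4 * r powr (- (2 * s)) + r * A * stable_density s 1 (r * a)"
      unfolding has_bochner_integral_integral_eq[OF g] p1 p3 by simp
    finally have "m / 4 * r powr (- (2 * s)) \<le> r * A * stable_density s 1 (r * a)"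
      by (simp add: algebra_simps)
    moreover have "m / (4 * A) * r powr (- (1 + 2 * s)) * (r * A) = m / 4 * r powr (- (2 * s))"
      using r0 A powr_add[of r "-1" "- (2 * s)"] by (simp add: powr_neg_one field_simps)
    ultimately have "m / (4 * A) * r powr (- (1 + 2 * s)) * (r * A) \<le> stable_density s 1 (r * a) * (r * A)"
      by (simp add: mult.commute)
    then show ?thesis using r0 A by (simp add: mult_le_cancel_right_pos del: times_divide_eq_left times_divide_eq_right)
  qed
  have "(m / (4 * A) * a powr (1 + 2 * s)) * x powr (- (1 + 2 * s)) \<le> stable_density s 1 x" if x: "2 * a \<le> x" for x
  proof -
    have "(x / a) powr (- (1 + 2 * s)) = a powr (1 + 2 * s) * x powr (- (1 + 2 * s))"
      using x a by (simp only: powr_divide powr_minus) (simp add: field_simps)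
    then show ?thesis using main[of "x / a"] x a by (simp add: field_simps)
  qed
  then show ?thesis using that[of "m / (4 * A) * a powr (1 + 2 * s)" "2 * a"] a A m by auto
qed

lemma stable_density_profile:
  obtains c C where "0 < c" "0 < C"
    "\<And>x. c * (1 + x\<^sup>2) powr (- ((1 + 2 * s) / 2)) \<le> stable_density s 1 x"
    "\<And>x. stable_density s 1 x \<le> C * (1 + x\<^sup>2) powr (- ((1 + 2 * s) / 2))"
proof -
  obtain C where C: "0 < C" and up: "\<And>x. 0 < x \<Longrightarrow> stable_density s 1 x \<le> C * x powr (- (1 + 2 * s))"
    using stable_density_tail_upper by blast
  obtain c x0 where c: "0 < c" "0 < x0" and lo: "\<And>x. x0 \<le> x \<Longrightarrow> c * x powr (- (1 + 2 * s)) \<le> stable_density s 1 x"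
    by (rule stable_density_tail_lower) blast
  define b where "b = (1 + 2 * s) / 2"
  have b: "0 < b" using s by (simp add: b_def)
  have sq: "x powr (- (1 + 2 * s)) = (x\<^sup>2) powr (- b)" if "0 < x" for x :: real
  proof -
    have "(x\<^sup>2) powr (- b) = (x powr 2) powr (- b)" using that by simp
    also have "\<dots> = x powr (2 * - b)" by (rule powr_powr)
    also have "2 * - b = - (1 + 2 * s)" by (simp add: b_def field_simps)
    finally show ?thesis by simp
  qed
  note nn = stable_density_nonneg[OF s zero_less_one]
  note noninc = stable_density_noninc(2)[OF s zero_less_one]
  \<comment> \<open>For |x| < \<open>x0\<close> the density is at least its value at
    \<open>x0\<close>, which is positive by the tail bound. In \<open>C'\<close> the factor 2^b
    comes from 1 + x^2 <= 2 max(1, x^2).\<close>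
  define c' where "c' = min c (stable_density s 1 x0)"
  define C' where "C' = (C + stable_density s 1 0) * 2 powr b"
  have "0 < c * x0 powr (- (1 + 2 * s))" using c by simp
  then have p0: "0 < stable_density s 1 x0" using lo[of x0] by linarith
  have lower: "c' * (1 + x\<^sup>2) powr (- b) \<le> stable_density s 1 x" for x
  proof (cases "x0 \<le> \<bar>x\<bar>")
    case True
    have "c' * (1 + x\<^sup>2) powr (- b) \<le> c * (\<bar>x\<bar>\<^sup>2) powr (- b)"
      using True c b p0 by (intro mult_mono powr_mono2') (auto simp: c'_def)
    also have "\<dots> \<le> stable_density s 1 \<bar>x\<bar>" using lo[OF True] True c sq[of "\<bar>x\<bar>"] by auto
    finally show ?thesis by simp
  next
    case False
    have "c' * (1 + x\<^sup>2) powr (- b) \<le> c' * 1 powr (- b)"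
      using b p0 c by (intro mult_left_mono powr_mono2') (auto simp: c'_def)
    also have "\<dots> \<le> stable_density s 1 x0" by (simp add: c'_def)
    also have "\<dots> \<le> stable_density s 1 \<bar>x\<bar>" using False by (intro noninc) auto
    finally show ?thesis by simp
  qed
  have upper: "stable_density s 1 x \<le> C' * (1 + x\<^sup>2) powr (- b)" for x
  proof -
    have 2: "2 powr b * (1 + x\<^sup>2) powr (- b) = ((1 + x\<^sup>2) / 2) powr (- b)"
      by (simp add: powr_divide powr_minus field_simps add_pos_nonneg)
    show ?thesis
    proof (cases "1 \<le> \<bar>x\<bar>")
      case True
      then have "1 \<le> x\<^sup>2" using one_le_power[OF True, of 2] by simp
      have "stable_density s 1 \<bar>x\<bar> \<le> C * (\<bar>x\<bar>\<^sup>2) powr (- b)" using up[of "\<bar>x\<bar>"] sq[of "\<bar>x\<bar>"] True by simp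
      also have "\<dots> \<le> (C + stable_density s 1 0) * ((1 + x\<^sup>2) / 2) powr (- b)"
        using \<open>1 \<le> x\<^sup>2\<close> C nn[of 0] b by (intro mult_mono powr_mono2') (auto simp: add_pos_nonneg)
      finally show ?thesis by (simp add: C'_def mult.assoc 2)
    next
      case False
      then have "x\<^sup>2 \<le> 1" using power_le_one[of "\<bar>x\<bar>" 2] by simp
      have "stable_density s 1 \<bar>x\<bar> \<le> stable_density s 1 0 * 1 powr (-b)" using noninc[of 0 "\<bar>x\<bar>"] by simp
      also have "\<dots> \<le> (C + stable_density s 1 0) * ((1 + x\<^sup>2) / 2) powr (- b)"
        using \<open>x\<^sup>2 \<le> 1\<close> C nn[of 0] b by (intro mult_mono powr_mono2') (auto simp: add_pos_nonneg)
      finally show ?thesis by (simp add: C'_def mult.assoc 2)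
    qed
  qed
  show ?thesis
    by (rule that[of c' C']) (use c C p0 nn[of 0] lower upper in \<open>auto simp: b_def c'_def C'_def add_pos_nonneg\<close>)
qed

section \<open>Self-similarity and identification of the kernel\<close>

lemma stable_density_scaling:
  assumes t: "0 < t"
  shows "stable_density s t x = t powr (- 1 / (2 * s)) * stable_density s 1 (t powr (- 1 / (2 * s)) * x)"
proof -
  define q where "q = t powr (- 1 / (2 * s))"
  have q: "0 < q" using t by (simp add: q_def)
  have qp: "q powr (2 * s) = 1 / t" using t s by (simp add: q_def powr_powr powr_neg_one)
  have "stable_symbol s t (q * z) = stable_symbol s 1 z" for z
    using q t by (simp add: stable_symbol_def abs_mult powr_mult qp)
  moreover have "cos_transform (stable_symbol s t) x = q * (\<integral>z. cos (x * (q * z)) * stable_symbol s t (q * z) \<partial>lborel)"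
    unfolding cos_transform_def using q by (subst lborel_integral_real_affine[of q _ 0]) auto
  ultimately show ?thesis
    unfolding stable_density_def cos_transform_def q_def[symmetric] by (simp add: ac_simps)
qed

lemma stable_density_bounds:
  obtains c C where "0 < c" "0 < C"
    "\<And>t x. 0 < t \<Longrightarrow> c * (t / (t powr (1 / s) + x\<^sup>2) powr ((1 + 2 * s) / 2)) \<le> stable_density s t x"
    "\<And>t x. 0 < t \<Longrightarrow> stable_density s t x \<le> C * (t / (t powr (1 / s) + x\<^sup>2) powr ((1 + 2 * s) / 2))"
proof -
  obtain c C where c: "0 < c" "0 < C"
    and lo: "\<And>x. c * (1 + x\<^sup>2) powr (- ((1 + 2 * s) / 2)) \<le> stable_density s 1 x"
    and up: "\<And>x. stable_density s 1 x \<le> C * (1 + x\<^sup>2) powr (- ((1 + 2 * s) / 2))"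
    by (rule stable_density_profile) blast
  define b where "b = (1 + 2 * s) / 2"
  \<comment> \<open>With q = t^(-1/(2s)) one has q^2 t^(1/s) = 1 and q^(1+2s) = q/t; this turns the
    rescaled profile into t / (t^(1/s) + x^2)^b.\<close>
  have eq: "t / (t powr (1 / s) + x\<^sup>2) powr b = t powr (- 1 / (2 * s)) * (1 + (t powr (- 1 / (2 * s)) * x)\<^sup>2) powr (- b)"
    if t: "0 < t" for t x :: real
  proof -
    define q where "q = t powr (- 1 / (2 * s))"
    have q: "0 < q" using t by (simp add: q_def)
    have qq: "q\<^sup>2 = q powr 2" using q by simp
    have "q\<^sup>2 = t powr (- 1 / (2 * s) * 2)" unfolding qq unfolding q_def by (rule powr_powr)
    also have "- 1 / (2 * s) * 2 = - (1 / s)" by simp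
    finally have q2: "q\<^sup>2 * t powr (1 / s) = 1" using t by (simp add: powr_minus)
    have "q powr (2 * b) = t powr (- 1 / (2 * s) * (2 * b))" unfolding q_def by (rule powr_powr)
    also have "- 1 / (2 * s) * (2 * b) = - 1 / (2 * s) + - 1" using s by (simp add: b_def field_simps)
    finally have q3: "q powr (2 * b) = q / t" using t by (simp add: powr_diff q_def)
    have "1 + (q * x)\<^sup>2 = q\<^sup>2 * (t powr (1 / s) + x\<^sup>2)"
      by (simp add: distrib_left q2 power_mult_distrib)
    moreover have "0 < t powr (1 / s) + x\<^sup>2" using t by (simp add: add_pos_nonneg)
    ultimately have "(1 + (q * x)\<^sup>2) powr (- b) = (q\<^sup>2) powr (- b) * (t powr (1 / s) + x\<^sup>2) powr (- b)"
      using q by (simp add: powr_mult)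
    also have "(q\<^sup>2) powr (- b) = 1 / q powr (2 * b)"
      unfolding qq powr_powr by (simp add: powr_minus field_simps)
    also have "1 / q powr (2 * b) = t / q" by (simp add: q3)
    finally show ?thesis
      using q unfolding q_def[symmetric] by (simp add: powr_minus field_simps)
  qed
  show ?thesis
  proof (rule that[OF c])
    fix t x :: real assume t: "0 < t"
    show "c * (t / (t powr (1 / s) + x\<^sup>2) powr ((1 + 2 * s) / 2)) \<le> stable_density s t x"
      using mult_left_mono[OF lo[of "t powr (- 1 / (2 * s)) * x"], of "t powr (- 1 / (2 * s))"]
      unfolding b_def[symmetric] eq[OF t] stable_density_scaling[OF t, of x] by (simp add: ac_simps)
    show "stable_density s t x \<le> C * (t / (t powr (1 / s) + x\<^sup>2) powr ((1 + 2 * s) / 2))"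
      using mult_left_mono[OF up[of "t powr (- 1 / (2 * s)) * x"], of "t powr (- 1 / (2 * s))"]
      unfolding b_def[symmetric] eq[OF t] stable_density_scaling[OF t, of x] by (simp add: ac_simps)
  qed
qed

lemma frac_heat_kernel_eq:
  assumes t: "0 < t"
  shows "frac_heat_kernel s x t = stable_density s t x"
proof -
  let ?f = "\<lambda>\<xi>. exp (\<i> * complex_of_real (x * \<xi>)) * complex_of_real (exp (- (\<bar>\<xi>\<bar> powr (2 * s)) * t))"
  have "integrable lborel ?f"
  proof (rule Bochner_Integration.integrable_bound)
    show "integrable lborel (stable_symbol s t)" using stable_symbol_integrable(2) s t by simp
    have "(\<lambda>\<xi>. exp (\<i> * complex_of_real (x * \<xi>))) \<in> borel_measurable borel"
      by (intro borel_measurable_continuous_onI continuous_intros)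
    then show "?f \<in> borel_measurable lborel" by simp
    show "AE \<xi> in lborel. norm (?f \<xi>) \<le> norm (stable_symbol s t \<xi>)"
      by (intro AE_I2) (simp add: norm_mult stable_symbol_def mult.commute)
  qed
  then have "Re (integral\<^sup>L lborel ?f) = (\<integral>\<xi>. Re (?f \<xi>) \<partial>lborel)"
    by (rule integral_Re[symmetric])
  also have "\<dots> = cos_transform (stable_symbol s t) x"
    unfolding cos_transform_def
    by (rule Bochner_Integration.integral_cong) (simp_all add: stable_symbol_def mult.commute Re_exp)
  finally show ?thesis
    unfolding frac_heat_kernel_def inv_fourier_def stable_density_def by simp
qed

end

section \<open>Consistency of the one-dimensional operator\<close>

lemma integral_lincomb:
  fixes f g h :: "real \<Rightarrow> real"
  assumes "integrable lborel f" "integrable lborel g" "integrable lborel h"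
  shows "(\<integral>x. f x - g x + c * h x \<partial>lborel) = integral\<^sup>L lborel f - integral\<^sup>L lborel g + c * integral\<^sup>L lborel h"
  using assms by simp

lemma two_minus_two_cos: "2 - 2 * cos u \<le> u\<^sup>2" "0 \<le> 2 - 2 * cos u" "\<bar>2 - 2 * cos u\<bar> \<le> 4" for u :: real
proof -
  have "2 - 2 * cos u = 4 * (sin (u / 2))\<^sup>2" using cos_double_sin[of "u / 2"] by simp
  also have "\<dots> \<le> 4 * (u / 2)\<^sup>2"
    using power_mono[OF abs_sin_x_le_abs_x[of "u / 2"], of 2] unfolding power2_abs by simp
  finally show "2 - 2 * cos u \<le> u\<^sup>2" by (simp add: power_divide)
  show "0 \<le> 2 - 2 * cos u" "\<bar>2 - 2 * cos u\<bar> \<le> 4" using cos_le_one[of u] cos_ge_minus_one[of u] by linarith+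
qed

lemma exp_minus_quadratic: "0 \<le> a \<Longrightarrow> \<bar>exp (- a) - 1 + a\<bar> \<le> a\<^sup>2" for a :: real
proof -
  assume a: "0 \<le> a"
  have "0 \<le> exp (- a) - 1 + a" using exp_ge_add_one_self[of "- a"] by linarith
  moreover have "exp (- a) \<le> 1 - a + a\<^sup>2"
  proof -
    have "1 \<le> (1 - a + a\<^sup>2) * (1 + a)" using a by (simp add: algebra_simps power2_eq_square)
    also have "\<dots> \<le> (1 - a + a\<^sup>2) * exp a"
    proof (intro mult_left_mono exp_ge_add_one_self_aux)
      have "0 \<le> (1 - a / 2)\<^sup>2 + 3 * a\<^sup>2 / 4" by simp
      also have "\<dots> = 1 - a + a\<^sup>2" by (simp add: power2_eq_square algebra_simps)
      finally show "0 \<le> 1 - a + a\<^sup>2" .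
    qed (use a in auto)
    finally show ?thesis by (simp add: exp_minus field_simps)
  qed
  ultimately show ?thesis by simp
qed

lemma C_frac_pos: "0 < s \<Longrightarrow> s < 1 \<Longrightarrow> 0 < C_frac s"
  unfolding C_frac_def by (intro divide_pos_pos mult_pos_pos Gamma_real_pos) auto

text \<open>Fourier multiplier of minus the truncated one-dimensional operator: a second difference
  with step r multiplies cos(x xi) by 2 cos(xi r) - 2.\<close>

definition levy_symbol :: "real \<Rightarrow> real \<Rightarrow> real \<Rightarrow> real" where
  "levy_symbol s e \<xi> = C_frac s * (\<integral>r. levy_weight (2 * s) e r * (2 - 2 * cos (\<xi> * r)) \<partial>lborel)"

text \<open>The value is 1 by the choice of \<open>C_frac\<close>, but only its positivity matters: the two-sided bounds
  do not see a dilation of time.\<close>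

definition diffusivity :: "real \<Rightarrow> real" where
  "diffusivity s = levy_symbol s 0 1"

definition levy_operator :: "real \<Rightarrow> real \<Rightarrow> (real \<Rightarrow> real) \<Rightarrow> real \<Rightarrow> real" where
  "levy_operator s e v x = C_frac s * (\<integral>r. levy_weight (2 * s) e r * (v (x + r) + v (x - r) - 2 * v x) \<partial>lborel)"

text \<open>Up to the factor \<open>2 * pi\<close>, the solution at time \<open>T\<close> of the one-dimensional fractional heat equation
  whose initial datum has the even Fourier transform \<open>g\<close>.\<close>

definition stable_flow :: "real \<Rightarrow> (real \<Rightarrow> real) \<Rightarrow> real \<Rightarrow> real \<Rightarrow> real" where
  "stable_flow s g T = cos_transform (\<lambda>\<xi>. g \<xi> * stable_symbol s T \<xi>)"

text \<open>The frequency moment in every error bound: 1 + xi^4 absorbs |xi|^(4s) from the time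
  discretisation and xi^2 from the truncation. The moment is finite only for \<open>d > 0\<close>,
  which is why barriers start at a positive time.\<close>

definition symbol_mass :: "real \<Rightarrow> real \<Rightarrow> real" where
  "symbol_mass s d = (\<integral>\<xi>. (1 + \<xi>^4) * stable_symbol s d \<xi> \<partial>lborel)"

lemma symbol_mass_nonneg: "0 \<le> symbol_mass s d"
  unfolding symbol_mass_def by (intro Bochner_Integration.integral_nonneg) simp

lemma stable_flow_minus [simp]: "stable_flow s g T (- x) = stable_flow s g T x"
  by (simp add: stable_flow_def cos_transform_def)

lemma continuous_cos_transform:
  assumes g: "integrable lborel g"
  shows "continuous_on A (cos_transform g)"
proof -
  have [measurable]: "g \<in> borel_measurable borel" using g by auto
  have "(\<lambda>n. cos_transform g (X n)) \<longlonglongrightarrow> cos_transform g x" if X: "X \<longlonglongrightarrow> x" for X x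
    unfolding cos_transform_def
  proof (rule integral_dominated_convergence)
    show "integrable lborel (\<lambda>\<xi>. \<bar>g \<xi>\<bar>)" using g by simp
    show "AE \<xi> in lborel. (\<lambda>n. cos (X n * \<xi>) * g \<xi>) \<longlonglongrightarrow> cos (x * \<xi>) * g \<xi>"
      by (intro AE_I2 tendsto_intros X)
    show "AE \<xi> in lborel. norm (cos (X n * \<xi>) * g \<xi>) \<le> \<bar>g \<xi>\<bar>" for n
      by (simp add: abs_mult mult_left_le_one_le)
  qed measurable
  then show ?thesis by (intro continuous_at_imp_continuous_on) (auto simp: continuous_at_sequentially o_def)
qed

context
  fixes s :: real
  assumes s: "1/2 < s" "s < 1"
begin

lemma levy_cos_integrable:
  assumes "0 \<le> e"
  shows "integrable lborel (\<lambda>r. levy_weight (2 * s) e r * (2 - 2 * cos (\<xi> * r)))"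
proof (rule levy_weight_integrable[where c=2 and M="max 4 (\<xi>\<^sup>2)"])
  show "\<bar>2 - 2 * cos (\<xi> * r)\<bar> \<le> max 4 (\<xi>\<^sup>2)" for r
    using two_minus_two_cos(3)[of "\<xi> * r"] by (simp only: le_max_iff_disj simp_thms)
  show "\<bar>2 - 2 * cos (\<xi> * r)\<bar> \<le> max 4 (\<xi>\<^sup>2) * r powr 2" if "0 < r" for r
  proof -
    have "\<bar>2 - 2 * cos (\<xi> * r)\<bar> = 2 - 2 * cos (\<xi> * r)" using two_minus_two_cos(2) by (rule abs_of_nonneg)
    also have "\<dots> \<le> \<xi>\<^sup>2 * r\<^sup>2" using two_minus_two_cos(1)[of "\<xi> * r"] by (simp add: power_mult_distrib)
    also have "\<dots> \<le> max 4 (\<xi>\<^sup>2) * r\<^sup>2" by (intro mult_right_mono) auto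
    finally show ?thesis using that by (simp add: powr_numeral)
  qed
qed (use s assms in auto)

lemma levy_symbol_0: "levy_symbol s 0 \<xi> = diffusivity s * \<bar>\<xi>\<bar> powr (2 * s)"
proof (cases "\<xi> = 0")
  case False
  have "cos (\<xi> * r) = cos (\<bar>\<xi>\<bar> * r)" for r by (simp add: abs_if)
  then show ?thesis
    using levy_weight_scale[of "\<bar>\<xi>\<bar>" "2 * s" "\<lambda>r. 2 - 2 * cos r"] False
    by (simp add: levy_symbol_def diffusivity_def)
qed (simp add: levy_symbol_def)

text \<open>The integrand is nonnegative, and on [1, 2], which lies below pi, 1 - cos r is at least
  1 - cos 1.\<close>

lemma diffusivity_pos: "0 < diffusivity s"
proof -
  have "0 < (\<integral>r. levy_weight (2 * s) 0 r * (2 - 2 * cos (1 * r)) \<partial>lborel)"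
  proof -
    have c1: "cos 1 < cos (0::real)" by (rule cos_monotone_0_pi) (use pi_gt3 in auto)
    have "0 < 2 powr (- (1 + 2 * s)) * (2 - 2 * cos 1)" using c1 by simp
    also have "\<dots> = integral\<^sup>L lborel (\<lambda>r::real. indicator {1..2} r * (2 powr (- (1 + 2 * s)) * (2 - 2 * cos 1)))" by simp
    also have "\<dots> \<le> (\<integral>r. levy_weight (2 * s) 0 r * (2 - 2 * cos (1 * r)) \<partial>lborel)"
    proof (rule integral_mono[OF _ levy_cos_integrable])
      show "integrable lborel (\<lambda>r::real. indicator {1..2} r * (2 powr (- (1 + 2 * s)) * (2 - 2 * cos 1)))"
        by (intro integrable_mult_left integrable_real_indicator) auto
      fix r :: real
      show "indicator {1..2} r * (2 powr (- (1 + 2 * s)) * (2 - 2 * cos 1)) \<le> levy_weight (2 * s) 0 r * (2 - 2 * cos (1 * r))"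
      proof (cases "r \<in> {1..2}")
        case True
        then have "cos r \<le> cos 1" by (intro cos_monotone_0_pi_le) (use pi_gt3 in auto)
        moreover have "2 powr (- (1 + 2 * s)) \<le> r powr (- (1 + 2 * s))"
          using True s by (intro powr_mono2') auto
        ultimately show ?thesis using True c1 by (auto simp: levy_weight_def intro!: mult_mono)
      qed (use two_minus_two_cos(2)[of r] in simp)
    qed simp
    finally show ?thesis .
  qed
  then show ?thesis using C_frac_pos[of s] s by (simp add: diffusivity_def levy_symbol_def)
qed

lemma levy_symbol_measurable [measurable]: "levy_symbol s e \<in> borel_measurable borel"
  unfolding levy_symbol_def[abs_def] by measurable

lemma levy_symbol_bounded:
  assumes "0 < e"
  shows "\<bar>levy_symbol s e \<xi>\<bar> \<le> C_frac s * (4 * (e powr (- (2 * s)) / (2 * s)))"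
proof -
  have w: "has_bochner_integral lborel (levy_weight (2 * s) e) (e powr (- (2 * s)) / (2 * s))"
    using s assms by (intro levy_weight_tail) auto
  let ?I = "\<integral>r. levy_weight (2 * s) e r * (2 - 2 * cos (\<xi> * r)) \<partial>lborel"
  have "?I \<le> (\<integral>r. levy_weight (2 * s) e r * 4 \<partial>lborel)"
  proof (rule integral_mono[OF levy_cos_integrable])
    show "levy_weight (2 * s) e r * (2 - 2 * cos (\<xi> * r)) \<le> levy_weight (2 * s) e r * 4" for r
      using two_minus_two_cos(3)[of "\<xi> * r"] by (intro mult_left_mono) auto
  qed (use assms integrable.intros[OF w] in auto)
  then have "?I \<le> 4 * (e powr (- (2 * s)) / (2 * s))"
    using has_bochner_integral_integral_eq[OF w] by simp
  moreover have "0 \<le> ?I"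
    by (intro Bochner_Integration.integral_nonneg mult_nonneg_nonneg two_minus_two_cos(2)) simp
  moreover have "0 < C_frac s" using C_frac_pos[of s] s by simp
  ultimately show ?thesis
    by (simp only: levy_symbol_def abs_mult abs_of_nonneg abs_of_pos mult_le_cancel_left_pos)
qed

text \<open>The discarded range 0 < r <= e contributes at most the integral of r^(-1-2s) (xi r)^2,
  which is finite and vanishes with e because s < 1.\<close>

lemma levy_symbol_diff:
  assumes e: "0 < e"
  shows "\<bar>diffusivity s * \<bar>\<xi>\<bar> powr (2 * s) - levy_symbol s e \<xi>\<bar> \<le> C_frac s * (e powr (2 - 2 * s) / (2 - 2 * s)) * \<xi>\<^sup>2"
proof -
  have p: "has_bochner_integral lborel (\<lambda>r. indicator {0..e} r * r powr (1 - 2 * s)) (e powr (2 - 2 * s) / (2 - 2 * s))"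
    using powr_weight_near_0[of "1 - 2 * s" e] s e by simp
  let ?D = "\<lambda>r. levy_weight (2 * s) 0 r * (2 - 2 * cos (\<xi> * r)) - levy_weight (2 * s) e r * (2 - 2 * cos (\<xi> * r))"
  have Di: "integrable lborel ?D" by (intro Bochner_Integration.integrable_diff levy_cos_integrable) (use e in auto)
  have D0: "0 \<le> ?D r" for r
    using mult_right_mono[OF levy_weight_mono[of 0 e "2 * s" r] two_minus_two_cos(2)[of "\<xi> * r"]] e by simp
  have D1: "?D r \<le> (indicator {0..e} r * r powr (1 - 2 * s)) * \<xi>\<^sup>2" for r
  proof (cases "0 < r \<and> r \<le> e")
    case True
    have "?D r = r powr (- (1 + 2 * s)) * (2 - 2 * cos (\<xi> * r))" using True by (simp add: levy_weight_def)
    also have "\<dots> \<le> r powr (- (1 + 2 * s)) * (\<xi> * r)\<^sup>2" by (intro mult_left_mono two_minus_two_cos) simp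
    also have "\<dots> = (r powr (- (1 + 2 * s)) * r powr 2) * \<xi>\<^sup>2" using True by (simp add: power_mult_distrib)
    also have "r powr (- (1 + 2 * s)) * r powr 2 = r powr (1 - 2 * s)" by (simp add: powr_add[symmetric])
    finally show ?thesis using True by simp
  qed (use e in \<open>auto simp: levy_weight_def\<close>)
  have "integral\<^sup>L lborel ?D \<le> (\<integral>r. (indicator {0..e} r * r powr (1 - 2 * s)) * \<xi>\<^sup>2 \<partial>lborel)"
    by (rule integral_mono[OF Di _ D1]) (use integrable.intros[OF p] in simp)
  also have "\<dots> = e powr (2 - 2 * s) / (2 - 2 * s) * \<xi>\<^sup>2" using has_bochner_integral_integral_eq[OF p] by simp
  finally have up: "integral\<^sup>L lborel ?D \<le> e powr (2 - 2 * s) / (2 - 2 * s) * \<xi>\<^sup>2" .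
  have eq: "diffusivity s * \<bar>\<xi>\<bar> powr (2 * s) - levy_symbol s e \<xi> = C_frac s * integral\<^sup>L lborel ?D"
    unfolding levy_symbol_0[symmetric] levy_symbol_def
    using Bochner_Integration.integral_diff[OF levy_cos_integrable[of 0 \<xi>] levy_cos_integrable[of e \<xi>]] e
    by (simp only: order_refl less_imp_le right_diff_distrib[of "C_frac s"])
  have "0 \<le> integral\<^sup>L lborel ?D" using D0 by simp
  then show ?thesis
    unfolding eq using mult_left_mono[OF up, of "C_frac s"] C_frac_pos[of s] s
    by (simp only: abs_mult abs_of_nonneg abs_of_pos mult.assoc less_imp_le)
qed

section \<open>The Euler step on flows with a bounded initial transform\<close>

context
  fixes g :: "real \<Rightarrow> real" and M :: real
  assumes g_meas: "g \<in> borel_measurable borel" and g_le: "\<And>\<xi>. \<bar>g \<xi>\<bar> \<le> M"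
begin

lemma multiplier_bound_nonneg: "0 \<le> M" using g_le[of 0] by linarith

lemma stable_flow_integrable: "0 < T \<Longrightarrow> integrable lborel (\<lambda>\<xi>. g \<xi> * stable_symbol s T \<xi>)"
proof (rule integrable_le)
  show "0 < T \<Longrightarrow> integrable lborel (\<lambda>\<xi>. M * stable_symbol s T \<xi>)"
    using stable_symbol_integrable(2) s by simp
  show "\<bar>g \<xi> * stable_symbol s T \<xi>\<bar> \<le> M * stable_symbol s T \<xi>" for \<xi>
    by (simp add: abs_mult mult_right_mono g_le)
qed (use g_meas in measurable)

lemma stable_flow_bounded: "0 < T \<Longrightarrow> \<bar>stable_flow s g T x\<bar> \<le> M * (\<integral>\<xi>. stable_symbol s T \<xi> \<partial>lborel)"
  unfolding stable_flow_def integral_mult_right_zero[symmetric]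
  by (rule abs_cos_transform_le) (use stable_symbol_integrable(2) s in \<open>auto simp: abs_mult mult_right_mono g_le\<close>)

lemma stable_flow_continuous: "0 < T \<Longrightarrow> continuous_on A (stable_flow s g T)"
  unfolding stable_flow_def by (intro continuous_cos_transform stable_flow_integrable)

text \<open>The addition theorem turns second differences of cosines into multiplication by 2 cos(xi
  r) - 2. Since \<open>e > 0\<close>, the weight is integrable and the integrals may be
  exchanged.\<close>

lemma levy_operator_stable_flow:
  assumes e: "0 < e" and T: "0 < T"
  shows "levy_operator s e (stable_flow s g T) x = - cos_transform (\<lambda>\<xi>. levy_symbol s e \<xi> * (g \<xi> * stable_symbol s T \<xi>)) x"
proof -
  note [measurable] = g_meas
  define F where "F = (\<lambda>r \<xi>. levy_weight (2 * s) e r * ((2 * cos (\<xi> * r) - 2) * (cos (x * \<xi>) * (g \<xi> * stable_symbol s T \<xi>))))"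
  have m: "case_prod F \<in> borel_measurable (borel \<Otimes>\<^sub>M borel)" unfolding F_def by measurable
  have le: "\<bar>F r \<xi>\<bar> \<le> levy_weight (2 * s) e r * (4 * \<bar>g \<xi> * stable_symbol s T \<xi>\<bar>)" for r \<xi>
  proof -
    have "\<bar>2 * cos (\<xi> * r) - 2\<bar> * (\<bar>cos (x * \<xi>)\<bar> * \<bar>g \<xi> * stable_symbol s T \<xi>\<bar>) \<le> 4 * (1 * \<bar>g \<xi> * stable_symbol s T \<xi>\<bar>)"
      using two_minus_two_cos(3)[of "\<xi> * r"] by (intro mult_mono) (auto simp: abs_minus_commute)
    then show ?thesis unfolding F_def abs_mult[of "levy_weight _ _ _"] abs_mult[of "2 * cos (\<xi> * r) - 2"] abs_mult[of "cos (x * \<xi>)"]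
      by (simp add: mult_left_mono)
  qed
  have wi: "integrable lborel (levy_weight (2 * s) e)" using levy_weight_tail[of "2 * s" e] s e by (auto intro: integrable.intros)
  have gi: "integrable lborel (\<lambda>\<xi>. 4 * \<bar>g \<xi> * stable_symbol s T \<xi>\<bar>)"
    by (intro integrable_mult_right integrable_abs stable_flow_integrable T)
  have in1: "(\<integral>\<xi>. F r \<xi> \<partial>lborel) = levy_weight (2 * s) e r * (stable_flow s g T (x + r) + stable_flow s g T (x - r) - 2 * stable_flow s g T x)" for r
  proof -
    let ?c = "\<lambda>y \<xi>. cos (y * \<xi>) * (g \<xi> * stable_symbol s T \<xi>)"
    have "(2 * cos (\<xi> * r) - 2) * ?c x \<xi> = ?c (x + r) \<xi> + ?c (x - r) \<xi> - 2 * ?c x \<xi>" for \<xi>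
    proof -
      have "cos ((x + r) * \<xi>) + cos ((x - r) * \<xi>) = 2 * cos (\<xi> * r) * cos (x * \<xi>)"
        by (simp add: distrib_right left_diff_distrib cos_add cos_diff mult.commute[of r])
      then have "?c (x + r) \<xi> + ?c (x - r) \<xi> = 2 * cos (\<xi> * r) * cos (x * \<xi>) * (g \<xi> * stable_symbol s T \<xi>)"
        by (metis distrib_right)
      then show ?thesis by (simp add: algebra_simps)
    qed
    then have "(\<integral>\<xi>. F r \<xi> \<partial>lborel) = levy_weight (2 * s) e r * (\<integral>\<xi>. ?c (x + r) \<xi> + ?c (x - r) \<xi> - 2 * ?c x \<xi> \<partial>lborel)"
      unfolding F_def integral_mult_right_zero by simp
    also have "(\<integral>\<xi>. ?c (x + r) \<xi> + ?c (x - r) \<xi> - 2 * ?c x \<xi> \<partial>lborel) = stable_flow s g T (x + r) + stable_flow s g T (x - r) - 2 * stable_flow s g T x"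
      unfolding stable_flow_def cos_transform_def
      using integral_lincomb[of "?c (x + r)" "\<lambda>\<xi>. - ?c (x - r) \<xi>" "?c x" "-2"] stable_flow_integrable[OF T]
      by (simp add: integrable_cos_mult)
    finally show ?thesis .
  qed
  have in2: "C_frac s * (\<integral>r. F r \<xi> \<partial>lborel) = - (cos (x * \<xi>) * (levy_symbol s e \<xi> * (g \<xi> * stable_symbol s T \<xi>)))" for \<xi>
  proof -
    have "(\<integral>r. F r \<xi> \<partial>lborel) = (\<integral>r. levy_weight (2 * s) e r * (2 - 2 * cos (\<xi> * r)) * (- (cos (x * \<xi>) * (g \<xi> * stable_symbol s T \<xi>))) \<partial>lborel)"
      unfolding F_def by (rule Bochner_Integration.integral_cong) (simp_all add: algebra_simps)
    then show ?thesis unfolding levy_symbol_def integral_mult_left_zero by simp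
  qed
  have "levy_operator s e (stable_flow s g T) x = C_frac s * (\<integral>r. (\<integral>\<xi>. F r \<xi> \<partial>lborel) \<partial>lborel)"
    unfolding levy_operator_def in1 ..
  also have "\<dots> = (\<integral>\<xi>. C_frac s * (\<integral>r. F r \<xi> \<partial>lborel) \<partial>lborel)"
    using fubini_dominated(1)[OF m wi gi le] by simp
  finally show ?thesis unfolding in2 cos_transform_def by simp
qed

text \<open>On the frequency side the defect is multiplication by exp(-k h y) - 1 plus h times the
  truncated symbol, with y = |xi|^(2s). Time discretisation contributes (k h y)^2 and truncation a
  multiple of h e^(2-2s) xi^2. The bound is h times a small quantity, uniformly in \<open>x\<close>
  and in \<open>T \<ge> d\<close>, so it can be summed over about t/h steps.\<close>

lemma stable_flow_consistent:
  assumes d: "0 < d" "d \<le> T" and e: "0 < e" and h: "0 < h"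
  shows "\<bar>stable_flow s g (T + diffusivity s * h) x - stable_flow s g T x - h * levy_operator s e (stable_flow s g T) x\<bar>
    \<le> h * (M * symbol_mass s d * ((diffusivity s)\<^sup>2 * h + 2 * C_frac s * (e powr (2 - 2 * s) / (2 - 2 * s))))"
proof -
  note [measurable] = g_meas
  define k where "k = diffusivity s"
  have k: "0 < k" using diffusivity_pos by (simp add: k_def)
  define E where "E = C_frac s * (e powr (2 - 2 * s) / (2 - 2 * s))"
  have E: "0 \<le> E" using C_frac_pos[of s] s by (simp add: E_def)
  have T: "0 < T" "0 < T + k * h" using d h k by (auto intro: add_pos_pos)
  define G where "G = (\<lambda>\<xi>. g \<xi> * stable_symbol s T \<xi>)"
  let ?b = "\<lambda>\<xi>. exp (- (k * h * \<bar>\<xi>\<bar> powr (2 * s))) - 1 + h * levy_symbol s e \<xi>"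
  have sym: "g \<xi> * stable_symbol s (T + k * h) \<xi> = exp (- (k * h * \<bar>\<xi>\<bar> powr (2 * s))) * G \<xi>" for \<xi>
    by (simp add: G_def stable_symbol_def exp_add[symmetric] algebra_simps)
  have Gi: "integrable lborel G" unfolding G_def by (rule stable_flow_integrable[OF T(1)])
  have i1: "integrable lborel (\<lambda>\<xi>. exp (- (k * h * \<bar>\<xi>\<bar> powr (2 * s))) * G \<xi>)"
    unfolding sym[symmetric] by (rule stable_flow_integrable[OF T(2)])
  have i2: "integrable lborel (\<lambda>\<xi>. levy_symbol s e \<xi> * G \<xi>)"
  proof (rule integrable_le)
    show "integrable lborel (\<lambda>\<xi>. C_frac s * (4 * (e powr (- (2 * s)) / (2 * s))) * \<bar>G \<xi>\<bar>)"
      using Gi by (intro integrable_mult_right integrable_abs)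
    show "\<bar>levy_symbol s e \<xi> * G \<xi>\<bar> \<le> C_frac s * (4 * (e powr (- (2 * s)) / (2 * s))) * \<bar>G \<xi>\<bar>" for \<xi>
      unfolding abs_mult by (intro mult_right_mono levy_symbol_bounded e) simp
  qed (use Gi in measurable)
  have "stable_flow s g (T + k * h) x - stable_flow s g T x - h * levy_operator s e (stable_flow s g T) x
     = cos_transform (\<lambda>\<xi>. exp (- (k * h * \<bar>\<xi>\<bar> powr (2 * s))) * G \<xi>) x - cos_transform G x + h * cos_transform (\<lambda>\<xi>. levy_symbol s e \<xi> * G \<xi>) x"
    unfolding levy_operator_stable_flow[OF e T(1)] by (simp add: stable_flow_def sym G_def)
  also have "\<dots> = cos_transform (\<lambda>\<xi>. ?b \<xi> * G \<xi>) x"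
  proof -
    have "cos_transform (\<lambda>\<xi>. ?b \<xi> * G \<xi>) x = (\<integral>\<xi>. cos (x * \<xi>) * (exp (- (k * h * \<bar>\<xi>\<bar> powr (2 * s))) * G \<xi>)
        - cos (x * \<xi>) * G \<xi> + h * (cos (x * \<xi>) * (levy_symbol s e \<xi> * G \<xi>)) \<partial>lborel)"
      unfolding cos_transform_def by (rule Bochner_Integration.integral_cong) (simp_all add: algebra_simps)
    also have "\<dots> = cos_transform (\<lambda>\<xi>. exp (- (k * h * \<bar>\<xi>\<bar> powr (2 * s))) * G \<xi>) x - cos_transform G x + h * cos_transform (\<lambda>\<xi>. levy_symbol s e \<xi> * G \<xi>) x"
      unfolding cos_transform_def
      by (rule integral_lincomb; intro integrable_cos_mult Gi i1 i2)
    finally show ?thesis ..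
  qed
  finally have eq: "stable_flow s g (T + k * h) x - stable_flow s g T x - h * levy_operator s e (stable_flow s g T) x = cos_transform (\<lambda>\<xi>. ?b \<xi> * G \<xi>) x" .
  have "\<bar>cos_transform (\<lambda>\<xi>. ?b \<xi> * G \<xi>) x\<bar> \<le> (\<integral>\<xi>. h * M * (k\<^sup>2 * h + 2 * E) * ((1 + \<xi>^4) * stable_symbol s d \<xi>) \<partial>lborel)"
  proof (rule abs_cos_transform_le)
    show "integrable lborel (\<lambda>\<xi>. h * M * (k\<^sup>2 * h + 2 * E) * ((1 + \<xi>^4) * stable_symbol s d \<xi>))"
      using stable_symbol_integrable(1)[OF s(1) d(1)] by simp
    fix \<xi> :: real
    define y where "y = \<bar>\<xi>\<bar> powr (2 * s)"
    have y: "0 \<le> y" by (simp add: y_def)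
    have y2: "y\<^sup>2 \<le> 1 + \<xi>^4"
    proof -
      have "y\<^sup>2 = \<bar>\<xi>\<^sup>2\<bar> powr (2 * s)" by (simp add: y_def power2_eq_square powr_mult[symmetric] abs_mult[symmetric])
      also have "\<dots> \<le> 1 + (\<xi>\<^sup>2)\<^sup>2" using s by (intro powr_abs_le) auto
      finally show ?thesis by simp
    qed
    have x2: "\<xi>\<^sup>2 \<le> 2 * (1 + \<xi>^4)"
    proof -
      have "0 \<le> (\<xi>\<^sup>2 - 1)\<^sup>2" by simp
      then have "2 * \<xi>\<^sup>2 \<le> 1 + \<xi>^4" by (simp add: power2_diff)
      moreover have "0 \<le> \<xi>\<^sup>2" "0 \<le> \<xi>^4" by simp_all
      ultimately show ?thesis by (simp only: distrib_left)
    qed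
    \<comment> \<open>k h y is added and subtracted: a Taylor remainder in time, and h times the
      difference of the full and the truncated symbol.\<close>
    have "\<bar>?b \<xi>\<bar> = \<bar>(exp (- (k * h * y)) - 1 + k * h * y) - h * (k * y - levy_symbol s e \<xi>)\<bar>"
      by (simp add: y_def algebra_simps)
    also have "\<dots> \<le> \<bar>exp (- (k * h * y)) - 1 + k * h * y\<bar> + \<bar>h * (k * y - levy_symbol s e \<xi>)\<bar>"
      by (rule abs_triangle_ineq4)
    also have "\<dots> \<le> (k * h * y)\<^sup>2 + h * (E * \<xi>\<^sup>2)"
    proof (intro add_mono exp_minus_quadratic)
      have "\<bar>h * (k * y - levy_symbol s e \<xi>)\<bar> = h * \<bar>k * y - levy_symbol s e \<xi>\<bar>"
        using h by (simp add: abs_mult)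
      also have "\<dots> \<le> h * (E * \<xi>\<^sup>2)"
        unfolding E_def k_def y_def by (rule mult_left_mono[OF levy_symbol_diff[OF e]]) (use h in simp)
      finally show "\<bar>h * (k * y - levy_symbol s e \<xi>)\<bar> \<le> h * (E * \<xi>\<^sup>2)" .
    qed (use h k y in simp)
    also have "\<dots> = h * (k\<^sup>2 * h * y\<^sup>2 + E * \<xi>\<^sup>2)" by (simp add: power2_eq_square algebra_simps)
    also have "\<dots> \<le> h * (k\<^sup>2 * h * (1 + \<xi>^4) + E * (2 * (1 + \<xi>^4)))"
      using y2 x2 h E by (intro mult_left_mono add_mono) auto
    also have "\<dots> = h * (k\<^sup>2 * h + 2 * E) * (1 + \<xi>^4)" by (simp add: algebra_simps)
    finally have b: "\<bar>?b \<xi>\<bar> \<le> h * (k\<^sup>2 * h + 2 * E) * (1 + \<xi>^4)" .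
    have "\<bar>G \<xi>\<bar> \<le> M * stable_symbol s d \<xi>"
      unfolding G_def abs_mult using multiplier_bound_nonneg stable_symbol_antimono[OF d(2)]
      by (intro mult_mono g_le) auto
    then have "\<bar>?b \<xi> * G \<xi>\<bar> \<le> (h * (k\<^sup>2 * h + 2 * E) * (1 + \<xi>^4)) * (M * stable_symbol s d \<xi>)"
      unfolding abs_mult using b h E multiplier_bound_nonneg by (intro mult_mono) auto
    then show "\<bar>?b \<xi> * G \<xi>\<bar> \<le> h * M * (k\<^sup>2 * h + 2 * E) * ((1 + \<xi>^4) * stable_symbol s d \<xi>)"
      by (simp add: ac_simps)
  qed
  also have "\<dots> = h * (M * symbol_mass s d * (k\<^sup>2 * h + 2 * E))"
    unfolding integral_mult_right_zero symbol_mass_def[symmetric] by (simp only: ac_simps)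
  finally have "\<bar>stable_flow s g (T + k * h) x - stable_flow s g T x - h * levy_operator s e (stable_flow s g T) x\<bar>
      \<le> h * (M * symbol_mass s d * (k\<^sup>2 * h + 2 * E))"
    unfolding eq .
  then show ?thesis by (simp only: k_def E_def mult.assoc)
qed

text \<open>A time derivative brings down |xi|^(2s) <= 3 (1 + xi^4). The estimate serves to pass
  from the neighbouring grid times to the given time.\<close>

lemma stable_flow_time_lipschitz:
  assumes d: "0 < d" "d \<le> T" "T \<le> T'"
  shows "\<bar>stable_flow s g T x - stable_flow s g T' x\<bar> \<le> (T' - T) * (3 * M * symbol_mass s d)"
proof -
  note [measurable] = g_meas
  have "stable_flow s g T x - stable_flow s g T' x = cos_transform (\<lambda>\<xi>. g \<xi> * stable_symbol s T \<xi> - g \<xi> * stable_symbol s T' \<xi>) x"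
    unfolding stable_flow_def cos_transform_def right_diff_distrib
    by (rule Bochner_Integration.integral_diff[symmetric]) (use d in \<open>auto intro!: integrable_cos_mult stable_flow_integrable\<close>)
  also have "\<bar>\<dots>\<bar> \<le> (\<integral>\<xi>. ((T' - T) * (3 * M)) * ((1 + \<xi>^4) * stable_symbol s d \<xi>) \<partial>lborel)"
  proof (rule abs_cos_transform_le)
    show "integrable lborel (\<lambda>\<xi>. ((T' - T) * (3 * M)) * ((1 + \<xi>^4) * stable_symbol s d \<xi>))"
      using stable_symbol_integrable(1)[OF s(1) d(1)] by simp
    fix \<xi> :: real
    define y where "y = \<bar>\<xi>\<bar> powr (2 * s)"
    have "y \<le> 1 + \<xi>\<^sup>2" unfolding y_def using s by (intro powr_abs_le) auto
    moreover have "0 \<le> (\<xi>\<^sup>2 - 1)\<^sup>2" by simp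
    then have "2 * \<xi>\<^sup>2 \<le> 1 + \<xi>^4" by (simp add: power2_diff)
    then have "\<xi>\<^sup>2 \<le> 1 + \<xi>^4" using zero_le_power2[of \<xi>] by linarith
    moreover have "0 \<le> \<xi>^4" by simp
    ultimately have "y \<le> 3 * (1 + \<xi>^4)" by (simp only: distrib_left)
    moreover have "0 \<le> y" by (simp add: y_def)
    ultimately have y: "y \<le> 3 * (1 + \<xi>^4)" "0 \<le> y" by blast+
    have "stable_symbol s T' \<xi> = stable_symbol s T \<xi> * exp (- ((T' - T) * y))"
      by (simp add: stable_symbol_def y_def exp_add[symmetric] algebra_simps)
    then have "stable_symbol s T \<xi> - stable_symbol s T' \<xi> = stable_symbol s T \<xi> * (1 - exp (- ((T' - T) * y)))"
      by (simp add: algebra_simps)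
    also have "\<dots> \<le> stable_symbol s d \<xi> * ((T' - T) * (3 * (1 + \<xi>^4)))"
    proof (intro mult_mono stable_symbol_antimono d)
      have "1 - exp (- ((T' - T) * y)) \<le> (T' - T) * y" by (rule one_minus_exp_bounds)
      also have "\<dots> \<le> (T' - T) * (3 * (1 + \<xi>^4))" using d y by (intro mult_left_mono) auto
      finally show "1 - exp (- ((T' - T) * y)) \<le> (T' - T) * (3 * (1 + \<xi>^4))" .
    qed (use d y in auto)
    finally have "stable_symbol s T \<xi> - stable_symbol s T' \<xi> \<le> stable_symbol s d \<xi> * ((T' - T) * (3 * (1 + \<xi>^4)))" .
    then have "\<bar>g \<xi>\<bar> * \<bar>stable_symbol s T \<xi> - stable_symbol s T' \<xi>\<bar> \<le> M * (stable_symbol s d \<xi> * ((T' - T) * (3 * (1 + \<xi>^4))))"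
      using stable_symbol_antimono[OF d(3), of s \<xi>] by (intro mult_mono g_le) (auto simp: multiplier_bound_nonneg)
    then show "\<bar>g \<xi> * stable_symbol s T \<xi> - g \<xi> * stable_symbol s T' \<xi>\<bar> \<le> (T' - T) * (3 * M) * ((1 + \<xi>^4) * stable_symbol s d \<xi>)"
      unfolding right_diff_distrib[symmetric] abs_mult by (simp only: ac_simps)
  qed
  finally show ?thesis by (simp add: symbol_mass_def)
qed

end

end

section \<open>The monotone scheme\<close>

lemma cINF_const_add:
  fixes f :: "'a \<Rightarrow> real"
  assumes "A \<noteq> {}" "bdd_below (f ` A)"
  shows "(INF z\<in>A. c + f z) = c + (INF z\<in>A. f z)"
proof (rule antisym)
  obtain m where "\<And>z. z \<in> A \<Longrightarrow> m \<le> f z" using assms(2) by (auto simp: bdd_below_def)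
  then have b: "bdd_below ((\<lambda>z. c + f z) ` A)"
    unfolding bdd_below_def by (auto intro!: exI[of _ "c + m"])
  have "(INF z\<in>A. c + f z) - c \<le> (INF z\<in>A. f z)"
  proof (rule cINF_greatest[OF assms(1)])
    fix z assume "z \<in> A"
    from cINF_lower[OF b this] show "(INF z\<in>A. c + f z) - c \<le> f z" by simp
  qed
  then show "(INF z\<in>A. c + f z) \<le> c + (INF z\<in>A. f z)" by simp
  show "c + (INF z\<in>A. f z) \<le> (INF z\<in>A. c + f z)"
    by (rule cINF_greatest[OF assms(1)]) (use cINF_lower[OF assms(2)] in auto)
qed

lemma cSUP_add_const:
  fixes f :: "'a \<Rightarrow> real"
  assumes "A \<noteq> {}" "bdd_above (f ` A)"
  shows "(SUP z\<in>A. f z + c) = (SUP z\<in>A. f z) + c"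
proof (rule antisym)
  obtain m where "\<And>z. z \<in> A \<Longrightarrow> f z \<le> m" using assms(2) by (auto simp: bdd_above_def)
  then have b: "bdd_above ((\<lambda>z. f z + c) ` A)"
    unfolding bdd_above_def by (auto intro!: exI[of _ "m + c"])
  have "(SUP z\<in>A. f z) \<le> (SUP z\<in>A. f z + c) - c"
  proof (rule cSUP_least[OF assms(1)])
    fix z assume "z \<in> A"
    from cSUP_upper[OF this b] show "f z \<le> (SUP z\<in>A. f z + c) - c" by simp
  qed
  then show "(SUP z\<in>A. f z) + c \<le> (SUP z\<in>A. f z + c)" by simp
  show "(SUP z\<in>A. f z + c) \<le> (SUP z\<in>A. f z) + c"
    by (rule cSUP_least[OF assms(1)]) (use cSUP_upper[OF _ assms(2)] in auto)
qed

text \<open>One half of the operator; it depends on a single direction, which separates the supremum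
  from the infimum.\<close>

definition ray_integral :: "real \<Rightarrow> real \<Rightarrow> (real^'n \<Rightarrow> real) \<Rightarrow> real^'n \<Rightarrow> real^'n \<Rightarrow> real" where
  "ray_integral s e f x y = (\<integral>r. levy_weight (2 * s) e r * f (x + r *\<^sub>R y) \<partial>lborel)"

definition bounded_continuous :: "(real^'n \<Rightarrow> real) \<Rightarrow> bool" where
  "bounded_continuous f \<longleftrightarrow> continuous_on UNIV f \<and> (\<exists>B. \<forall>x. \<bar>f x\<bar> \<le> B)"

lemma bounded_continuous_0: "bounded_continuous (\<lambda>x. 0)"
  by (auto simp: bounded_continuous_def)

lemma L_eps_translate: "L_eps s e (\<lambda>x. f (x + a)) x = L_eps s e f (x + a)"
  by (simp add: L_eps_def algebra_simps)

lemma bounded_continuous_BUC: "BUC UNIV f \<Longrightarrow> bounded_continuous f"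
  by (auto simp: BUC_def bounded_continuous_def bounded_iff uniformly_continuous_imp_continuous)

lemma sphere_nonempty: "sphere (0 :: real^'n) 1 \<noteq> {}"
  by (metis empty_iff mem_sphere_0 norm_axis_1)

context
  fixes s e :: real
  assumes s: "1/2 < s" "s < 1" and e: "0 < e"
begin

abbreviation (input) levy_tail where "levy_tail \<equiv> e powr (- (2 * s)) / (2 * s)"

lemma levy_tail_integral: "integral\<^sup>L lborel (levy_weight (2 * s) e) = levy_tail" "integrable lborel (levy_weight (2 * s) e)"
  using levy_weight_tail[of "2 * s" e] s e by (auto simp: has_bochner_integral_iff)

lemma ray_integrable:
  assumes "bounded_continuous f"
  shows "integrable lborel (\<lambda>r. levy_weight (2 * s) e r * f (x + r *\<^sub>R y))"
proof -
  obtain B where B: "\<And>x. \<bar>f x\<bar> \<le> B" using assms by (auto simp: bounded_continuous_def)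
  have "continuous_on UNIV f" using assms by (simp add: bounded_continuous_def)
  then have "continuous_on UNIV (\<lambda>r. f (x + r *\<^sub>R y))"
    by (rule continuous_on_compose2) (auto intro!: continuous_intros)
  then show ?thesis
    using s e B by (intro levy_weight_integrable_bounded borel_measurable_continuous_onI) auto
qed

lemma ray_integral_mono:
  assumes f: "bounded_continuous f" and g: "bounded_continuous g" and le: "\<And>x. f x \<le> g x + c"
  shows "ray_integral s e f x y \<le> ray_integral s e g x y + c * levy_tail"
proof -
  have "ray_integral s e f x y \<le> (\<integral>r. levy_weight (2 * s) e r * g (x + r *\<^sub>R y) + c * levy_weight (2 * s) e r \<partial>lborel)"
    unfolding ray_integral_def
  proof (rule integral_mono[OF ray_integrable[OF f]])
    show "integrable lborel (\<lambda>r. levy_weight (2 * s) e r * g (x + r *\<^sub>R y) + c * levy_weight (2 * s) e r)"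
      using ray_integrable[OF g] levy_tail_integral by simp
    show "levy_weight (2 * s) e r * f (x + r *\<^sub>R y) \<le> levy_weight (2 * s) e r * g (x + r *\<^sub>R y) + c * levy_weight (2 * s) e r" for r
      using mult_left_mono[OF le levy_weight_nonneg, of "2 * s" e r "x + r *\<^sub>R y"] by (simp add: algebra_simps)
  qed
  also have "\<dots> = ray_integral s e g x y + c * levy_tail"
    unfolding ray_integral_def levy_tail_integral(1)[symmetric]
    using ray_integrable[OF g] levy_tail_integral(2) by simp
  finally show ?thesis .
qed

lemma ray_integral_bdd:
  assumes f: "bounded_continuous f"
  shows "bdd_above (ray_integral s e f x ` A)" "bdd_below (ray_integral s e f x ` A)"
proof -
  obtain B where B: "\<And>x. \<bar>f x\<bar> \<le> B" using f by (auto simp: bounded_continuous_def)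
  have B': "f x \<le> 0 + B" "0 \<le> f x + B" for x using B[of x] by auto
  have 0: "ray_integral s e (\<lambda>x. 0) x y = 0" for y by (simp add: ray_integral_def)
  show "bdd_above (ray_integral s e f x ` A)"
    using ray_integral_mono[OF f bounded_continuous_0 B'(1), of x] unfolding bdd_above_def 0 by auto
  show "bdd_below (ray_integral s e f x ` A)"
    unfolding bdd_below_def
  proof (intro exI ballI)
    fix z assume "z \<in> ray_integral s e f x ` A"
    then obtain y where "z = ray_integral s e f x y" by auto
    then show "- (B * levy_tail) \<le> z"
      using ray_integral_mono[OF bounded_continuous_0 f B'(2), of x y] unfolding 0 by linarith
  qed
qed

text \<open>For \<open>e > 0\<close> the three terms of the integrand converge separately, so the
  integral is a function of the first direction plus a function of the second. Hence sup inf splits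
  into a supremum plus an infimum, and the reflection z to -z maps the sphere to itself.\<close>

lemma L_eps_eq:
  fixes f :: "real^'n \<Rightarrow> real"
  assumes f: "bounded_continuous f"
  shows "L_eps s e f x = C_frac s * ((SUP y\<in>sphere 0 1. ray_integral s e f x y)
      + (INF y\<in>sphere 0 1. ray_integral s e f x y) - 2 * levy_tail * f x)"
proof -
  let ?R = "ray_integral s e f x"
  have 1: "(LINT r:{e<..}|lborel. (f (x + r *\<^sub>R y) + f (x - r *\<^sub>R z) - 2 * f x) / r powr (1 + 2 * s))
      = (?R y - 2 * levy_tail * f x) + ?R (- z)" for y z
  proof -
    have "(LINT r:{e<..}|lborel. (f (x + r *\<^sub>R y) + f (x - r *\<^sub>R z) - 2 * f x) / r powr (1 + 2 * s))
        = (\<integral>r. levy_weight (2 * s) e r * f (x + r *\<^sub>R y) - (- (levy_weight (2 * s) e r * f (x + r *\<^sub>R (- z))))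
            + (- 2 * f x) * levy_weight (2 * s) e r \<partial>lborel)"
      unfolding set_lebesgue_integral_def
    proof (rule Bochner_Integration.integral_cong[OF refl])
      fix r
      have "levy_weight (2 * s) e r = indicator {e<..} r / r powr (1 + 2 * s)"
        by (simp only: levy_weight_def powr_minus divide_inverse)
      then show "indicator {e<..} r *\<^sub>R ((f (x + r *\<^sub>R y) + f (x - r *\<^sub>R z) - 2 * f x) / r powr (1 + 2 * s))
        = levy_weight (2 * s) e r * f (x + r *\<^sub>R y) - (- (levy_weight (2 * s) e r * f (x + r *\<^sub>R (- z))))
            + (- 2 * f x) * levy_weight (2 * s) e r"
        by (cases "e < r") (simp_all add: add_divide_distrib diff_divide_distrib)
    qed
    also have "\<dots> = ?R y - (- ?R (- z)) + (- 2 * f x) * levy_tail"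
      unfolding ray_integral_def levy_tail_integral(1)[symmetric]
      by (subst integral_lincomb[OF ray_integrable[OF f] integrable_minus[OF ray_integrable[OF f]] levy_tail_integral(2)]) simp
    finally show ?thesis by simp
  qed
  have img: "(\<lambda>z. ?R (- z)) ` sphere 0 1 = ?R ` sphere 0 1"
  proof -
    have "uminus ` sphere (0 :: real^'n) 1 = sphere 0 1"
      by (auto simp: image_iff intro!: bexI[of _ "- _"])
    then show ?thesis by (metis image_image)
  qed
  have 2: "(INF z\<in>sphere 0 1. (?R y - 2 * levy_tail * f x) + ?R (- z)) = ?R y + ((INF z\<in>sphere 0 1. ?R z) - 2 * levy_tail * f x)" for y
    by (subst cINF_const_add[OF sphere_nonempty]) (use ray_integral_bdd[OF f] in \<open>simp_all add: img\<close>)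
  show ?thesis
    unfolding L_eps_def 1 2
    by (subst cSUP_add_const[OF sphere_nonempty]) (use ray_integral_bdd[OF f] in \<open>simp_all add: algebra_simps\<close>)
qed

text \<open>The CFL bound says that the coefficient
  \<open>1 - h * C_frac s * (2 * levy_tail)\<close> of the value at \<open>x\<close> is nonnegative,
  so the step is monotone in all values of \<open>f\<close>. Constants pass through: supremum and
  infimum each gain \<open>c\<close> times the tail mass, and the diagonal term loses the same
  amount.\<close>

lemma euler_step_mono:
  fixes f g :: "real^'n \<Rightarrow> real"
  assumes f: "bounded_continuous f" and g: "bounded_continuous g" and le: "\<And>x. f x \<le> g x + c"
    and h: "0 < h" "h \<le> s / C_frac s * e powr (2 * s)"
  shows "f x + h * L_eps s e f x \<le> g x + h * L_eps s e g x + c"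
proof -
  have C: "0 < C_frac s" using C_frac_pos[of s] s by simp
  have "h * C_frac s * (2 * levy_tail) \<le> (s / C_frac s * e powr (2 * s)) * C_frac s * (2 * levy_tail)"
    using h C s by (intro mult_right_mono) auto
  also have "\<dots> = 1" using C s e by (simp add: powr_minus field_simps)
  finally have cfl: "h * C_frac s * (2 * levy_tail) \<le> 1" .
  let ?S = "\<lambda>f. SUP y\<in>sphere 0 1. ray_integral s e f x y" and ?I = "\<lambda>f. INF y\<in>sphere 0 1. ray_integral s e f x y"
  note mono = ray_integral_mono[OF f g le, of x]
  have S: "?S f \<le> ?S g + c * levy_tail"
  proof (rule cSUP_least[OF sphere_nonempty])
    fix y :: "real^'n" assume y: "y \<in> sphere 0 1"
    show "ray_integral s e f x y \<le> ?S g + c * levy_tail"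
      using mono[of y] cSUP_upper[OF y ray_integral_bdd(1)[OF g], of x] by linarith
  qed
  have "?I f - c * levy_tail \<le> ?I g"
  proof (rule cINF_greatest[OF sphere_nonempty])
    fix y :: "real^'n" assume y: "y \<in> sphere 0 1"
    show "?I f - c * levy_tail \<le> ray_integral s e g x y"
      using mono[of y] cINF_lower[OF ray_integral_bdd(2)[OF f] y, of x] by linarith
  qed
  then have "?S f + ?I f \<le> ?S g + ?I g + (c * levy_tail + c * levy_tail)" using S by linarith
  also have "c * levy_tail + c * levy_tail = 2 * levy_tail * c" by (simp add: algebra_simps)
  finally have "h * C_frac s * (?S f + ?I f) \<le> h * C_frac s * (?S g + ?I g + 2 * levy_tail * c)"
    using h C by (intro mult_left_mono) auto
  moreover have "(1 - h * C_frac s * (2 * levy_tail)) * f x \<le> (1 - h * C_frac s * (2 * levy_tail)) * (g x + c)"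
    using cfl le by (intro mult_left_mono) auto
  moreover define T where "T = levy_tail"
  ultimately show ?thesis
    unfolding L_eps_eq[OF f] L_eps_eq[OF g] T_def[symmetric] by (simp add: algebra_simps)
qed

text \<open>Both properties follow from monotonicity: comparison with the zero function preserves
  the bound, and comparison with translates, which commute with the step, preserves the modulus of
  continuity.\<close>

lemma BUC_euler_step:
  fixes f :: "real^'n \<Rightarrow> real"
  assumes f: "BUC UNIV f" and h: "0 < h" "h \<le> s / C_frac s * e powr (2 * s)"
  shows "BUC UNIV (\<lambda>x. f x + h * L_eps s e f x)"
proof -
  let ?G = "\<lambda>x. f x + h * L_eps s e f x"
  note bf = bounded_continuous_BUC[OF f]
  obtain B where B: "\<And>x. \<bar>f x\<bar> \<le> B" using bf by (auto simp: bounded_continuous_def)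
  have B': "f x \<le> 0 + B" "0 \<le> f x + B" for x using B[of x] by auto
  have 0: "L_eps s e (\<lambda>x. 0) x = 0" for x :: "real^'n"
    using sphere_nonempty by (simp add: L_eps_def)
  have "\<bar>?G x\<bar> \<le> B" for x
    using euler_step_mono[OF bf bounded_continuous_0 B'(1) h, of x]
      euler_step_mono[OF bounded_continuous_0 bf B'(2) h, of x] by (simp add: 0)
  then have "bounded (range ?G)" by (auto simp: bounded_iff)
  moreover have "uniformly_continuous_on UNIV ?G"
    unfolding uniformly_continuous_on_def
  proof (intro allI impI)
    fix \<epsilon> :: real assume "0 < \<epsilon>"
    then have "0 < \<epsilon> / 2" by simp
    then obtain d where d: "d > 0" "\<And>x y. dist y x < d \<Longrightarrow> dist (f y) (f x) < \<epsilon> / 2"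
      using f unfolding BUC_def uniformly_continuous_on_def by (metis UNIV_I)
    have "dist (?G y) (?G x) < \<epsilon>" if "dist y x < d" for x y
    proof -
      define a where "a = y - x"
      have "\<bar>f (z + a) - f z\<bar> < \<epsilon> / 2" for z
        using d(2)[of "z + a" z] that by (simp add: a_def dist_norm)
      then have le: "f (z + a) \<le> f z + \<epsilon> / 2" "f z \<le> f (z + a) + \<epsilon> / 2" for z
        by (smt (verit))+
      have ba: "bounded_continuous (\<lambda>z. f (z + a))"
        using bf unfolding bounded_continuous_def
        by (auto intro!: continuous_on_compose2[of UNIV f] continuous_intros)
      have "?G (x + a) \<le> ?G x + \<epsilon> / 2" "?G x \<le> ?G (x + a) + \<epsilon> / 2"
        using euler_step_mono[OF ba bf le(1) h, of x] euler_step_mono[OF bf ba le(2) h, of x]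
        unfolding L_eps_translate by simp_all
      then show ?thesis using \<open>0 < \<epsilon>\<close> by (simp add: a_def dist_real_def abs_less_iff)
    qed
    then show "\<exists>d>0. \<forall>x\<in>UNIV. \<forall>y\<in>UNIV. dist y x < d \<longrightarrow> dist (?G y) (?G x) < \<epsilon>" using d(1) by blast
  qed
  ultimately show ?thesis by (simp add: BUC_def)
qed

lemma BUC_scheme:
  assumes "BUC UNIV u0" "0 < h" "h \<le> s / C_frac s * e powr (2 * s)"
  shows "BUC UNIV (scheme s e h u0 j)"
  using assms by (induction j) (auto intro: BUC_euler_step)

text \<open>Monotonicity and commutation with constants carry the initial gap \<open>c\<close> along
  unchanged, and every step adds its defect \<open>h * E\<close> once.\<close>

lemma scheme_compare:
  fixes V :: "nat \<Rightarrow> real^'n \<Rightarrow> real"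
  assumes u0: "BUC UNIV u0" and h: "0 < h" "h \<le> s / C_frac s * e powr (2 * s)"
    and V: "\<And>j. bounded_continuous (V j)"
    and cons: "\<And>j x. \<bar>V (Suc j) x - V j x - h * L_eps s e (V j) x\<bar> \<le> h * E"
  shows "(\<And>x. V 0 x \<le> u0 x + c) \<Longrightarrow> V j x \<le> scheme s e h u0 j x + c + real j * (h * E)"
    and "(\<And>x. u0 x \<le> V 0 x + c) \<Longrightarrow> scheme s e h u0 j x \<le> V j x + c + real j * (h * E)"
proof -
  note U = bounded_continuous_BUC[OF BUC_scheme[OF u0 h]]
  show "V j x \<le> scheme s e h u0 j x + c + real j * (h * E)" if "\<And>x. V 0 x \<le> u0 x + c"
  proof (induction j arbitrary: x)
    case (Suc j)
    have "V j x \<le> scheme s e h u0 j x + (c + real j * (h * E))" for x using Suc[of x] by simp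
    from euler_step_mono[OF V U this h, of x] cons[of j x] show ?case
      by (simp add: algebra_simps abs_le_iff)
  qed (use that in simp)
  show "scheme s e h u0 j x \<le> V j x + c + real j * (h * E)" if "\<And>x. u0 x \<le> V 0 x + c"
  proof (induction j arbitrary: x)
    case (Suc j)
    have "scheme s e h u0 j x \<le> V j x + (c + real j * (h * E))" for x using Suc[of x] by simp
    from euler_step_mono[OF U V this h, of x] cons[of j x] show ?case
      by (simp add: algebra_simps abs_le_iff)
  qed (use that in simp)
qed

text \<open>For unit y the distance of x + q y to the centre lies between |r - q| and r + q, and
  both ends are attained along the radial line. One direction is thus optimal for every q at once,
  and the order survives integration. Evenness of \<open>v\<close> turns |r - q| into r - q when the
  ray passes the centre, which gives the one-dimensional operator.\<close>

lemma L_eps_radial: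
  fixes x0 :: "real^'n"
  assumes v: "continuous_on UNIV v" "\<And>r. v (- r) = v r" "\<And>r. \<bar>v r\<bar> \<le> B"
    and noninc: "\<And>a b. 0 \<le> a \<Longrightarrow> a \<le> b \<Longrightarrow> v b \<le> v a"
  shows "bounded_continuous (\<lambda>x. v (norm (x - x0)))"
    and "L_eps s e (\<lambda>x. v (norm (x - x0))) x = levy_operator s e v (norm (x - x0))"
proof -
  let ?f = "\<lambda>x. v (norm (x - x0))"
  show f: "bounded_continuous ?f"
    using v(3) unfolding bounded_continuous_def
    by (auto intro!: continuous_on_compose2[OF v(1)] continuous_intros)
  define r where "r = norm (x - x0)"
  \<comment> \<open>The radial direction; at the centre itself any unit vector serves.\<close>
  obtain y0 :: "real^'n" where y0: "norm y0 = 1" "x - x0 = r *\<^sub>R y0"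
  proof (cases "x = x0")
    case True
    obtain y :: "real^'n" where "norm y = 1" using vector_choose_size[of 1] by auto
    then show ?thesis using that[of y] True by (simp add: r_def)
  next
    case False
    then show ?thesis using that[of "(1 / r) *\<^sub>R (x - x0)"] by (simp add: r_def)
  qed
  have pos: "x + q *\<^sub>R y0 - x0 = (r + q) *\<^sub>R y0" for q using y0(2) by (simp add: algebra_simps)
  have neg: "x + q *\<^sub>R (- y0) - x0 = (r - q) *\<^sub>R y0" for q using y0(2) by (simp add: algebra_simps)
  have vabs: "v \<bar>q\<bar> = v q" for q using v(2)[of q] by (simp add: abs_if)
  have R0: "ray_integral s e ?f x y0 = (\<integral>q. levy_weight (2 * s) e q * v (r + q) \<partial>lborel)"
    "ray_integral s e ?f x (- y0) = (\<integral>q. levy_weight (2 * s) e q * v (r - q) \<partial>lborel)"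
    unfolding ray_integral_def pos neg by (simp_all add: y0 vabs)
  have bounds: "ray_integral s e ?f x y \<le> ray_integral s e ?f x (- y0)"
     "ray_integral s e ?f x y0 \<le> ray_integral s e ?f x y" if y: "norm y = 1" for y
  proof -
    have "levy_weight (2 * s) e q * ?f (x + q *\<^sub>R y) \<le> levy_weight (2 * s) e q * ?f (x + q *\<^sub>R (- y0))" for q
    proof (cases "q \<le> e")
      case False
      then have q: "0 < q" using e by simp
      have "\<bar>r - q\<bar> \<le> norm (x + q *\<^sub>R y - x0)"
        using norm_triangle_ineq3[of "x - x0" "- (q *\<^sub>R y)"] y q by (simp add: r_def algebra_simps)
      then have "v (norm (x + q *\<^sub>R y - x0)) \<le> v \<bar>r - q\<bar>" by (intro noninc) auto
      then show ?thesis unfolding neg by (intro mult_left_mono) (simp_all add: y0)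
    qed (simp add: levy_weight_eq_0)
    then show "ray_integral s e ?f x y \<le> ray_integral s e ?f x (- y0)"
      unfolding ray_integral_def by (intro integral_mono ray_integrable[OF f])
    have "levy_weight (2 * s) e q * ?f (x + q *\<^sub>R y0) \<le> levy_weight (2 * s) e q * ?f (x + q *\<^sub>R y)" for q
    proof (cases "q \<le> e")
      case False
      then have q: "0 < q" using e by simp
      have "norm (x + q *\<^sub>R y - x0) \<le> \<bar>r + q\<bar>"
        using norm_triangle_ineq[of "x - x0" "q *\<^sub>R y"] y q by (simp add: r_def algebra_simps)
      then have "v \<bar>r + q\<bar> \<le> v (norm (x + q *\<^sub>R y - x0))" by (intro noninc) auto
      then show ?thesis unfolding pos by (intro mult_left_mono) (simp_all add: y0)
    qed (simp add: levy_weight_eq_0)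
    then show "ray_integral s e ?f x y0 \<le> ray_integral s e ?f x y"
      unfolding ray_integral_def by (intro integral_mono ray_integrable[OF f])
  qed
  have S: "(SUP y\<in>sphere 0 1. ray_integral s e ?f x y) = ray_integral s e ?f x (- y0)"
    by (rule cSup_eq_maximum) (use y0 bounds(1) in \<open>auto simp: image_iff intro!: bexI[of _ "- y0"]\<close>)
  have I: "(INF y\<in>sphere 0 1. ray_integral s e ?f x y) = ray_integral s e ?f x y0"
    by (rule cInf_eq_minimum) (use y0 bounds(2) in auto)
  have i: "integrable lborel (\<lambda>q. levy_weight (2 * s) e q * v (r + q))" "integrable lborel (\<lambda>q. levy_weight (2 * s) e q * v (r - q))"
    using ray_integrable[OF f, of x y0] ray_integrable[OF f, of x "- y0"] unfolding pos neg by (simp_all add: y0 vabs)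
  have "levy_operator s e v r = C_frac s * (\<integral>q. levy_weight (2 * s) e q * v (r + q) - (- (levy_weight (2 * s) e q * v (r - q))) + (- 2 * v r) * levy_weight (2 * s) e q \<partial>lborel)"
    unfolding levy_operator_def by (simp add: algebra_simps)
  also have "\<dots> = C_frac s * (ray_integral s e ?f x y0 - (- ray_integral s e ?f x (- y0)) + (- 2 * v r) * levy_tail)"
    unfolding R0 levy_tail_integral(1)[symmetric]
    by (subst integral_lincomb) (use i levy_tail_integral(2) in auto)
  finally show "L_eps s e ?f x = levy_operator s e v (norm (x - x0))"
    unfolding L_eps_eq[OF f] S I r_def by (simp add: algebra_simps)
qed

end

section \<open>Time interpolation and the limit of the scheme\<close>

lemma interp_index:
  fixes t h :: real
  assumes "0 < t" "0 < h"
  defines "j \<equiv> nat (\<lceil>t / h\<rceil> - 1)"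
  shows "real j * h < t" "t \<le> real (Suc j) * h"
proof -
  have "0 < t / h" using assms by simp
  then have c: "1 \<le> \<lceil>t / h\<rceil>" by simp
  then have j: "real j = of_int \<lceil>t / h\<rceil> - 1" by (simp add: j_def)
  have "real j < t / h" "t / h \<le> real (Suc j)" unfolding of_nat_Suc j by linarith+
  then show "real j * h < t" "t \<le> real (Suc j) * h" using assms(2) by (simp_all add: field_simps)
qed

text \<open>The interpolant is a convex combination of the values at the two grid times enclosing
  \<open>t\<close>, and both lie within \<open>h\<close> of \<open>t\<close>.\<close>

lemma interp_scheme_ge:
  assumes t: "0 < t" and h: "0 < h"
    and "\<And>i. real i * h \<le> t + h \<Longrightarrow> \<bar>real i * h - t\<bar> \<le> h \<Longrightarrow> m \<le> scheme s e h u0 i x"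
  shows "m \<le> interp_scheme s e h u0 (x, t)"
proof -
  define j where "j = nat (\<lceil>t / h\<rceil> - 1)"
  note j = interp_index[OF t h, folded j_def]
  have U: "m \<le> scheme s e h u0 j x" "m \<le> scheme s e h u0 (Suc j) x"
    using j h by (intro assms(3); simp add: algebra_simps abs_le_iff)+
  have ab: "(real (Suc j) * h - t) / h + (t - real j * h) / h = 1"
    using h by (simp add: field_simps)
  have "m = (real (Suc j) * h - t) / h * m + (t - real j * h) / h * m"
    unfolding distrib_right[symmetric] ab by simp
  also have "\<dots> \<le> (real (Suc j) * h - t) / h * scheme s e h u0 j x + (t - real j * h) / h * scheme s e h u0 (Suc j) x"
    using j h U by (intro add_mono mult_left_mono divide_nonneg_pos) auto
  also have "\<dots> = interp_scheme s e h u0 (x, t)"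
    using t by (simp add: interp_scheme_def j_def Let_def del: scheme.simps)
  finally show ?thesis .
qed

lemma interp_scheme_le:
  assumes t: "0 < t" and h: "0 < h"
    and "\<And>i. real i * h \<le> t + h \<Longrightarrow> \<bar>real i * h - t\<bar> \<le> h \<Longrightarrow> scheme s e h u0 i x \<le> m"
  shows "interp_scheme s e h u0 (x, t) \<le> m"
proof -
  define j where "j = nat (\<lceil>t / h\<rceil> - 1)"
  note j = interp_index[OF t h, folded j_def]
  have U: "scheme s e h u0 j x \<le> m" "scheme s e h u0 (Suc j) x \<le> m"
    using j h by (intro assms(3); simp add: algebra_simps abs_le_iff)+
  have ab: "(real (Suc j) * h - t) / h + (t - real j * h) / h = 1"
    using h by (simp add: field_simps)
  have "interp_scheme s e h u0 (x, t) = (real (Suc j) * h - t) / h * scheme s e h u0 j x + (t - real j * h) / h * scheme s e h u0 (Suc j) x"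
    using t by (simp add: interp_scheme_def j_def Let_def del: scheme.simps)
  also have "\<dots> \<le> (real (Suc j) * h - t) / h * m + (t - real j * h) / h * m"
    using j h U by (intro add_mono mult_left_mono divide_nonneg_pos) auto
  also have "\<dots> = m"
    unfolding distrib_right[symmetric] ab by simp
  finally show ?thesis .
qed

context
  fixes s :: real
  assumes s: "1/2 < s" "s < 1"
begin

text \<open>In \<open>err\<close> the first term pays for moving from grid times to
  \<open>t\<close>, the second for at most (t + h)/h steps of the consistency defect. The flow is
  sampled at speed \<open>diffusivity s\<close> because the symbol of the operator is that multiple
  of |xi|^(2s).\<close>

lemma stable_flow_barrier_scheme:
  fixes u0 :: "real^'n \<Rightarrow> real"
  assumes g: "g \<in> borel_measurable borel" "\<And>\<xi>. \<bar>g \<xi>\<bar> \<le> M" and d: "0 < d"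
    and noninc: "\<And>T a b. d \<le> T \<Longrightarrow> 0 \<le> a \<Longrightarrow> a \<le> b \<Longrightarrow> stable_flow s g T b \<le> stable_flow s g T a"
    and u0: "BUC UNIV u0" and t: "0 < t"
    and e: "0 < e" and h: "0 < h" "h \<le> s / C_frac s * e powr (2 * s)"
  defines "err \<equiv> diffusivity s * h * (3 * M * symbol_mass s d)
      + (t + h) * (M * symbol_mass s d * ((diffusivity s)\<^sup>2 * h + 2 * C_frac s * (e powr (2 - 2 * s) / (2 - 2 * s))))"
  shows "(\<And>x. stable_flow s g d (norm (x - x0)) \<le> u0 x + c) \<Longrightarrow>
      stable_flow s g (d + diffusivity s * t) (norm (x - x0)) - c - err \<le> interp_scheme s e h u0 (x, t)"
    and "(\<And>x. u0 x \<le> stable_flow s g d (norm (x - x0)) + c) \<Longrightarrow>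
      interp_scheme s e h u0 (x, t) \<le> stable_flow s g (d + diffusivity s * t) (norm (x - x0)) + c + err"
proof -
  define k where "k = diffusivity s"
  have k: "0 < k" using diffusivity_pos[OF s] by (simp add: k_def)
  define E where "E = M * symbol_mass s d * (k\<^sup>2 * h + 2 * C_frac s * (e powr (2 - 2 * s) / (2 - 2 * s)))"
  have M: "0 \<le> M" using g(2)[of 0] by linarith
  have E: "0 \<le> E" unfolding E_def using M symbol_mass_nonneg[of s d] h C_frac_pos[of s] s
    by (intro mult_nonneg_nonneg add_nonneg_nonneg) auto
  define L where "L = 3 * M * symbol_mass s d"
  have L: "0 \<le> L" unfolding L_def using M symbol_mass_nonneg[of s d] by simp
  have err: "err = k * h * L + (t + h) * E" by (simp add: err_def k_def L_def E_def)
  define V where "V i x = stable_flow s g (d + k * (real i * h)) (norm (x - x0))" for i and x :: "real^'n"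
  have dT: "d \<le> d + k * (real i * h)" for i using k h by simp
  then have T: "0 < d + k * (real i * h)" for i using d by (meson less_le_trans)
  have Veq: "V i = (\<lambda>x. stable_flow s g (d + k * (real i * h)) (norm (x - x0)))" for i
    by (simp add: V_def fun_eq_iff)
  have rad: "bounded_continuous (V i)"
    "L_eps s e (V i) x = levy_operator s e (stable_flow s g (d + k * (real i * h))) (norm (x - x0))" for i x
    unfolding Veq
    by (rule L_eps_radial[OF s e stable_flow_continuous[OF s g T] stable_flow_minus stable_flow_bounded[OF s g T] noninc[OF dT]]; assumption)+
  have cons: "\<bar>V (Suc i) x - V i x - h * L_eps s e (V i) x\<bar> \<le> h * E" for i x
  proof -
    have "d + k * (real (Suc i) * h) = d + k * (real i * h) + k * h" by (simp add: algebra_simps)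
    then show ?thesis
      using stable_flow_consistent[OF s g d dT[of i] e h(1), of "norm (x - x0)"]
      unfolding rad(2) by (simp only: V_def k_def E_def)
  qed
  have near: "\<bar>V i x - stable_flow s g (d + k * t) (norm (x - x0))\<bar> \<le> k * h * L" if i: "\<bar>real i * h - t\<bar> \<le> h" for i
  proof -
    have le: "k * \<bar>real i * h - t\<bar> * L \<le> k * h * L" using i k L by (intro mult_right_mono mult_left_mono) auto
    have dt: "d \<le> d + k * t" using k t by simp
    show ?thesis
    proof (cases "real i * h \<le> t")
      case True
      then have "d + k * (real i * h) \<le> d + k * t" using k by simp
      from stable_flow_time_lipschitz[OF s g d dT this, of "norm (x - x0)"] le True
      show ?thesis by (simp add: V_def L_def[symmetric] right_diff_distrib)
    next
      case False
      then have "d + k * t \<le> d + k * (real i * h)" using k by simp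
      from stable_flow_time_lipschitz[OF s g d dt this, of "norm (x - x0)"] le False
      show ?thesis by (simp add: V_def L_def[symmetric] right_diff_distrib abs_minus_commute)
    qed
  qed
  have iE: "real i * (h * E) \<le> (t + h) * E" if "real i * h \<le> t + h" for i
    using mult_right_mono[OF that E] by (simp add: mult.assoc)
  note cmp = scheme_compare[where V = V, OF s e u0 h rad(1) cons]
  {
    assume a: "\<And>x. stable_flow s g d (norm (x - x0)) \<le> u0 x + c"
    have V0: "V 0 x \<le> u0 x + c" for x using a by (simp add: V_def)
    show "stable_flow s g (d + diffusivity s * t) (norm (x - x0)) - c - err \<le> interp_scheme s e h u0 (x, t)"
    proof (rule interp_scheme_ge[OF t h(1)])
      fix i assume i: "real i * h \<le> t + h" "\<bar>real i * h - t\<bar> \<le> h"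
      show "stable_flow s g (d + diffusivity s * t) (norm (x - x0)) - c - err \<le> scheme s e h u0 i x"
        using cmp(1)[OF V0, of i x] near[OF i(2)] iE[OF i(1)] unfolding err k_def[symmetric] abs_le_iff by linarith
    qed
  next
    assume a: "\<And>x. u0 x \<le> stable_flow s g d (norm (x - x0)) + c"
    have V0: "u0 x \<le> V 0 x + c" for x using a by (simp add: V_def)
    show "interp_scheme s e h u0 (x, t) \<le> stable_flow s g (d + diffusivity s * t) (norm (x - x0)) + c + err"
    proof (rule interp_scheme_le[OF t h(1)])
      fix i assume i: "real i * h \<le> t + h" "\<bar>real i * h - t\<bar> \<le> h"
      show "scheme s e h u0 i x \<le> stable_flow s g (d + diffusivity s * t) (norm (x - x0)) + c + err"
        using cmp(2)[OF V0, of i x] near[OF i(2)] iE[OF i(1)] unfolding err k_def[symmetric] abs_le_iff by linarith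
    qed
  }
qed

text \<open>Truncation and time step vanish along the sequence, so \<open>err\<close> does, and
  convergence at the single point \<open>(x, t)\<close> transfers the discrete bounds to
  \<open>u\<close>.\<close>

lemma stable_flow_barrier:
  fixes u0 :: "real^'n \<Rightarrow> real"
  assumes g: "g \<in> borel_measurable borel" "\<And>\<xi>. \<bar>g \<xi>\<bar> \<le> M" and d: "0 < d"
    and noninc: "\<And>T a b. d \<le> T \<Longrightarrow> 0 \<le> a \<Longrightarrow> a \<le> b \<Longrightarrow> stable_flow s g T b \<le> stable_flow s g T a"
    and u0: "BUC UNIV u0" and t: "0 < t"
    and u: "constructed_viscosity_solution s u0 u"
  shows "(\<And>x. stable_flow s g d (norm (x - x0)) \<le> u0 x + c) \<Longrightarrow>
      stable_flow s g (d + diffusivity s * t) (norm (x - x0)) - c \<le> u (x, t)"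
    and "(\<And>x. u0 x \<le> stable_flow s g d (norm (x - x0)) + c) \<Longrightarrow>
      u (x, t) \<le> stable_flow s g (d + diffusivity s * t) (norm (x - x0)) + c"
proof -
  obtain h and e :: "nat \<Rightarrow> real" where h: "\<forall>\<epsilon>>0. 0 < h \<epsilon> \<and> h \<epsilon> \<le> s / C_frac s * \<epsilon> powr (2 * s)"
    and e': "\<forall>k. 0 < e k" and e2: "e \<longlonglongrightarrow> 0"
    and lim: "\<forall>K. compact K \<and> K \<subseteq> UNIV \<times> {0..} \<longrightarrow>
      uniform_limit K (\<lambda>k. interp_scheme s (e k) (h (e k)) u0) u sequentially"
    using u unfolding constructed_viscosity_solution_def by (elim exE conjE) (rule that)
  have e: "0 < e k" for k using e' by blast
  have h: "0 < h (e k)" "h (e k) \<le> s / C_frac s * e k powr (2 * s)" for k using h e by blast+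
  have "uniform_limit {(x, t)} (\<lambda>k. interp_scheme s (e k) (h (e k)) u0) u sequentially"
    using lim[rule_format, of "{(x, t)}"] t by simp
  then have L: "(\<lambda>k. interp_scheme s (e k) (h (e k)) u0 (x, t)) \<longlonglongrightarrow> u (x, t)"
    by (rule tendsto_uniform_limitI) simp
  have ep: "(\<lambda>k. e k powr a) \<longlonglongrightarrow> 0" if "0 < a" for a
  proof -
    have "(\<lambda>k. e k powr a) \<longlonglongrightarrow> 0 powr a"
      using that by (intro tendsto_powr' e2 tendsto_const) (auto intro!: always_eventually less_imp_le e)
    then show ?thesis by simp
  qed
  \<comment> \<open>The CFL bound forces the time steps to 0 together with the truncation
    radius.\<close>
  have h0: "(\<lambda>k. h (e k)) \<longlonglongrightarrow> 0"
  proof (rule tendsto_sandwich[of "\<lambda>_. 0"])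
    show "(\<lambda>k. s / C_frac s * e k powr (2 * s)) \<longlonglongrightarrow> 0"
      by (rule tendsto_mult_right_zero[OF ep]) (use s in simp)
  qed (intro always_eventually allI h(2) less_imp_le[OF h(1)] tendsto_const)+
  define err where "err k = diffusivity s * h (e k) * (3 * M * symbol_mass s d)
      + (t + h (e k)) * (M * symbol_mass s d * ((diffusivity s)\<^sup>2 * h (e k) + 2 * C_frac s * (e k powr (2 - 2 * s) / (2 - 2 * s))))" for k
  have "err \<longlonglongrightarrow> diffusivity s * 0 * (3 * M * symbol_mass s d)
      + (t + 0) * (M * symbol_mass s d * ((diffusivity s)\<^sup>2 * 0 + 2 * C_frac s * (0 / (2 - 2 * s))))"
    unfolding err_def by (intro tendsto_intros h0 ep) (use s in auto)
  then have err: "err \<longlonglongrightarrow> 0" by simp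
  show "stable_flow s g (d + diffusivity s * t) (norm (x - x0)) - c \<le> u (x, t)"
    if a: "\<And>x. stable_flow s g d (norm (x - x0)) \<le> u0 x + c"
  proof (rule LIMSEQ_le[OF _ L])
    show "(\<lambda>k. stable_flow s g (d + diffusivity s * t) (norm (x - x0)) - c - err k)
       \<longlonglongrightarrow> stable_flow s g (d + diffusivity s * t) (norm (x - x0)) - c"
      using tendsto_diff[OF tendsto_const err] by simp
    have "stable_flow s g (d + diffusivity s * t) (norm (x - x0)) - c - err k \<le> interp_scheme s (e k) (h (e k)) u0 (x, t)" for k
      unfolding err_def by (rule stable_flow_barrier_scheme(1)[OF g d noninc u0 t e h a])
    then show "\<exists>N. \<forall>k\<ge>N. stable_flow s g (d + diffusivity s * t) (norm (x - x0)) - c - err k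
        \<le> interp_scheme s (e k) (h (e k)) u0 (x, t)" by blast
  qed
  show "u (x, t) \<le> stable_flow s g (d + diffusivity s * t) (norm (x - x0)) + c"
    if a: "\<And>x. u0 x \<le> stable_flow s g d (norm (x - x0)) + c"
  proof (rule LIMSEQ_le[OF L])
    show "(\<lambda>k. stable_flow s g (d + diffusivity s * t) (norm (x - x0)) + c + err k)
       \<longlonglongrightarrow> stable_flow s g (d + diffusivity s * t) (norm (x - x0)) + c"
      using tendsto_add[OF tendsto_const err] by simp
    have "interp_scheme s (e k) (h (e k)) u0 (x, t) \<le> stable_flow s g (d + diffusivity s * t) (norm (x - x0)) + c + err k" for k
      unfolding err_def by (rule stable_flow_barrier_scheme(2)[OF g d noninc u0 t e h a])
    then show "\<exists>N. \<forall>k\<ge>N. interp_scheme s (e k) (h (e k)) u0 (x, t)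
        \<le> stable_flow s g (d + diffusivity s * t) (norm (x - x0)) + c + err k" by blast
  qed
qed

end

section \<open>Barriers\<close>

text \<open>The transform of the indicator function of \<open>{- b..b}\<close>, except for the junk value 0 at \<open>\<xi> = 0\<close>.\<close>

definition window_symbol :: "real \<Rightarrow> real \<Rightarrow> real" where
  "window_symbol b \<xi> = 2 * sin (b * \<xi>) / \<xi>"

text \<open>Convolution of the kernel with the indicator function of
  \<open>{- b..b}\<close>.\<close>

definition window_mass :: "real \<Rightarrow> real \<Rightarrow> real \<Rightarrow> real \<Rightarrow> real" where
  "window_mass s b T x = (\<integral>y. indicator {x - b..x + b} y * stable_density s T y \<partial>lborel)"

lemma window_symbol_measurable [measurable]: "window_symbol b \<in> borel_measurable borel"
  unfolding window_symbol_def[abs_def] by measurable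

lemma window_symbol_le: "0 < b \<Longrightarrow> \<bar>window_symbol b \<xi>\<bar> \<le> 2 * b"
proof (cases "\<xi> = 0")
  case False
  assume "0 < b"
  have "\<bar>sin (b * \<xi>)\<bar> \<le> \<bar>b * \<xi>\<bar>" by (rule abs_sin_x_le_abs_x)
  then show ?thesis using False \<open>0 < b\<close> by (simp add: window_symbol_def abs_mult field_simps)
qed (simp add: window_symbol_def)

lemma integral_cos_window:
  assumes "0 < b" "\<xi> \<noteq> 0"
  shows "(\<integral>y. indicator {x - b..x + b} y * cos (y * \<xi>) \<partial>lborel) = cos (x * \<xi>) * window_symbol b \<xi>"
proof -
  have "(\<integral>y. cos (y * \<xi>) * indicator {x - b..x + b} y \<partial>lborel) = sin ((x + b) * \<xi>) / \<xi> - sin ((x - b) * \<xi>) / \<xi>"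
    by (rule integral_FTC_Icc_real) (use assms in \<open>auto intro!: derivative_eq_intros\<close>)
  also have "\<dots> = (sin ((x + b) * \<xi>) - sin ((x - b) * \<xi>)) / \<xi>" by (simp add: diff_divide_distrib)
  also have "sin ((x + b) * \<xi>) - sin ((x - b) * \<xi>) = 2 * cos (x * \<xi>) * sin (b * \<xi>)"
    by (simp add: distrib_right left_diff_distrib sin_add sin_diff)
  finally show ?thesis by (simp add: window_symbol_def mult.commute[of "indicator _ _"] mult.assoc)
qed

context
  fixes s :: real
  assumes s: "1/2 < s" "s < 1"
begin

lemma stable_flow_1: "stable_flow s (\<lambda>_. k) T x = k * (2 * pi) * stable_density s T x"
proof -
  have "stable_flow s (\<lambda>_. k) T x = k * cos_transform (stable_symbol s T) x"
    unfolding stable_flow_def cos_transform_def integral_mult_right_zero[symmetric] by (simp add: ac_simps)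
  then show ?thesis by (simp add: stable_density_def)
qed

text \<open>Fubini, with the cosine integral over the window evaluated for
  \<open>\<xi> \<noteq> 0\<close>. The integrands agree almost everywhere, which absorbs the junk
  value of \<open>window_symbol\<close> at 0.\<close>

lemma stable_flow_window:
  assumes b: "0 < b" and T: "0 < T"
  shows "stable_flow s (\<lambda>\<xi>. k * window_symbol b \<xi>) T x = k * (2 * pi) * window_mass s b T x"
proof -
  define F where "F = (\<lambda>y \<xi>. indicator {x - b..x + b} y * (cos (y * \<xi>) * stable_symbol s T \<xi>))"
  have m: "case_prod F \<in> borel_measurable (borel \<Otimes>\<^sub>M borel)" unfolding F_def by measurable
  have le: "\<bar>F y \<xi>\<bar> \<le> indicator {x - b..x + b} y * stable_symbol s T \<xi>" for y \<xi>
    unfolding F_def abs_mult by (intro mult_mono) (auto simp: mult_left_le_one_le)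
  have i1: "integrable lborel (\<lambda>y. indicat_real {x - b..x + b} y)"
    by (intro integrable_real_indicator) (auto simp: emeasure_lborel_Icc_eq)
  note fub = fubini_dominated(1)[OF m i1 stable_symbol_integrable(2)[OF s(1) T] le]
  have in1: "(\<integral>\<xi>. F y \<xi> \<partial>lborel) = 2 * pi * (indicator {x - b..x + b} y * stable_density s T y)" for y
    by (simp add: F_def stable_density_def cos_transform_def)
  have in2: "(\<integral>y. F y \<xi> \<partial>lborel) = cos (x * \<xi>) * (window_symbol b \<xi> * stable_symbol s T \<xi>)" if "\<xi> \<noteq> 0" for \<xi>
  proof -
    have "(\<integral>y. F y \<xi> \<partial>lborel) = (\<integral>y. indicator {x - b..x + b} y * cos (y * \<xi>) \<partial>lborel) * stable_symbol s T \<xi>"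
      unfolding F_def by (simp add: mult.assoc[symmetric])
    then show ?thesis unfolding integral_cos_window[OF b that] by simp
  qed
  have "(\<integral>\<xi>. cos (x * \<xi>) * (window_symbol b \<xi> * stable_symbol s T \<xi>) \<partial>lborel) = (\<integral>\<xi>. (\<integral>y. F y \<xi> \<partial>lborel) \<partial>lborel)"
  proof (rule integral_cong_AE)
    have "AE \<xi> in lborel. \<xi> \<noteq> (0::real)" by (rule AE_lborel_singleton)
    then show "AE \<xi> in lborel. cos (x * \<xi>) * (window_symbol b \<xi> * stable_symbol s T \<xi>) = (\<integral>y. F y \<xi> \<partial>lborel)"
      by eventually_elim (simp add: in2)
    show "(\<lambda>\<xi>. \<integral>y. F y \<xi> \<partial>lborel) \<in> borel_measurable lborel"
      unfolding F_def by measurable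
  qed measurable
  also have "\<dots> = 2 * pi * window_mass s b T x"
    using fub by (simp add: in1 window_mass_def)
  finally show ?thesis
    unfolding stable_flow_def cos_transform_def mult.assoc[of k] mult.left_commute[of _ k] integral_mult_right_zero by simp
qed

lemma stable_density_continuous: "0 < T \<Longrightarrow> continuous_on A (stable_density s T)"
  unfolding stable_density_def
  by (intro continuous_intros continuous_cos_transform stable_symbol_integrable s) auto

text \<open>The derivative in x is the density at x + b minus the density at x - b, nonpositive
  because |x - b| <= x + b for x >= 0.\<close>

lemma window_mass_noninc:
  assumes b: "0 < b" and T: "0 < T" and x: "0 \<le> x" "x \<le> x'"
  shows "window_mass s b T x' \<le> window_mass s b T x"
proof -
  \<comment> \<open>Large enough for every window centred in [0, x'] to lie in the interior of
    [-N, N].\<close>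
  define N where "N = x' + b + 1"
  obtain Q where Q: "\<And>y. y \<in> {-N..N} \<Longrightarrow> (Q has_vector_derivative stable_density s T y) (at y within {-N..N})"
    using antiderivative_continuous[OF stable_density_continuous[OF T, of "{-N..N}"]] by blast
  have D: "(Q has_real_derivative stable_density s T y) (at y)" if "-N < y" "y < N" for y
    using Q[of y] that at_within_Icc_at[of "-N" y N]
    by (simp add: has_real_derivative_iff_has_vector_derivative)
  have W: "window_mass s b T z = Q (z + b) - Q (z - b)" if "0 \<le> z" "z \<le> x'" for z
  proof -
    have "(\<integral>y. stable_density s T y * indicator {z - b..z + b} y \<partial>lborel) = Q (z + b) - Q (z - b)"
    proof (rule integral_FTC_Icc_real)
      show "isCont (stable_density s T) y" for y
        using stable_density_continuous[OF T, of UNIV] by (simp add: continuous_on_eq_continuous_at)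
    qed (use that b in \<open>auto intro!: D simp: N_def\<close>)
    then show ?thesis by (simp add: window_mass_def mult.commute)
  qed
  have "Q (x' + b) - Q (x' - b) \<le> Q (x + b) - Q (x - b)"
  proof (rule DERIV_nonpos_imp_nonincreasing[OF x(2)])
    fix z assume z: "x \<le> z" "z \<le> x'"
    have "((\<lambda>z. Q (z + b) - Q (z - b)) has_real_derivative stable_density s T (z + b) - stable_density s T (z - b)) (at z)"
    proof (rule DERIV_diff)
      have "((\<lambda>z. Q (z + b)) has_real_derivative stable_density s T (z + b) * 1) (at z)"
        using z x b by (intro DERIV_chain2[where f=Q] D) (auto intro!: derivative_eq_intros simp: N_def)
      then show "((\<lambda>z. Q (z + b)) has_real_derivative stable_density s T (z + b)) (at z)" by simp
      have "((\<lambda>z. Q (z - b)) has_real_derivative stable_density s T (z - b) * 1) (at z)"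
        using z x b by (intro DERIV_chain2[where f=Q] D) (auto intro!: derivative_eq_intros simp: N_def)
      then show "((\<lambda>z. Q (z - b)) has_real_derivative stable_density s T (z - b)) (at z)" by simp
    qed
    moreover have "stable_density s T (z + b) \<le> stable_density s T \<bar>z - b\<bar>"
      using z x b by (intro stable_density_noninc[OF s T]) auto
    ultimately show "\<exists>y. ((\<lambda>z. Q (z + b) - Q (z - b)) has_real_derivative y) (at z) \<and> y \<le> 0"
      by (intro exI[of _ "stable_density s T (z + b) - stable_density s T (z - b)"]) simp
  qed
  then show ?thesis using W[of x] W[of x'] x by simp
qed

lemma stable_density_mass:
  assumes T: "0 < T"
  shows "has_bochner_integral lborel (stable_density s T) 1"
proof -
  define q where "q = T powr (- 1 / (2 * s))"
  have q: "0 < q" using T by (simp add: q_def)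
  have i: "integrable lborel (\<lambda>x. q * stable_density s 1 (0 + q * x))"
    using stable_density_has_integral[OF s] q
    by (intro integrable_mult_right lborel_integrable_real_affine) (auto intro: integrable.intros)
  have "1 = q * (\<integral>x. stable_density s 1 (0 + q * x) \<partial>lborel)"
    using lborel_integral_real_affine[of q "stable_density s 1" 0] q
      has_bochner_integral_integral_eq[OF stable_density_has_integral[OF s]] by simp
  then have "(\<integral>x. q * stable_density s 1 (0 + q * x) \<partial>lborel) = 1" by simp
  with i have "has_bochner_integral lborel (\<lambda>x. q * stable_density s 1 (0 + q * x)) 1"
    by (simp add: has_bochner_integral_iff)
  then show ?thesis
    unfolding stable_density_scaling[OF s T, abs_def] q_def by simp
qed

lemma window_mass_integrable: "0 < T \<Longrightarrow> integrable lborel (\<lambda>y. indicator {c..d} y * stable_density s T y)"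
  using integrable_mult_indicator[OF _ integrable.intros[OF stable_density_mass], of "{c..d}" T] by simp

lemma window_mass_le_1: "0 < T \<Longrightarrow> window_mass s b T x \<le> 1"
  unfolding window_mass_def has_bochner_integral_integral_eq[OF stable_density_mass, symmetric]
  by (intro integral_mono window_mass_integrable integrable.intros[OF stable_density_mass])
    (auto simp: indicator_def stable_density_nonneg[OF s])

lemma window_mass_ge:
  assumes b: "0 < b" and T: "0 < T" and x: "0 \<le> x"
  shows "2 * b * stable_density s T (x + b) \<le> window_mass s b T x"
proof -
  have "2 * b * stable_density s T (x + b) = (\<integral>y. indicator {x - b..x + b} y * stable_density s T (x + b) \<partial>lborel)"
    using b by simp
  also have "\<dots> \<le> window_mass s b T x" unfolding window_mass_def
  proof (rule integral_mono[OF _ window_mass_integrable[OF T]])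
    show "integrable lborel (\<lambda>y. indicator {x - b..x + b} y * stable_density s T (x + b))"
      by (intro integrable_mult_left integrable_real_indicator) (auto simp: emeasure_lborel_Icc_eq)
    fix y
    have "stable_density s T (x + b) \<le> stable_density s T \<bar>y\<bar>" if "y \<in> {x - b..x + b}"
      using that x b by (intro stable_density_noninc[OF s T]) auto
    then show "indicator {x - b..x + b} y * stable_density s T (x + b) \<le> indicator {x - b..x + b} y * stable_density s T y"
      by (simp add: indicator_def)
  qed
  finally show ?thesis .
qed

text \<open>For x >= 2 b the window keeps distance b from 0, where the density is O(T) for small T.
  This measures how far the lower barrier sticks out over \<open>u0\<close> at its initial
  time.\<close>

lemma window_mass_le:
  assumes b: "0 < b" and T: "0 < T" and x: "2 * b \<le> x"
  shows "window_mass s b T x \<le> 2 * b * stable_density s T b"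
proof -
  have "window_mass s b T x \<le> (\<integral>y. indicator {x - b..x + b} y * stable_density s T b \<partial>lborel)"
    unfolding window_mass_def
  proof (rule integral_mono[OF window_mass_integrable[OF T]])
    show "integrable lborel (\<lambda>y. indicator {x - b..x + b} y * stable_density s T b)"
      by (intro integrable_mult_left integrable_real_indicator) (auto simp: emeasure_lborel_Icc_eq)
    fix y
    have "stable_density s T y \<le> stable_density s T b" if "y \<in> {x - b..x + b}"
      using that x b by (intro stable_density_noninc[OF s T]) auto
    then show "indicator {x - b..x + b} y * stable_density s T y \<le> indicator {x - b..x + b} y * stable_density s T b"
      by (simp add: indicator_def)
  qed
  also have "\<dots> = 2 * b * stable_density s T b" using b by simp
  finally show ?thesis .
qed

lemma solution_upper_bound:
  fixes u0 :: "real^'n \<Rightarrow> real"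
  assumes u0: "BUC UNIV u0"
    and decay: "\<And>x. R \<le> norm x \<Longrightarrow> u0 x \<le> (1 + (norm x)\<^sup>2) powr (- ((1 + 2 * s) / 2))"
  obtains K where "0 < K"
    "\<And>u x t. constructed_viscosity_solution s u0 u \<Longrightarrow> 0 < t \<Longrightarrow>
      u (x, t) \<le> K * stable_density s (1 + diffusivity s * t) (norm x)"
proof -
  obtain c C where c: "0 < c"
    and lo: "\<And>x. c * (1 + x\<^sup>2) powr (- ((1 + 2 * s) / 2)) \<le> stable_density s 1 x"
    by (rule stable_density_profile[OF s]) blast
  define b where "b = (1 + 2 * s) / 2"
  have b: "0 < b" using s by (simp add: b_def)
  obtain B where B: "\<And>x. \<bar>u0 x\<bar> \<le> B"
    using bounded_continuous_BUC[OF u0] by (auto simp: bounded_continuous_def)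
  have B0: "0 \<le> B" using B[of 0] by linarith
  \<comment> \<open>The 1 pays for |x| >= R and the second summand for |x| < R, where (1 +
    |x|^2)^(-b) is at least (1 + R^2)^(-b). Division by \<open>c\<close> passes to the kernel at
    time 1.\<close>
  define K where "K = (1 + B * (1 + R\<^sup>2) powr b) / c"
  have K: "0 < K" using c B0 by (simp add: K_def add_pos_nonneg)
  have init: "u0 x \<le> K * stable_density s 1 (norm x)" for x
  proof -
    have "u0 x \<le> (1 + B * (1 + R\<^sup>2) powr b) * (1 + (norm x)\<^sup>2) powr (- b)"
    proof (cases "R \<le> norm x")
      case True
      have "u0 x \<le> 1 * (1 + (norm x)\<^sup>2) powr (- b)" using decay[OF True] by (simp add: b_def)
      also have "\<dots> \<le> (1 + B * (1 + R\<^sup>2) powr b) * (1 + (norm x)\<^sup>2) powr (- b)"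
        using B0 by (intro mult_right_mono) auto
      finally show ?thesis .
    next
      case False
      then have "(norm x)\<^sup>2 \<le> R\<^sup>2" by (intro power_mono) auto
      then have "(1 + R\<^sup>2) powr (- b) \<le> (1 + (norm x)\<^sup>2) powr (- b)"
        using b by (intro powr_mono2') (auto simp: add_pos_nonneg)
      then have "B * (1 + R\<^sup>2) powr b * (1 + R\<^sup>2) powr (- b) \<le> B * (1 + R\<^sup>2) powr b * (1 + (norm x)\<^sup>2) powr (- b)"
        using B0 by (intro mult_left_mono) auto
      moreover have "B * (1 + R\<^sup>2) powr b * (1 + R\<^sup>2) powr (- b) = B"
        using add_pos_nonneg[of 1 "R\<^sup>2"] by (simp add: powr_minus)
      ultimately have "u0 x \<le> B * (1 + R\<^sup>2) powr b * (1 + (norm x)\<^sup>2) powr (- b)" using B[of x] by simp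
      then show ?thesis by (simp add: distrib_right add_increasing)
    qed
    also have "\<dots> = K * (c * (1 + (norm x)\<^sup>2) powr (- b))" using c by (simp add: K_def)
    also have "\<dots> \<le> K * stable_density s 1 (norm x)"
      using lo[of "norm x"] K by (intro mult_left_mono) (auto simp: b_def)
    finally show ?thesis .
  qed
  show ?thesis
  proof (rule that[OF K])
    fix u :: "(real^'n) \<times> real \<Rightarrow> real" and x :: "real^'n" and t :: real
    assume u: "constructed_viscosity_solution s u0 u" and t: "0 < t"
    let ?g = "\<lambda>_::real. K / (2 * pi)"
    have w: "stable_flow s ?g T y = K * stable_density s T y" for T y by (simp add: stable_flow_1)
    have "u (x, t) \<le> stable_flow s ?g (1 + diffusivity s * t) (norm (x - 0)) + 0"
    proof (rule stable_flow_barrier(2)[OF s _ _ _ _ u0 t u])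
      show "stable_flow s ?g T q \<le> stable_flow s ?g T p" if "1 \<le> T" "0 \<le> p" "p \<le> q" for T p q
        unfolding w using K that by (intro mult_left_mono stable_density_noninc[OF s]) auto
      show "\<bar>?g \<xi>\<bar> \<le> K / (2 * pi)" for \<xi> using K by simp
    qed (use init in \<open>auto simp: w\<close>)
    then show "u (x, t) \<le> K * stable_density s (1 + diffusivity s * t) (norm x)" by (simp add: w)
  qed
qed

text \<open>The barrier has height \<open>a\<close>, half of the positive value at
  \<open>x0\<close>, and \<open>u0\<close> stays above \<open>a\<close> on a ball. Outside the ball
  the barrier exceeds \<open>u0\<close> by at most \<open>P\<close>, which is O(d) by the upper
  kernel bound; \<open>P\<close> is subtracted and d tends to 0. The shifted time
  \<open>1 + diffusivity s * t\<close> in the denominator makes the estimate uniform in d <=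
  1.\<close>

lemma solution_lower_bound:
  fixes u0 :: "real^'n \<Rightarrow> real"
  assumes u0: "BUC UNIV u0" "\<And>x. 0 \<le> u0 x" and x0: "0 < u0 x0"
  obtains k b where "0 < k" "0 < b"
    "\<And>u x t. constructed_viscosity_solution s u0 u \<Longrightarrow> 0 < t \<Longrightarrow>
      k * (t / ((1 + diffusivity s * t) powr (1 / s) + (norm (x - x0) + b)\<^sup>2) powr ((1 + 2 * s) / 2)) \<le> u (x, t)"
proof -
  obtain c C where c: "0 < c" "0 < C"
    and lo: "\<And>t x. 0 < t \<Longrightarrow> c * (t / (t powr (1 / s) + x\<^sup>2) powr ((1 + 2 * s) / 2)) \<le> stable_density s t x"
    and up: "\<And>t x. 0 < t \<Longrightarrow> stable_density s t x \<le> C * (t / (t powr (1 / s) + x\<^sup>2) powr ((1 + 2 * s) / 2))"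
    by (rule stable_density_bounds[OF s]) blast
  define \<beta> where "\<beta> = (1 + 2 * s) / 2"
  have \<beta>: "0 < \<beta>" using s by (simp add: \<beta>_def)
  define a where "a = u0 x0 / 2"
  have a: "0 < a" using x0 by (simp add: a_def)
  have "continuous_on UNIV u0" using bounded_continuous_BUC[OF u0(1)] by (simp add: bounded_continuous_def)
  then have "isCont u0 x0" by (simp add: continuous_on_eq_continuous_at)
  then obtain r where r: "0 < r" "\<And>x. dist x x0 < r \<Longrightarrow> dist (u0 x) (u0 x0) < a"
    unfolding continuous_at_eps_delta using a by blast
  have ball: "a \<le> u0 x" if "norm (x - x0) < r" for x
  proof -
    have "\<bar>u0 x - u0 x0\<bar> < a" using r(2)[of x] that by (simp add: dist_norm)
    then have "u0 x0 - u0 x < a" by (simp add: abs_less_iff)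
    then show ?thesis using a_def by simp
  qed
  \<comment> \<open>Half the radius, so that outside the ball the window keeps distance b from the
    centre.\<close>
  define b where "b = r / 2"
  have b: "0 < b" using r by (simp add: b_def)
  define \<kappa> where "\<kappa> = diffusivity s"
  have \<kappa>: "0 < \<kappa>" using diffusivity_pos[OF s] by (simp add: \<kappa>_def)
  define k where "k = a * (2 * b) * c * \<kappa>"
  have k: "0 < k" using a b c \<kappa> by (simp add: k_def)
  show ?thesis
  proof (rule that[OF k b])
    fix u :: "(real^'n) \<times> real \<Rightarrow> real" and x :: "real^'n" and t :: real
    assume u: "constructed_viscosity_solution s u0 u" and t: "0 < t"
    define n where "n = norm (x - x0)"
    let ?A = "k * (t / ((1 + \<kappa> * t) powr (1 / s) + (n + b)\<^sup>2) powr \<beta>)"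
    \<comment> \<open>\<open>(b\<^sup>2) powr \<beta>\<close> is b^(1+2s): at distance b and time d
      the kernel is at most C d / b^(1+2s).\<close>
    define D where "D = a * (2 * b) * C / (b\<^sup>2) powr \<beta>"
    have main: "?A - D * d \<le> u (x, t)" if d: "0 < d" "d \<le> 1" for d
    proof -
      let ?g = "\<lambda>\<xi>. a / (2 * pi) * window_symbol b \<xi>"
      have w: "stable_flow s ?g T y = a * window_mass s b T y" if "0 < T" for T y
        using stable_flow_window[OF b that, of "a / (2 * pi)" y] by simp
      define P where "P = a * (2 * b * stable_density s d b)"
      have P0: "0 \<le> P" using a b stable_density_nonneg[OF s d(1)] by (simp add: P_def)
      have T: "0 < d + \<kappa> * t" using d \<kappa> t by (simp add: add_pos_pos)
      have "stable_flow s ?g (d + diffusivity s * t) (norm (x - x0)) - P \<le> u (x, t)"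
      proof (rule stable_flow_barrier(1)[OF s _ _ d(1) _ u0(1) t u])
        show "\<bar>?g \<xi>\<bar> \<le> a / (2 * pi) * (2 * b)" for \<xi>
          unfolding abs_mult using a window_symbol_le[OF b, of \<xi>] by (intro mult_mono) auto
        show "stable_flow s ?g T q \<le> stable_flow s ?g T p" if "d \<le> T" "0 \<le> p" "p \<le> q" for T p q
        proof -
          have T: "0 < T" using that d by simp
          show ?thesis
            unfolding w[OF T] using a that by (intro mult_left_mono window_mass_noninc b T) auto
        qed
        fix z
        have "a * window_mass s b d (norm (z - x0)) \<le> u0 z + P"
        proof (cases "norm (z - x0) < r")
          case True
          have "a * window_mass s b d (norm (z - x0)) \<le> a * 1"
            using a by (intro mult_left_mono window_mass_le_1 d) auto
          then show ?thesis using ball[OF True] P0 by simp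
        next
          case False
          then have "a * window_mass s b d (norm (z - x0)) \<le> P"
            unfolding P_def using a d by (intro mult_left_mono window_mass_le b) (auto simp: b_def)
          then show ?thesis using u0(2)[of z] by simp
        qed
        then show "stable_flow s ?g d (norm (z - x0)) \<le> u0 z + P"
          unfolding w[OF d(1)] .
      qed measurable
      then have 1: "a * window_mass s b (d + \<kappa> * t) n - P \<le> u (x, t)"
        using w[OF T] by (simp add: n_def \<kappa>_def)
      \<comment> \<open>Uniformity in \<open>d\<close>: the numerator is estimated by d > 0 and the
        denominator by d <= 1.\<close>
      have 2: "?A \<le> a * window_mass s b (d + \<kappa> * t) n"
      proof -
        have n: "0 \<le> n" by (simp add: n_def)
        have nb: "0 < (n + b)\<^sup>2" using n b by simp
        have "\<kappa> * t / ((1 + \<kappa> * t) powr (1 / s) + (n + b)\<^sup>2) powr \<beta>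
            \<le> (d + \<kappa> * t) / ((d + \<kappa> * t) powr (1 / s) + (n + b)\<^sup>2) powr \<beta>"
        proof (intro frac_le powr_mono2 add_mono)
          show "0 < ((d + \<kappa> * t) powr (1 / s) + (n + b)\<^sup>2) powr \<beta>"
            using add_nonneg_pos[OF powr_ge_zero[of "d + \<kappa> * t" "1 / s"] nb] by simp
        qed (use d T \<kappa> t s \<beta> in auto)
        then have "c * (\<kappa> * t / ((1 + \<kappa> * t) powr (1 / s) + (n + b)\<^sup>2) powr \<beta>)
            \<le> c * ((d + \<kappa> * t) / ((d + \<kappa> * t) powr (1 / s) + (n + b)\<^sup>2) powr \<beta>)"
          using c by (intro mult_left_mono) auto
        also have "\<dots> \<le> stable_density s (d + \<kappa> * t) (n + b)"
          using lo[OF T] by (simp add: \<beta>_def)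
        finally have "a * (2 * b * (c * (\<kappa> * t / ((1 + \<kappa> * t) powr (1 / s) + (n + b)\<^sup>2) powr \<beta>)))
            \<le> a * (2 * b * stable_density s (d + \<kappa> * t) (n + b))"
          using a b by (intro mult_left_mono) auto
        also have "\<dots> \<le> a * window_mass s b (d + \<kappa> * t) n"
          using a by (intro mult_left_mono window_mass_ge b T n) auto
        finally show ?thesis by (simp add: k_def ac_simps)
      qed
      have 3: "P \<le> D * d"
      proof -
        have "d / (d powr (1 / s) + b\<^sup>2) powr \<beta> \<le> d / (b\<^sup>2) powr \<beta>"
          using d b \<beta> add_nonneg_pos[OF powr_ge_zero[of d "1 / s"], of "b\<^sup>2"]
          by (intro divide_left_mono powr_mono2 mult_pos_pos) auto
        then have "C * (d / (d powr (1 / s) + b\<^sup>2) powr \<beta>) \<le> C * (d / (b\<^sup>2) powr \<beta>)"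
          using c by (intro mult_left_mono) auto
        then have "stable_density s d b \<le> C * (d / (b\<^sup>2) powr \<beta>)"
          using up[OF d(1), of b] by (simp add: \<beta>_def)
        then have "P \<le> a * (2 * b * (C * (d / (b\<^sup>2) powr \<beta>)))"
          unfolding P_def using a b by (intro mult_left_mono) auto
        then show ?thesis by (simp add: D_def ac_simps)
      qed
      show ?thesis using 1 2 3 by linarith
    qed
    \<comment> \<open>Along d = 1/(m+1) the subtracted constant vanishes.\<close>
    have "(\<lambda>m. ?A - D * (1 / real (Suc m))) \<longlonglongrightarrow> ?A - D * 0"
      by (intro tendsto_diff tendsto_mult tendsto_const LIMSEQ_Suc[OF lim_1_over_n])
    then have "?A \<le> u (x, t)"
      using main[of "1 / real (Suc _)"] by (intro LIMSEQ_le_const2) auto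
    then show "k * (t / ((1 + diffusivity s * t) powr (1 / s) + (norm (x - x0) + b)\<^sup>2) powr ((1 + 2 * s) / 2)) \<le> u (x, t)"
      by (simp add: n_def \<kappa>_def \<beta>_def)
  qed
qed

end

section \<open>From the barriers to two-sided bounds by the kernel at time t\<close>

theorem theorem2p13:
  fixes s R :: real and u0 :: "real^'n \<Rightarrow> real"
  assumes "CARD('n) \<ge> 2"
    and "1/2 < s" and "s < 1"
    and "BUC UNIV u0"
    and "\<exists>x. u0 x \<noteq> 0"
    and "R \<ge> 1"
    and "\<forall>x. 0 \<le> u0 x"
    and "\<forall>x. norm x \<ge> R \<longrightarrow> u0 x \<le> (1 + (norm x)\<^sup>2) powr (- ((1 + 2 * s) / 2))"
  shows "(\<forall>\<tau>>0. \<exists>C1>0. \<exists>C2>0. \<forall>u.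
            BUC (UNIV \<times> {0..}) u \<and> constructed_viscosity_solution s u0 u \<longrightarrow>
            (\<forall>x. \<forall>t\<ge>\<tau>. C1 * frac_heat_kernel s (norm x) t \<le> u (x, t) \<and>
                        u (x, t) \<le> C2 * frac_heat_kernel s (norm x) t)) \<and>
         (\<forall>\<tau>>0. \<exists>C1>0. \<exists>C2>0. \<forall>u.
            BUC (UNIV \<times> {0..}) u \<and> constructed_viscosity_solution s u0 u \<longrightarrow>
            (\<forall>x. \<forall>t\<ge>\<tau>.
               C1 * (t / (t powr (1 / s) + (norm x)\<^sup>2) powr ((1 + 2 * s) / 2)) \<le> u (x, t) \<and>
               u (x, t) \<le> C2 * (t / (t powr (1 / s) + (norm x)\<^sup>2) powr ((1 + 2 * s) / 2)))) \<and>
         (\<forall>\<tau>>0. \<forall>u.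
            BUC (UNIV \<times> {0..}) u \<and> constructed_viscosity_solution s u0 u \<longrightarrow>
            (\<forall>x. \<forall>t\<ge>\<tau>. 0 < u (x, t)))"
proof -
  note s = assms(2,3) and u0 = assms(4) and nonneg = assms(7) and decay = assms(8)
  define W :: "real \<Rightarrow> real^'n \<Rightarrow> real" where
    "W t x = t / (t powr (1 / s) + (norm x)\<^sup>2) powr ((1 + 2 * s) / 2)" for t x
  define \<kappa> where "\<kappa> = diffusivity s"
  have \<kappa>: "0 < \<kappa>" using diffusivity_pos[OF s] by (simp add: \<kappa>_def)
  have W_pos: "0 < W t x" if "0 < t" for t x
  proof -
    have "0 < t powr (1 / s) + (norm x)\<^sup>2" using that by (simp add: add_pos_nonneg)
    then show ?thesis using that unfolding W_def by (intro divide_pos_pos) (auto simp only: powr_gt_zero)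
  qed
  obtain c C where c: "0 < c" "0 < C"
    and lo: "\<And>t x. 0 < t \<Longrightarrow> c * W t x \<le> frac_heat_kernel s (norm x) t"
    and up: "\<And>t x. 0 < t \<Longrightarrow> frac_heat_kernel s (norm x) t \<le> C * W t x"
    unfolding W_def using stable_density_bounds[OF s] frac_heat_kernel_eq[OF s] by metis
  obtain K where K: "0 < K"
    and K_up: "\<And>u x t. constructed_viscosity_solution s u0 u \<Longrightarrow> 0 < t \<Longrightarrow>
      u (x, t) \<le> K * stable_density s (1 + \<kappa> * t) (norm x)"
    unfolding \<kappa>_def using solution_upper_bound[OF s u0] decay by metis
  obtain x0 where "0 < u0 x0" using assms(5) nonneg by (metis less_eq_real_def)
  then obtain k b where k: "0 < k" "0 < b"
    and k_lo: "\<And>u x t. constructed_viscosity_solution s u0 u \<Longrightarrow> 0 < t \<Longrightarrow>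
      k * (t / ((1 + \<kappa> * t) powr (1 / s) + (norm (x - x0) + b)\<^sup>2) powr ((1 + 2 * s) / 2)) \<le> u (x, t)"
    unfolding \<kappa>_def using solution_lower_bound[OF s u0] nonneg by metis
  \<comment> \<open>The constants precede the quantifier over \<open>u\<close>. They depend on
    \<tau>, whereas the barrier constants \<open>K\<close>, \<open>k\<close> and \<open>b\<close> do
    not.\<close>
  have W_bounds: "\<exists>C1>0. \<exists>C2>0. \<forall>u. constructed_viscosity_solution s u0 u \<longrightarrow>
      (\<forall>x. \<forall>t\<ge>\<tau>. C1 * W t x \<le> u (x, t) \<and> u (x, t) \<le> C2 * W t x)" if \<tau>: "0 < \<tau>" for \<tau>
  proof -
    \<comment> \<open>For t >= \<tau> the shifted time \<open>1 + \<kappa> * t\<close> is at most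
      \<open>q * t\<close>.\<close>
    define q where "q = 1 / \<tau> + \<kappa>"
    have q: "0 < q" using \<tau> \<kappa> by (simp add: q_def add_pos_pos)
    have qt: "1 + \<kappa> * t \<le> q * t" if "\<tau> \<le> t" for t
      using that \<tau> by (simp add: q_def distrib_right)
    obtain A where A: "0 < A" "\<And>x t. \<tau> \<le> t \<Longrightarrow> A * W t x \<le>
        k * (t / ((1 + \<kappa> * t) powr (1 / s) + (norm (x - x0) + b)\<^sup>2) powr ((1 + 2 * s) / 2))"
    proof -
      define d where "d = norm x0 + b"
      \<comment> \<open>The first summand absorbs the time shift, the second the displacement
        \<open>d\<close> of the centre, measured against t^(1/s) >= \<tau>^(1/s); the 2 comes from
        (|x| + d)^2 <= 2 |x|^2 + 2 d^2.\<close>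
      define Q where "Q = q powr (1 / s) + 2 * d\<^sup>2 / \<tau> powr (1 / s) + 2"
      have Q: "0 < Q" unfolding Q_def by (intro add_nonneg_pos add_nonneg_nonneg) auto
      have "k / Q powr ((1 + 2 * s) / 2) * W t x \<le>
        k * (t / ((1 + \<kappa> * t) powr (1 / s) + (norm (x - x0) + b)\<^sup>2) powr ((1 + 2 * s) / 2))"
        if t: "\<tau> \<le> t" for x t
      proof -
        have t0: "0 < t" using t \<tau> by simp
        have "(1 + \<kappa> * t) powr (1 / s) \<le> (q * t) powr (1 / s)"
          using qt[OF t] t0 \<kappa> s by (intro powr_mono2) auto
        then have 1: "(1 + \<kappa> * t) powr (1 / s) \<le> q powr (1 / s) * t powr (1 / s)"
          using q t0 by (simp add: powr_mult)
        have "norm (x - x0) + b \<le> norm x + d" using norm_triangle_ineq4[of x x0] by (simp add: d_def)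
        then have "(norm (x - x0) + b)\<^sup>2 \<le> (norm x + d)\<^sup>2" using k by (intro power_mono) auto
        also have "\<dots> \<le> 2 * (norm x)\<^sup>2 + 2 * d\<^sup>2"
          using zero_le_power2[of "norm x - d"] by (simp add: power2_sum power2_diff)
        finally have 2: "(norm (x - x0) + b)\<^sup>2 \<le> 2 * (norm x)\<^sup>2 + 2 * d\<^sup>2" .
        have "\<tau> powr (1 / s) \<le> t powr (1 / s)" using t \<tau> s by (intro powr_mono2) auto
        then have "2 * d\<^sup>2 / \<tau> powr (1 / s) * \<tau> powr (1 / s) \<le> 2 * d\<^sup>2 / \<tau> powr (1 / s) * t powr (1 / s)"
          by (intro mult_left_mono) auto
        then have 3: "2 * d\<^sup>2 \<le> 2 * d\<^sup>2 / \<tau> powr (1 / s) * t powr (1 / s)" using \<tau> by simp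
        have 4: "0 \<le> q powr (1 / s) * (norm x)\<^sup>2" "0 \<le> 2 * d\<^sup>2 / \<tau> powr (1 / s) * (norm x)\<^sup>2" "0 \<le> t powr (1 / s)"
          by simp_all
        have "(1 + \<kappa> * t) powr (1 / s) + (norm (x - x0) + b)\<^sup>2 \<le> Q * (t powr (1 / s) + (norm x)\<^sup>2)"
          using 1 2 3 4 unfolding Q_def distrib_right distrib_left by linarith
        then have "((1 + \<kappa> * t) powr (1 / s) + (norm (x - x0) + b)\<^sup>2) powr ((1 + 2 * s) / 2)
           \<le> (Q * (t powr (1 / s) + (norm x)\<^sup>2)) powr ((1 + 2 * s) / 2)"
          using s by (intro powr_mono2) auto
        also have "\<dots> = Q powr ((1 + 2 * s) / 2) * (t powr (1 / s) + (norm x)\<^sup>2) powr ((1 + 2 * s) / 2)"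
          using Q by (simp add: powr_mult)
        finally have le: "((1 + \<kappa> * t) powr (1 / s) + (norm (x - x0) + b)\<^sup>2) powr ((1 + 2 * s) / 2)
          \<le> Q powr ((1 + 2 * s) / 2) * (t powr (1 / s) + (norm x)\<^sup>2) powr ((1 + 2 * s) / 2)" .
        have "t / (Q powr ((1 + 2 * s) / 2) * (t powr (1 / s) + (norm x)\<^sup>2) powr ((1 + 2 * s) / 2))
           \<le> t / ((1 + \<kappa> * t) powr (1 / s) + (norm (x - x0) + b)\<^sup>2) powr ((1 + 2 * s) / 2)"
        proof -
          have "0 < t powr (1 / s) + (norm x)\<^sup>2" using t0 by (simp add: add_pos_nonneg)
          moreover have "0 < (1 + \<kappa> * t) powr (1 / s) + (norm (x - x0) + b)\<^sup>2"
            using add_pos_pos[of 1 "\<kappa> * t"] t0 \<kappa> by (intro add_pos_nonneg) auto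
          ultimately show ?thesis
            using le t0 Q by (intro divide_left_mono) (auto intro!: mult_pos_pos)
        qed
        then show ?thesis
          using mult_left_mono[of _ _ k] k by (fastforce simp: W_def)
      qed
      then show ?thesis using that[of "k / Q powr ((1 + 2 * s) / 2)"] k Q by simp
    qed
    obtain B where B: "0 < B" "\<And>x t. \<tau> \<le> t \<Longrightarrow> K * stable_density s (1 + \<kappa> * t) (norm x) \<le> B * W t x"
    proof -
      \<comment> \<open>The minimum serves the time term and the space term separately, so that p
        (t^(1/s) + |x|^2) stays below (1 + \<kappa> t)^(1/s) + |x|^2.\<close>
      define p where "p = min 1 (\<kappa> powr (1 / s))"
      have p: "0 < p" using \<kappa> by (simp add: p_def)
      have "K * stable_density s (1 + \<kappa> * t) (norm x) \<le> K * C * q / p powr ((1 + 2 * s) / 2) * W t x"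
        if t: "\<tau> \<le> t" for x :: "real^'n" and t
      proof -
        have t0: "0 < t" "0 < 1 + \<kappa> * t" using t \<tau> \<kappa> by (auto simp: add_pos_pos)
        have "p * t powr (1 / s) \<le> (1 + \<kappa> * t) powr (1 / s)"
        proof -
          have "p * t powr (1 / s) \<le> \<kappa> powr (1 / s) * t powr (1 / s)" by (intro mult_right_mono) (auto simp: p_def)
          also have "\<dots> = (\<kappa> * t) powr (1 / s)" using \<kappa> t0 by (simp add: powr_mult)
          also have "\<dots> \<le> (1 + \<kappa> * t) powr (1 / s)" using \<kappa> t0 s by (intro powr_mono2) auto
          finally show ?thesis .
        qed
        moreover have "p * (norm x)\<^sup>2 \<le> 1 * (norm x)\<^sup>2" by (intro mult_right_mono) (auto simp: p_def)
        ultimately have "p * (t powr (1 / s) + (norm x)\<^sup>2) \<le> (1 + \<kappa> * t) powr (1 / s) + (norm x)\<^sup>2"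
          by (simp add: distrib_left)
        then have "(p * (t powr (1 / s) + (norm x)\<^sup>2)) powr ((1 + 2 * s) / 2)
            \<le> ((1 + \<kappa> * t) powr (1 / s) + (norm x)\<^sup>2) powr ((1 + 2 * s) / 2)"
          using s p by (intro powr_mono2) auto
        moreover have "(p * (t powr (1 / s) + (norm x)\<^sup>2)) powr ((1 + 2 * s) / 2)
            = p powr ((1 + 2 * s) / 2) * (t powr (1 / s) + (norm x)\<^sup>2) powr ((1 + 2 * s) / 2)"
          using p by (simp add: powr_mult)
        moreover have "0 < t powr (1 / s) + (norm x)\<^sup>2" using t0 by (simp add: add_pos_nonneg)
        ultimately have W: "W (1 + \<kappa> * t) x \<le> q * t / (p powr ((1 + 2 * s) / 2) * (t powr (1 / s) + (norm x)\<^sup>2) powr ((1 + 2 * s) / 2))"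
          unfolding W_def using qt[OF t] t0 p q by (intro frac_le) auto
        have "stable_density s (1 + \<kappa> * t) (norm x) \<le> C * W (1 + \<kappa> * t) x"
          using up[OF t0(2), of x] frac_heat_kernel_eq[OF s t0(2)] by simp
        then have "K * stable_density s (1 + \<kappa> * t) (norm x) \<le> K * (C * W (1 + \<kappa> * t) x)"
          using K by (intro mult_left_mono) auto
        also have "\<dots> \<le> K * (C * (q * t / (p powr ((1 + 2 * s) / 2) * (t powr (1 / s) + (norm x)\<^sup>2) powr ((1 + 2 * s) / 2))))"
          using K c W by (intro mult_left_mono) auto
        finally show ?thesis by (simp add: W_def)
      qed
      then show ?thesis using that[of "K * C * q / p powr ((1 + 2 * s) / 2)"] K c q p by simp
    qed
    have "A * W t x \<le> u (x, t) \<and> u (x, t) \<le> B * W t x"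
      if u: "constructed_viscosity_solution s u0 u" and t: "\<tau> \<le> t" for u x t
    proof -
      have t0: "0 < t" using t \<tau> by simp
      show ?thesis
        using order_trans[OF A(2)[OF t] k_lo[OF u t0]] order_trans[OF K_up[OF u t0] B(2)[OF t]] by blast
    qed
    with A(1) B(1) show ?thesis by blast
  qed
  show ?thesis
    unfolding W_def[symmetric]
  proof (intro conjI allI impI)
    fix \<tau> :: real assume \<tau>: "0 < \<tau>"
    from W_bounds[OF \<tau>] obtain C1 C2 where C: "0 < C1" "0 < C2"
      and bd: "\<And>u x t. constructed_viscosity_solution s u0 u \<Longrightarrow> \<tau> \<le> t \<Longrightarrow> C1 * W t x \<le> u (x, t) \<and> u (x, t) \<le> C2 * W t x"
      by blast
    show "\<exists>C1>0. \<exists>C2>0. \<forall>u. BUC (UNIV \<times> {0..}) u \<and> constructed_viscosity_solution s u0 u \<longrightarrow>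
        (\<forall>x. \<forall>t\<ge>\<tau>. C1 * W t x \<le> u (x, t) \<and> u (x, t) \<le> C2 * W t x)"
      using C bd by blast
    \<comment> \<open>The kernel lies between \<open>c * W t x\<close> and \<open>C * W t x\<close>,
      so each constant is divided by the bound from the opposite side.\<close>
    have "C1 / C * frac_heat_kernel s (norm x) t \<le> u (x, t) \<and> u (x, t) \<le> C2 / c * frac_heat_kernel s (norm x) t"
      if u: "constructed_viscosity_solution s u0 u" and t: "\<tau> \<le> t" for u x t
    proof -
      have t0: "0 < t" using t \<tau> by simp
      have "C1 / C * frac_heat_kernel s (norm x) t \<le> C1 / C * (C * W t x)"
        using C c up[OF t0] by (intro mult_left_mono) auto
      moreover have "C2 / c * (c * W t x) \<le> C2 / c * frac_heat_kernel s (norm x) t"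
        using C c lo[OF t0] by (intro mult_left_mono) auto
      ultimately show ?thesis using bd[OF u t, of x] c by simp
    qed
    moreover have "0 < C1 / C" "0 < C2 / c" using C c by simp_all
    ultimately show "\<exists>C1>0. \<exists>C2>0. \<forall>u. BUC (UNIV \<times> {0..}) u \<and> constructed_viscosity_solution s u0 u \<longrightarrow>
        (\<forall>x. \<forall>t\<ge>\<tau>. C1 * frac_heat_kernel s (norm x) t \<le> u (x, t) \<and> u (x, t) \<le> C2 * frac_heat_kernel s (norm x) t)"
      by blast
    fix u :: "(real^'n) \<times> real \<Rightarrow> real" and x t
    assume "BUC (UNIV \<times> {0..}) u \<and> constructed_viscosity_solution s u0 u" and t: "\<tau> \<le> t"
    then have "C1 * W t x \<le> u (x, t)" using bd by blast
    moreover have "0 < C1 * W t x" using C W_pos[of t x] t \<tau> by simp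
    ultimately show "0 < u (x, t)" by linarith
  qed
qed

end
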